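(* Let $1<p<\infty$, and let $$\nu(r)=\exp\left(-\frac{\alpha}{(1-r^l)^\beta}\right)\quad\text{and}\quad\omega(r)=\exp\left(-\frac{\widetilde\alpha}{(1-r^{\widetilde l})^{\widetilde\beta}}\right),\quad0\le r<1,$$ where $0<\alpha,\widetilde\alpha,l,\widetilde l<\infty$ and $0<\beta,\widetilde\beta\le1$. Then $P_\omega:L^p_\nu\to L^p_\nu$ is bounded if and only if $\beta=\widetilde\beta$ and $\widetilde\alpha=\frac{2\alpha}p\left(\frac{\widetilde l}l\right)^\beta$.
   Context: Let $\mathbb{D}=\{z\in\mathbb{C}:|z|<1\}$, let $dA=\frac{dx\,dy}{\pi}$ be normalized area measure on $\mathbb{D}$, and let $\mathcal{H}(\mathbb{D})$ be the space of analytic functions in $\mathbb{D}$. A radial weight is a non-negative function $\omega\in L^1(\mathbb{D})$ with $\omega(z)=\omega(|z|)$ for all $z\in\mathbb{D}$; the functions $\nu,\omega$ of the statement are regarded as radial weights in this way. For $0<p<\infty$, $L^p_\omega$ is the space of complex-valued measurable $f$ on $\mathbb{D}$ with $\|f\|_{L^p_\omega}^p=\int_{\mathbb{D}}|f|^p\omega\,dA<\infty$, and $A^p_\omega=L^p_\omega\cap\mathcal{H}(\mathbb{D})$. $B^\omega_z\in A^2_\omega$ denotes the reproducing kernel of $A^2_\omega$ at $z\in\mathbb{D}$: $f(z)=\int_{\mathbb{D}}f(\zeta)\overline{B^\omega_z(\zeta)}\omega(\zeta)\,dA(\zeta)$ for all $f\in A^2_\omega$. Equivalently $B^\omega_z(\zeta)=\sum_{n=0}^\infty\frac{(\overline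 z\zeta)^n}{2\omega_{2n+1}}$, where $\omega_x=\int_0^1r^x\omega(r)\,dr$. The Bergman projection is $$P_\omega(f)(z)=\int_{\mathbb{D}}f(\zeta)\overline{B^\omega_z(\zeta)}\,\omega(\zeta)\,dA(\zeta),\quad z\in\mathbb{D};$$ boundedness $P_\omega:L^p_\nu\to L^p_\nu$ means that this is well defined for every $f\in L^p_\nu$ and $\|P_\omega(f)\|_{L^p_\nu}\le C\|f\|_{L^p_\nu}$ for some constant $C$. *)

theory Defs
  imports "HOL-Complex_Analysis.Complex_Analysis"
begin

text \<open>
  Functions on the unit disc are rendered as functions on all of \<open>complex\<close>; since the underlying
  space of \<open>disc_area\<close> is the open disc, values outside the disc never matter. Functions
  are not identified modulo null sets.
\<close>

abbreviation unit_disc :: "complex set" where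
  "unit_disc \<equiv> ball 0 1"

definition disc_area :: "complex measure" where
  "disc_area = density (lebesgue_on unit_disc) (\<lambda>_. ennreal (1 / pi))"

definition radial :: "(real \<Rightarrow> real) \<Rightarrow> complex \<Rightarrow> real" where
  "radial \<omega> z = \<omega> (cmod z)"

definition weighted_Lp :: "real \<Rightarrow> (complex \<Rightarrow> real) \<Rightarrow> (complex \<Rightarrow> complex) set" where
  "weighted_Lp p \<omega> =
     {f. f \<in> borel_measurable disc_area \<and> integrable disc_area (\<lambda>z. cmod (f z) powr p * \<omega> z)}"

definition weighted_Lp_norm :: "real \<Rightarrow> (complex \<Rightarrow> real) \<Rightarrow> (complex \<Rightarrow> complex) \<Rightarrow> real" where
  "weighted_Lp_norm p \<omega> f = (LINT z|disc_area. cmod (f z) powr p * \<omega> z) powr (1 / p)"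

definition bergman_space :: "real \<Rightarrow> (complex \<Rightarrow> real) \<Rightarrow> (complex \<Rightarrow> complex) set" where
  "bergman_space p \<omega> = {f \<in> weighted_Lp p \<omega>. f holomorphic_on unit_disc}"

definition reproducing_kernel_at ::
    "(complex \<Rightarrow> real) \<Rightarrow> complex \<Rightarrow> (complex \<Rightarrow> complex) \<Rightarrow> bool" where
  "reproducing_kernel_at \<omega> z B \<longleftrightarrow>
     B \<in> bergman_space 2 \<omega> \<and>
     (\<forall>f\<in>bergman_space 2 \<omega>.
        f z = (LINT \<zeta>|disc_area. f \<zeta> * cnj (B \<zeta>) * of_real (\<omega> \<zeta>)))"

text \<open>
  For \<open>z\<close> in the disc the reproducing kernel is determined uniquely on the disc; the choice operator
  only makes an arbitrary choice of its irrelevant values elsewhere.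
\<close>

definition bergman_kernel :: "(complex \<Rightarrow> real) \<Rightarrow> complex \<Rightarrow> complex \<Rightarrow> complex" where
  "bergman_kernel \<omega> z = (SOME B. reproducing_kernel_at \<omega> z B)"

definition bergman_projection ::
    "(complex \<Rightarrow> real) \<Rightarrow> (complex \<Rightarrow> complex) \<Rightarrow> complex \<Rightarrow> complex" where
  "bergman_projection \<omega> f z =
     (LINT \<zeta>|disc_area. f \<zeta> * cnj (bergman_kernel \<omega> z \<zeta>) * of_real (\<omega> \<zeta>))"

text \<open>
  Integrals of non-integrable functions are \<open>0\<close> in the library, so that the projection is well
  defined and maps into the space has to be required separately from the norm inequality.
\<close>

definition bergman_projection_bounded ::
    "(complex \<Rightarrow> real) \<Rightarrow> real \<Rightarrow> (complex \<Rightarrow> real) \<Rightarrow> bool" where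
  "bergman_projection_bounded \<omega> p \<nu> \<longleftrightarrow>
     (\<forall>f\<in>weighted_Lp p \<nu>. \<forall>z\<in>unit_disc.
        integrable disc_area (\<lambda>\<zeta>. f \<zeta> * cnj (bergman_kernel \<omega> z \<zeta>) * of_real (\<omega> \<zeta>))) \<and>
     (\<exists>C. \<forall>f\<in>weighted_Lp p \<nu>.
        bergman_projection \<omega> f \<in> weighted_Lp p \<nu> \<and>
        weighted_Lp_norm p \<nu> (bergman_projection \<omega> f) \<le> C * weighted_Lp_norm p \<nu> f)"

end

theory Submission
  imports Defs "HOL-Probability.Probability" "HOL-Real_Asymp.Real_Asymp"
begin

text \<open>
  In the variable \<open>t = - ln \<bar>z\<bar>\<close> normalized area has density \<open>2 exp (- 2 t)\<close>, and since
  \<open>(1 - exp (- w)) powr (- \<beta>)\<close> and \<open>w powr (- \<beta>)\<close> differ by at most 1 for \<open>\<beta> \<le> 1\<close>, each of the two weights is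
  comparable with some \<open>exp (- b t powr (- B))\<close>. The condition of the theorem says that \<open>\<nu>\<close> is comparable
  with \<open>\<omega> powr (p / 2)\<close>.

  Sufficiency: by Schur's test it is enough that
  \<open>\<omega>(z) powr (1/2) \<integral> \<bar>B\<^sub>z(w)\<bar> \<omega>(w) powr (1/2) dA(w)\<close> is bounded in \<open>z\<close>. Let \<open>s = \<bar>z\<bar> = exp (- t)\<close> and
  \<open>\<tau> = t powr (1 + B/2)\<close>. The Cauchy-Schwarz inequality with a weight that grows away from \<open>s\<close> at scale
  \<open>\<tau>\<close> in both directions reduces this to the \<open>L\<^sup>2\<close> norms of \<open>K(s w)\<close> and \<open>(w - s) K(s w)\<close>, where
  \<open>K(u) = \<Sum> u ^ n / m\<^sub>n\<close> with the even moments \<open>m\<^sub>n\<close>. By orthogonality these are sums over Taylor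
  coefficients; Laplace's method bounds \<open>m\<^sub>n\<close> below and the variance of \<open>r ^ (2 n) \<omega>\<close> about \<open>s\<close> above, and the
  \<open>n\<close>-th term is at most a constant times
  \<open>exp (b t powr (- B)) \<tau> / (1 + \<tau>\<^sup>2 (2 n + 2 - b B t powr (- B - 1))\<^sup>2)\<close>, which sums to \<open>O(1 / \<omega>(s))\<close>.

  Necessity: let \<open>\<theta>\<close> minimize \<open>2 n t + b t powr (- B)\<close>. Testing on \<open>z ^ n\<close> restricted to a thin annulus
  at \<open>t = (1 + \<eta>) \<theta>\<close> and letting \<open>n \<rightarrow> \<infinity>\<close> gives for every \<open>\<eta>\<close> an inequality between the two exponents that is
  an equality at \<open>\<eta> = 0\<close>; its derivative there must vanish.
\<close>

section \<open>Area measure\<close>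

text \<open>The obstacle to sufficiency is that the absolute value of the kernel must be integrated
  although only its Taylor coefficients are accessible. L^2 norms see nothing but coefficients, and
  decay away from s is encoded by the multiplier z - s: its effect is to subtract neighbouring
  coefficients, leaving s^n (m_{n+1} - s^2 m_n) / (m_n m_{n+1}). The bracket is the integral of r^2
  - s^2 against r^(2n) \<omega>, which is small when that measure is concentrated near s. Pointwise
  asymptotics of the kernel are thereby avoided. The scale \<tau> is, up to a constant, the inverse
  square root of the second derivative b B (B + 1) t^(-B-2) of the phase, the standard deviation of
  Laplace's method; the same scale serves for the angle. For necessity only the leading order of the
  exponents matters, so crude bounds that lose powers of n are good enough there. A weight with
  parameters \<alpha>, l, \<beta> has b = \<alpha> / l^\<beta> because r^l = exp (- l t); this
  produces the ratio of the two l in the condition.\<close>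

lemma borel_measurable_Complex [measurable]:
  assumes "f \<in> borel_measurable M" "g \<in> borel_measurable M"
  shows "(\<lambda>x. Complex (f x) (g x)) \<in> borel_measurable M"
  using assms by (simp add: Complex_eq)

section \<open>Rotation invariance of planar Lebesgue measure\<close>

lemma lborel_complex: "lborel = distr (lborel \<Otimes>\<^sub>M lborel) borel (\<lambda>(x, y). Complex x y)"
proof (rule lborel_eqI)
  fix l u :: complex
  assume lu: "\<And>b. b \<in> Basis \<Longrightarrow> l \<bullet> b \<le> u \<bullet> b"
  have le: "Re l \<le> Re u" "Im l \<le> Im u"
    using lu[of 1] lu[of \<i>] by (auto simp: Basis_complex_def)
  have "(\<lambda>(x, y). Complex x y) -` box l u \<inter> space (lborel \<Otimes>\<^sub>M lborel) =
      {Re l<..<Re u} \<times> {Im l<..<Im u}"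
    by (auto simp: box_def Basis_complex_def space_pair_measure)
  then have "emeasure (distr (lborel \<Otimes>\<^sub>M lborel) borel (\<lambda>(x, y). Complex x y)) (box l u) =
      emeasure (lborel \<Otimes>\<^sub>M lborel) ({Re l<..<Re u} \<times> {Im l<..<Im u})"
    by (subst emeasure_distr) auto
  also have "\<dots> = ennreal (Re u - Re l) * ennreal (Im u - Im l)"
    using le by (subst lborel.emeasure_pair_measure_Times) auto
  also have "\<dots> = (\<Prod>b\<in>Basis. (u - l) \<bullet> b)"
    using le by (simp add: Basis_complex_def ennreal_mult)
  finally show "emeasure (distr (lborel \<Otimes>\<^sub>M lborel) borel (\<lambda>(x, y). Complex x y)) (box l u) =
      (\<Prod>b\<in>Basis. (u - l) \<bullet> b)" .
qed simp

lemma nn_integral_lborel_complex: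
  assumes [measurable]: "f \<in> borel_measurable borel"
  shows "(\<integral>\<^sup>+z. f z \<partial>lborel) = (\<integral>\<^sup>+x. \<integral>\<^sup>+y. f (Complex x y) \<partial>lborel \<partial>lborel)"
  by (subst lborel_complex) (simp add: nn_integral_distr lborel.nn_integral_fst[symmetric] split_beta)

text \<open>A rotation is the product of the two shears \<open>(x, y) \<mapsto> (a x - b y, y)\<close> and
  \<open>(u, y) \<mapsto> (u, (b u + y) / a)\<close>, whose Jacobians \<open>a\<close> and \<open>1 / a\<close> cancel.\<close>

lemma nn_integral_lborel_rotate_aux:
  assumes [measurable]: "f \<in> borel_measurable borel" and c: "cmod c = 1" "Re c \<noteq> 0"
  shows "(\<integral>\<^sup>+z. f (c * z) \<partial>lborel) = (\<integral>\<^sup>+z. f z \<partial>lborel)"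
proof -
  define a b where "a = Re c" and "b = Im c"
  have a: "a \<noteq> 0" and ab: "a * a + b * b = 1"
    using c cmod_power2[of c] by (auto simp: a_def b_def power2_eq_square)
  have mult: "c * Complex x y = Complex (- b * y + a * x) ((b * (- b * y + a * x) + y) / a)" for x y
  proof -
    have "y = (a * a + b * b) * y"
      using ab by simp
    then have "y = a * (a * y) + b * (b * y)"
      by (simp add: algebra_simps)
    then show ?thesis
      using a by (simp add: complex_eq_iff flip: a_def b_def) (simp add: field_simps)
  qed
  have "(\<integral>\<^sup>+z. f (c * z) \<partial>lborel) = (\<integral>\<^sup>+y. \<integral>\<^sup>+x. f (c * Complex x y) \<partial>lborel \<partial>lborel)"
    by (subst nn_integral_lborel_complex) (auto intro!: lborel_pair.Fubini'[symmetric])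
  then have "ennreal \<bar>a\<bar> * (\<integral>\<^sup>+z. f (c * z) \<partial>lborel) =
      (\<integral>\<^sup>+y. ennreal \<bar>a\<bar> * (\<integral>\<^sup>+x. f (Complex (- b * y + a * x) ((b * (- b * y + a * x) + y) / a)) \<partial>lborel) \<partial>lborel)"
    by (simp only: mult) (subst nn_integral_cmult, auto)
  also have "\<dots> = (\<integral>\<^sup>+y. \<integral>\<^sup>+u. f (Complex u ((b * u + y) / a)) \<partial>lborel \<partial>lborel)"
  proof (rule nn_integral_cong)
    fix y :: real
    show "ennreal \<bar>a\<bar> * (\<integral>\<^sup>+x. f (Complex (- b * y + a * x) ((b * (- b * y + a * x) + y) / a)) \<partial>lborel) =
        (\<integral>\<^sup>+u. f (Complex u ((b * u + y) / a)) \<partial>lborel)"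
      using a nn_integral_real_affine[of "\<lambda>u. f (Complex u ((b * u + y) / a))" a "- b * y"] by simp
  qed
  also have "\<dots> = (\<integral>\<^sup>+u. \<integral>\<^sup>+y. f (Complex u (b * u / a + (1 / a) * y)) \<partial>lborel \<partial>lborel)"
    by (subst lborel_pair.Fubini') (auto simp: add_divide_distrib)
  also have "\<dots> = (\<integral>\<^sup>+u. ennreal \<bar>a\<bar> * (\<integral>\<^sup>+y. f (Complex u y) \<partial>lborel) \<partial>lborel)"
  proof (rule nn_integral_cong)
    fix u :: real
    have "ennreal \<bar>a\<bar> * (\<integral>\<^sup>+y. f (Complex u y) \<partial>lborel) = 
       ennreal \<bar>a\<bar> * (ennreal \<bar>1 / a\<bar> * (\<integral>\<^sup>+y. f (Complex u (b * u / a + (1 / a) * y)) \<partial>lborel))"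
      using a by (subst nn_integral_real_affine[where c = "1 / a" and t = "b * u / a"]) auto
    also have "\<dots> = (\<integral>\<^sup>+y. f (Complex u (b * u / a + (1 / a) * y)) \<partial>lborel)"
      using a by (simp add: mult.assoc[symmetric] flip: ennreal_mult)
    finally show "(\<integral>\<^sup>+y. f (Complex u (b * u / a + (1 / a) * y)) \<partial>lborel) =
        ennreal \<bar>a\<bar> * (\<integral>\<^sup>+y. f (Complex u y) \<partial>lborel)" ..
  qed
  also have "\<dots> = ennreal \<bar>a\<bar> * (\<integral>\<^sup>+z. f z \<partial>lborel)"
    by (simp add: nn_integral_cmult nn_integral_lborel_complex)
  finally show ?thesis
    using a by (simp add: ennreal_mult_cancel_left)
qed

lemma nn_integral_lborel_rotate:
  assumes [measurable]: "f \<in> borel_measurable borel" and c: "cmod c = 1"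
  shows "(\<integral>\<^sup>+z. f (c * z) \<partial>lborel) = (\<integral>\<^sup>+z. f z \<partial>lborel)"
proof (cases "Re c = 0")
  case True
  \<comment> \<open>The shears divide by the real part. A quarter turn is the square of a rotation
    by an eighth, to which they apply.\<close>
  define d where "d = csqrt c"
  have d: "d * d = c"
    using power2_csqrt[of c] by (simp add: d_def power2_eq_square)
  then have "cmod d ^ 2 = 1"
    using c by (metis norm_mult power2_eq_square)
  then have "cmod d = 1"
    by (simp add: power2_eq_1_iff) (smt (verit) norm_ge_zero)
  moreover have "Re d \<noteq> 0"
  proof
    assume "Re d = 0"
    then have "Re (d * d) = - (Im d)\<^sup>2" "(cmod d)\<^sup>2 = (Im d)\<^sup>2"
      using cmod_power2[of d] by (simp_all add: power2_eq_square)
    with True d \<open>cmod d ^ 2 = 1\<close> show False by simp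
  qed
  moreover have "f (c * z) = f (d * (d * z))" for z
    by (simp add: d mult.assoc[symmetric])
  ultimately show ?thesis
    using nn_integral_lborel_rotate_aux[of "\<lambda>z. f (d * z)" d] nn_integral_lborel_rotate_aux[of f d]
    by simp
qed (use nn_integral_lborel_rotate_aux c in auto)

lemma distr_lborel_rotate:
  assumes "cmod c = 1"
  shows "distr lborel lborel ((*) c) = lborel"
proof (rule measure_eqI)
  fix A assume "A \<in> sets (distr lborel lborel ((*) c))"
  then have [measurable]: "A \<in> sets borel" by simp
  have "emeasure (distr lborel lborel ((*) c)) A = (\<integral>\<^sup>+z. indicator A (c * z) \<partial>lborel)"
    by (subst nn_integral_indicator[symmetric], simp, subst nn_integral_distr) auto
  then show "emeasure (distr lborel lborel ((*) c)) A = emeasure lborel A"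
    using nn_integral_lborel_rotate[of "indicator A" c] assms by simp
qed simp

text \<open>Passing from Borel to Lebesgue sets requires that null sets have null preimages; the
  invariance of \<open>lborel\<close> supplies this.\<close>

lemma
  assumes "cmod c = 1"
  shows measurable_lebesgue_rotate: "(*) c \<in> lebesgue \<rightarrow>\<^sub>M lebesgue"
    and distr_lebesgue_rotate: "distr lebesgue lebesgue ((*) c) = lebesgue"
proof -
  have m: "(*) c \<in> lborel \<rightarrow>\<^sub>M lborel" by simp
  have eq: "distr lebesgue lborel ((*) c) = lborel"
    using distr_completion[OF m] distr_lborel_rotate[OF assms] by simp
  have m': "(*) c \<in> lebesgue \<rightarrow>\<^sub>M lborel" by (rule measurable_completion[OF m])
  show *: "(*) c \<in> lebesgue \<rightarrow>\<^sub>M lebesgue"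
    by (rule completion.measurable_completion2[OF m']) (simp add: eq)
  have "completion (distr lebesgue lborel ((*) c)) = distr lebesgue lebesgue ((*) c)"
    by (rule completion.completion_distr_eq[OF m']) (simp add: eq)
  then show "distr lebesgue lebesgue ((*) c) = lebesgue"
    by (simp add: eq)
qed

section \<open>Normalized area on the disc\<close>

lemma space_disc_area [simp]: "space disc_area = unit_disc"
  by (simp add: disc_area_def)

lemma sets_disc_area: "sets disc_area = sets (lebesgue_on unit_disc)"
  by (simp add: disc_area_def)

lemma measurable_disc_area_eq: "f \<in> disc_area \<rightarrow>\<^sub>M N \<longleftrightarrow> f \<in> lebesgue_on unit_disc \<rightarrow>\<^sub>M N"
  by (rule arg_cong[where f="\<lambda>S. f \<in> S"], rule measurable_cong_sets) (simp_all add: sets_disc_area)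

lemma measurable_ident_disc_area [measurable]: "(\<lambda>z. z) \<in> borel_measurable disc_area"
  unfolding measurable_disc_area_eq
  by (intro measurable_restrict_space1 measurable_completion) simp

lemma borel_measurable_disc_area: "f \<in> borel_measurable borel \<Longrightarrow> f \<in> borel_measurable disc_area"
  using measurable_compose[OF measurable_ident_disc_area] by simp

lemma borel_measurable_cnj [measurable]: "cnj \<in> borel_measurable borel"
  by (intro borel_measurable_continuous_onI continuous_intros)

lemma continuous_on_disc_measurable:
  fixes f :: "complex \<Rightarrow> 'a::euclidean_space"
  shows "continuous_on unit_disc f \<Longrightarrow> f \<in> borel_measurable disc_area"
  unfolding measurable_disc_area_eq by (rule continuous_imp_measurable_on_sets_lebesgue) auto

lemma borel_measurable_if_disc:
  fixes f :: "complex \<Rightarrow> 'a::euclidean_space"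
  shows "continuous_on unit_disc f \<Longrightarrow> (\<lambda>z. if z \<in> unit_disc then f z else 0) \<in> borel_measurable borel"
  using borel_measurable_continuous_on_indicator[of unit_disc f]
  by (auto simp: indicator_def elim!: measurable_cong[THEN iffD1, rotated])

lemma prob_space_disc_area: "prob_space disc_area"
proof
  have "emeasure (lebesgue_on unit_disc) unit_disc = ennreal pi"
    by (simp add: emeasure_restrict_space emeasure_ball unit_ball_vol_2)
  then show "emeasure disc_area (space disc_area) = 1"
    using nn_integral_cmult_indicator[of unit_disc "lebesgue_on unit_disc" "ennreal (1 / pi)"]
    sets.top[of "lebesgue_on unit_disc"]
    by (simp add: disc_area_def emeasure_density flip: ennreal_mult)
qed

interpretation disc_area: prob_space disc_area
  by (rule prob_space_disc_area)

lemma sets_disc_area_ball: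
  assumes "r \<le> 1"
  shows "ball 0 r \<in> sets disc_area"
proof -
  have "ball 0 r \<subseteq> unit_disc" using assms by auto
  then show ?thesis
    by (auto simp: sets_disc_area sets_restrict_space intro!: image_eqI[where x="ball 0 r"])
qed

lemma emeasure_disc_area_ball:
  assumes "0 \<le> r" "r \<le> 1"
  shows "emeasure disc_area (ball 0 r) = ennreal (r\<^sup>2)"
proof -
  have sub: "ball 0 r \<subseteq> unit_disc" using assms by auto
  have "ball 0 r \<in> sets (lebesgue_on unit_disc)"
    using sets_disc_area_ball assms by (simp add: sets_disc_area)
  then have "emeasure disc_area (ball 0 r) = ennreal (1/pi) * emeasure (lebesgue_on unit_disc) (ball 0 r)"
    by (simp add: disc_area_def emeasure_density nn_integral_cmult)
  also have "emeasure (lebesgue_on unit_disc) (ball 0 r) = ennreal (pi * r\<^sup>2)"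
    using sub assms by (simp add: emeasure_restrict_space emeasure_ball unit_ball_vol_2 DIM_complex)
  finally show ?thesis
    by (simp flip: ennreal_mult)
qed

lemma
  assumes c: "cmod c = 1"
  shows measurable_disc_area_rotate: "(*) c \<in> disc_area \<rightarrow>\<^sub>M disc_area"
    and distr_disc_area_rotate: "distr disc_area disc_area ((*) c) = disc_area"
proof -
  have m: "(*) c \<in> lebesgue_on unit_disc \<rightarrow>\<^sub>M lebesgue_on unit_disc"
    using measurable_lebesgue_rotate[OF c] c
    by (intro measurable_restrict_space3) (auto simp: norm_mult)
  then show m': "(*) c \<in> disc_area \<rightarrow>\<^sub>M disc_area"
    by (simp add: disc_area_def)
  show "distr disc_area disc_area ((*) c) = disc_area"
  proof (rule measure_eqI)
    fix A assume "A \<in> sets (distr disc_area disc_area ((*) c))"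
    then have A: "A \<in> sets (lebesgue_on unit_disc)" by (simp add: sets_disc_area)
    then have A': "A \<in> sets lebesgue" "A \<subseteq> unit_disc"
      by (auto simp: sets_restrict_space)
    have scal: "emeasure disc_area B = ennreal (1/pi) * emeasure lebesgue B"
      if "B \<in> sets lebesgue" "B \<subseteq> unit_disc" for B
    proof -
      have "B \<in> sets (lebesgue_on unit_disc)"
        using that by (auto simp: sets_restrict_space intro!: image_eqI[where x=B])
      then show ?thesis
        using that by (simp add: disc_area_def emeasure_density nn_integral_cmult emeasure_restrict_space del: emeasure_completion)
    qed
    have pre: "(*) c -` A \<inter> unit_disc = (*) c -` A"
      using A' c by (auto simp: norm_mult subset_iff)
    have "emeasure (distr disc_area disc_area ((*) c)) A = emeasure disc_area ((*) c -` A)"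
      using m' A pre by (simp add: emeasure_distr sets_disc_area)
    also have "\<dots> = ennreal (1/pi) * emeasure lebesgue ((*) c -` A)"
      using measurable_sets[OF measurable_lebesgue_rotate[OF c] A'(1)] pre by (intro scal) auto
    also have "emeasure lebesgue ((*) c -` A) = emeasure (distr lebesgue lebesgue ((*) c)) A"
      using measurable_lebesgue_rotate[OF c] A'(1)
      by (simp add: emeasure_distr del: emeasure_completion)
    also have "\<dots> = emeasure lebesgue A"
      using distr_lebesgue_rotate[OF c] by simp
    also have "ennreal (1/pi) * \<dots> = emeasure disc_area A"
      using scal[OF A'] by simp
    finally show "emeasure (distr disc_area disc_area ((*) c)) A = emeasure disc_area A" .
  qed simp
qed

lemma nn_integral_disc_area_rotate:
  assumes "f \<in> borel_measurable disc_area" "cmod c = 1"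
  shows "(\<integral>\<^sup>+z. f (c * z) \<partial>disc_area) = (\<integral>\<^sup>+z. f z \<partial>disc_area)"
  using nn_integral_distr[OF measurable_disc_area_rotate[OF assms(2)], of f] assms
  by (simp add: distr_disc_area_rotate)

lemma integral_disc_area_rotate:
  fixes f :: "complex \<Rightarrow> complex"
  assumes "f \<in> borel_measurable disc_area" "cmod c = 1"
  shows "(LINT z|disc_area. f (c * z)) = (LINT z|disc_area. f z)"
  using integral_distr[OF measurable_disc_area_rotate[OF assms(2)], of f] assms
  by (simp add: distr_disc_area_rotate)

lemma null_sets_disc_area_0: "{0} \<in> null_sets disc_area"
proof -
  have "{0} \<in> sets (lebesgue_on unit_disc)"
    by (auto simp: sets_restrict_space intro!: image_eqI[where x="{0}"])
  then show ?thesis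
    by (auto simp: disc_area_def null_sets_def emeasure_density nn_integral_cmult emeasure_restrict_space)
qed

lemma AE_disc_area_nonzero: "AE z in disc_area. z \<noteq> 0"
  using null_sets_disc_area_0 by (rule AE_I') auto

text \<open>The origin is exempted because the bounds on the weights are stated in the variable
  \<open>- ln (cmod z)\<close>, which says nothing about z = 0.\<close>

lemma AE_disc_areaI:
  assumes "\<And>z. z \<in> unit_disc \<Longrightarrow> z \<noteq> 0 \<Longrightarrow> P z"
  shows "AE z in disc_area. P z"
  using AE_disc_area_nonzero by (rule AE_mp) (use assms in \<open>auto intro!: AE_I2\<close>)

text \<open>The majorant is a product, so the single summable sequence \<open>a\<close> yields both
  the pointwise and the integrated summability.\<close>

lemma sums_integral_dominated:
  fixes g :: "nat \<Rightarrow> 'a \<Rightarrow> complex"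
  assumes [measurable]: "\<And>n. g n \<in> borel_measurable M" and f: "integrable M f" and a: "summable a"
    and le: "\<And>n x. x \<in> space M \<Longrightarrow> norm (g n x) \<le> a n * f x"
  shows "(\<lambda>n. integral\<^sup>L M (g n)) sums (LINT x|M. (\<Sum>n. g n x))"
proof -
  have int: "integrable M (g n)" for n
  proof (rule Bochner_Integration.integrable_bound[OF integrable_mult_right[OF f, of "a n"]])
    show "AE x in M. norm (g n x) \<le> norm (a n * f x)"
      using order.trans[OF le abs_ge_self] by (intro AE_I2) simp
  qed measurable
  show ?thesis
  proof (rule sums_integral[OF int])
    show "AE x in M. summable (\<lambda>n. norm (g n x))"
      using le by (intro AE_I2 summable_comparison_test'[OF summable_mult2[OF a]]) simp
    show "summable (\<lambda>n. LINT x|M. norm (g n x))"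
    proof (rule summable_comparison_test'[OF summable_mult2[OF a]])
      fix n
      have "(LINT x|M. norm (g n x)) \<le> (LINT x|M. a n * f x)"
        using le int f by (intro integral_mono integrable_norm integrable_mult_right) auto
      then show "norm (LINT x|M. norm (g n x)) \<le> a n * (LINT x|M. f x)"
        by simp
    qed
  qed
qed

text \<open>A replacement for polar coordinates: discs of radius exp (- a) have area exp (- 2 a), so
  - ln |z| is an exponential random variable, and integrals of radial functions become integrals
  against its density.\<close>

lemma distributed_disc_area: "distributed disc_area lborel (\<lambda>z. - ln (cmod z)) (exponential_density 2)"
proof (rule exponential_distributedI)
  fix a :: real assume a: "0 \<le> a"
  have iff: "- ln (cmod z) \<le> a \<longleftrightarrow> exp (- a) \<le> cmod z" if "z \<noteq> 0" for z
    using that by (subst ln_ge_iff[symmetric]) (auto simp: minus_le_iff)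
  have "{z \<in> space disc_area. - ln (cmod z) \<le> a} = (unit_disc - ball 0 (exp (- a))) \<union> {0}"
    (is "?L = ?R")
  proof (rule set_eqI)
    show "z \<in> ?L \<longleftrightarrow> z \<in> ?R" for z
      by (cases "z = 0") (auto simp: a iff not_less)
  qed
  moreover have meas: "ball 0 (exp (- a)) \<in> sets disc_area"
    using a by (intro sets_disc_area_ball) simp
  moreover have "unit_disc \<in> sets disc_area"
    using sets.top[of disc_area] by simp
  ultimately have "emeasure disc_area {z \<in> space disc_area. - ln (cmod z) \<le> a} = emeasure disc_area (unit_disc - ball 0 (exp (- a)))"
    using null_sets_disc_area_0 by (simp only: emeasure_Un_null_set sets.Diff)
  also have "\<dots> = emeasure disc_area unit_disc - emeasure disc_area (ball 0 (exp (- a)))"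
    using meas \<open>unit_disc \<in> sets disc_area\<close> a subset_ball[of "exp (- a)" 1 "0::complex"]
    by (intro emeasure_Diff) (auto simp: emeasure_disc_area_ball simp del: mem_ball)
  also have "\<dots> = 1 - ennreal (exp (- a * 2))"
    using a disc_area.emeasure_space_1
    by (simp add: emeasure_disc_area_ball ennreal_minus power2_eq_square flip: exp_add ennreal_1)
  finally show "emeasure disc_area {z \<in> space disc_area. - ln (cmod z) \<le> a} = 1 - ennreal (exp (- a * 2))" .
qed auto

lemma nn_integral_disc_area_radial:
  assumes [measurable]: "G \<in> borel_measurable borel"
  shows "(\<integral>\<^sup>+z. G (cmod z) \<partial>disc_area) =
    (\<integral>\<^sup>+t\<in>{0<..}. G (exp (- t)) * ennreal (2 * exp (- 2 * t)) \<partial>lborel)"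
proof -
  have "(\<integral>\<^sup>+z. G (cmod z) \<partial>disc_area) = (\<integral>\<^sup>+z. G (exp (- (- ln (cmod z)))) \<partial>disc_area)"
    using AE_disc_area_nonzero by (intro nn_integral_cong_AE) auto
  also have "\<dots> = (\<integral>\<^sup>+t. exponential_density 2 t * G (exp (- t)) \<partial>lborel)"
    by (rule distributed_nn_integral[OF distributed_disc_area, symmetric]) measurable
  also have "\<dots> = (\<integral>\<^sup>+t\<in>{0<..}. G (exp (- t)) * ennreal (2 * exp (- 2 * t)) \<partial>lborel)"
    using AE_lborel_singleton[of "0::real"]
    by (intro nn_integral_cong_AE) (auto simp: exponential_density_def mult_ac split: split_indicator)
  finally show ?thesis .
qed

section \<open>The Bergman kernel of a radial weight\<close>

text \<open>The rotation by the angle pi / (j - k) preserves area and changes the sign of the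
  integrand.\<close>

lemma integral_disc_area_eq_0:
  fixes f :: "complex \<Rightarrow> complex"
  assumes [measurable]: "f \<in> borel_measurable disc_area" and "j \<noteq> k"
    and f: "\<And>c z. cmod c = 1 \<Longrightarrow> z \<in> unit_disc \<Longrightarrow> f (c * z) = c ^ j * cnj c ^ k * f z"
  shows "(LINT z|disc_area. f z) = 0"
proof -
  define \<theta> where "\<theta> = pi / (real j - real k)"
  define c where "c = cis \<theta>"
  have c: "cmod c = 1" by (simp add: c_def)
  have "c ^ j * cnj c ^ k = cis ((real j - real k) * \<theta>)"
    by (simp add: c_def Complex.DeMoivre cis_cnj cis_mult) (simp add: algebra_simps)
  also have "(real j - real k) * \<theta> = pi"
    using \<open>j \<noteq> k\<close> by (simp add: \<theta>_def)
  finally have d: "c ^ j * cnj c ^ k = -1" by simp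
  have "(LINT z|disc_area. f z) = (LINT z|disc_area. f (c * z))"
    using c by (simp add: integral_disc_area_rotate)
  also have "\<dots> = (LINT z|disc_area. - f z)"
    using f[OF c] by (intro Bochner_Integration.integral_cong) (auto simp: d)
  finally show ?thesis by simp
qed

locale radial_weight =
  fixes \<omega> :: "real \<Rightarrow> real"
  assumes borel_measurable_weight [measurable]: "(\<lambda>z. \<omega> (cmod z)) \<in> borel_measurable disc_area"
    and integrable_weight: "integrable disc_area (\<lambda>z. \<omega> (cmod z))"
    and weight_pos: "0 \<le> r \<Longrightarrow> r < 1 \<Longrightarrow> 0 < \<omega> r"
begin

lemma weight_nonneg: "z \<in> unit_disc \<Longrightarrow> 0 \<le> \<omega> (cmod z)"
  using weight_pos[of "cmod z"] by simp

lemma integrable_bounded_mult_weight: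
  fixes g :: "complex \<Rightarrow> 'a::{real_normed_algebra_1, second_countable_topology, banach}"
  assumes [measurable]: "g \<in> borel_measurable disc_area"
    and g: "\<And>z. z \<in> unit_disc \<Longrightarrow> norm (g z) \<le> C"
  shows "integrable disc_area (\<lambda>z. g z * of_real (\<omega> (cmod z)))"
proof (rule Bochner_Integration.integrable_bound[OF integrable_mult_right[OF integrable_weight, of C]])
  show "AE z in disc_area. norm (g z * of_real (\<omega> (cmod z))) \<le> norm (C * \<omega> (cmod z))"
  proof (rule AE_I2)
    fix z assume z: "z \<in> space disc_area"
    then have "norm (g z * of_real (\<omega> (cmod z))) \<le> norm (g z) * norm (of_real (\<omega> (cmod z)) :: 'a)"
      by (intro norm_mult_ineq)
    also have "\<dots> \<le> C * \<omega> (cmod z)"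
      using g[of z] weight_nonneg[of z] z order.trans[OF norm_ge_zero g[of z]] by (auto intro!: mult_mono)
    finally show "norm (g z * of_real (\<omega> (cmod z))) \<le> norm (C * \<omega> (cmod z))"
      by simp
  qed
qed measurable

text \<open>In polar coordinates this is 2 \<omega>_{2n+1}, the squared norm of z^n in the weighted
  Bergman space and hence the denominator in the kernel series.\<close>

definition moment :: "nat \<Rightarrow> real" where
  "moment n = (LINT z|disc_area. cmod z ^ (2 * n) * \<omega> (cmod z))"

lemma integrable_moment: "integrable disc_area (\<lambda>z. cmod z ^ n * \<omega> (cmod z))"
  using integrable_bounded_mult_weight[of "\<lambda>z. cmod z ^ n" 1]
  by (auto simp: power_le_one)

text \<open>Only the mass of the weight outside the disc of radius \<open>\<rho>\<close> is kept. It
  is positive since that disc has area \<open>\<rho>\<^sup>2\<close> < 1. As \<open>\<rho>\<close>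
  may be close to 1, the kernel series converges on the whole disc.\<close>

lemma moment_lower_bound:
  assumes "0 < \<rho>" "\<rho> < 1"
  obtains c where "0 < c" "\<And>n. c * \<rho> ^ (2 * n) \<le> moment n"
proof
  define f where "f z = indicator {z. \<rho> \<le> cmod z} z * \<omega> (cmod z)" for z
  have [measurable]: "f \<in> borel_measurable disc_area"
    unfolding f_def by measurable
  have f: "integrable disc_area f"
    using integrable_bounded_mult_weight[of "indicator {z. \<rho> \<le> cmod z} :: complex \<Rightarrow> real" 1]
    by (simp add: f_def[abs_def])
  have f_nonneg: "0 \<le> f z" if "z \<in> unit_disc" for z
    using weight_nonneg[OF that] by (simp add: f_def)
  have "integral\<^sup>L disc_area f \<noteq> 0"
  proof
    assume "integral\<^sup>L disc_area f = 0"
    then have "AE z in disc_area. f z = 0"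
      using integral_nonneg_eq_0_iff_AE[OF f] AE_I2[of disc_area "\<lambda>z. 0 \<le> f z"] f_nonneg by simp
    then have "AE z in disc_area. z \<in> ball 0 \<rho>"
    proof (rule AE_mp, intro AE_I2 impI)
      fix z assume "z \<in> space disc_area" "f z = 0"
      then show "z \<in> ball 0 \<rho>"
        using weight_pos[of "cmod z"] by (cases "\<rho> \<le> cmod z") (auto simp: f_def)
    qed
    moreover have "ball 0 \<rho> \<in> sets disc_area"
      using assms by (simp add: sets_disc_area_ball)
    ultimately have "emeasure disc_area (ball 0 \<rho>) = 1"
      by (subst disc_area.emeasure_eq_1_AE) auto
    then show False
      using assms by (simp add: emeasure_disc_area_ball power2_eq_1_iff del: ennreal_1 flip: ennreal_1)
  qed
  moreover have "0 \<le> integral\<^sup>L disc_area f"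
    using f_nonneg by (intro Bochner_Integration.integral_nonneg) simp
  ultimately show "0 < integral\<^sup>L disc_area f" by simp
  show "integral\<^sup>L disc_area f * \<rho> ^ (2 * n) \<le> moment n" for n
    unfolding moment_def Bochner_Integration.integral_mult_left_zero[symmetric]
  proof (intro integral_mono integrable_moment integrable_mult_left f)
    fix z assume z: "z \<in> space disc_area"
    show "f z * \<rho> ^ (2 * n) \<le> cmod z ^ (2 * n) * \<omega> (cmod z)"
      using weight_nonneg[of z] z assms
      by (auto simp: f_def indicator_def mult.commute intro!: mult_left_mono power_mono)
  qed
qed

lemma moment_pos: "0 < moment n"
proof -
  obtain c :: real where "0 < c" "\<And>n. c * (1/2) ^ (2 * n) \<le> moment n"
    by (rule moment_lower_bound[of "1/2"]) auto
  then show ?thesis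
    by (intro less_le_trans[of 0 "c * (1/2) ^ (2 * n)" "moment n"]) auto
qed

lemma abs_moment [simp]: "\<bar>moment n\<bar> = moment n"
  using moment_pos[of n] by simp

lemma summable_kernel:
  assumes "0 \<le> x" "x < 1"
  shows "summable (\<lambda>n. x ^ n / moment n)"
proof -
  \<comment> \<open>Chosen so that x < \<open>\<rho>\<^sup>2\<close> < 1, which makes the comparison
    series geometric with ratio below 1.\<close>
  define \<rho> where "\<rho> = sqrt ((1 + x) / 2)"
  have \<rho>: "0 < \<rho>" "\<rho> < 1" "x < \<rho>\<^sup>2"
    using assms by (auto simp: \<rho>_def real_less_lsqrt)
  obtain c where c: "0 < c" "\<And>n. c * \<rho> ^ (2 * n) \<le> moment n"
    using moment_lower_bound[OF \<rho>(1,2)] by blast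
  show ?thesis
  proof (rule summable_comparison_test')
    show "summable (\<lambda>n. (x / \<rho>\<^sup>2) ^ n / c)"
      using \<rho> assms by (intro summable_divide summable_geometric) auto
    show "norm (x ^ n / moment n) \<le> (x / \<rho>\<^sup>2) ^ n / c" for n
    proof -
      have "x ^ n / moment n \<le> x ^ n / (c * \<rho> ^ (2 * n))"
        using c \<rho> assms moment_pos[of n] by (intro divide_left_mono) auto
      also have "\<dots> = (x / \<rho>\<^sup>2) ^ n / c"
        by (simp add: power_divide power_mult)
      finally show ?thesis
        using assms moment_pos[of n] by simp
    qed
  qed
qed

section \<open>The kernel as a power series\<close>

definition kernel :: "complex \<Rightarrow> complex" where
  "kernel u = (\<Sum>n. u ^ n / of_real (moment n))"

lemma summable_norm_kernel:
  assumes "cmod u < 1"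
  shows "summable (\<lambda>n. norm (u ^ n / of_real (moment n)))"
  using summable_kernel[of "cmod u"] assms
  by (simp add: norm_divide norm_power)

lemma kernel_sums:
  assumes "cmod u < 1"
  shows "(\<lambda>n. u ^ n / of_real (moment n)) sums kernel u"
  unfolding kernel_def
  by (rule summable_sums[OF summable_norm_cancel[OF summable_norm_kernel[OF assms]]])

lemma kernel_bound:
  assumes "cmod u \<le> x" "x < 1"
  shows "cmod (kernel u) \<le> (\<Sum>n. x ^ n / moment n)"
proof -
  have "cmod (kernel u) \<le> (\<Sum>n. norm (u ^ n / of_real (moment n)))"
    unfolding kernel_def using assms by (intro summable_norm summable_norm_kernel) simp
  also have "\<dots> \<le> (\<Sum>n. x ^ n / moment n)"
    using assms moment_pos[THEN less_imp_le]
    by (intro suminf_le summable_norm_kernel summable_kernel order.trans[OF norm_ge_zero assms(1)])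
      (auto simp: norm_divide norm_power intro!: divide_right_mono power_mono)
  finally show ?thesis .
qed

lemma holomorphic_kernel: "kernel holomorphic_on unit_disc"
proof (rule power_series_holomorphic[where a = "\<lambda>n. 1 / of_real (moment n)"])
  show "(\<lambda>n. 1 / of_real (moment n) * (w - 0) ^ n) sums kernel w" if "w \<in> unit_disc" for w
    using kernel_sums[of w] that by simp
qed

lemma kernel_cnj:
  assumes "cmod u < 1"
  shows "cnj (kernel u) = kernel (cnj u)"
proof (rule sums_unique2)
  show "(\<lambda>n. cnj (u ^ n / of_real (moment n))) sums cnj (kernel u)"
    unfolding sums_cnj using kernel_sums[OF assms] .
  show "(\<lambda>n. cnj (u ^ n / of_real (moment n))) sums kernel (cnj u)"
    using kernel_sums[of "cnj u"] assms by simp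
qed

lemma norm_mult_less_one: "z \<in> unit_disc \<Longrightarrow> w \<in> unit_disc \<Longrightarrow> cmod (z * w) < 1"
  using mult_strict_mono'[of "cmod z" 1 "cmod w" 1] by (simp add: norm_mult)

lemma holomorphic_kernel_mult:
  assumes "cmod z < 1"
  shows "(\<lambda>w. kernel (z * w)) holomorphic_on unit_disc"
proof -
  have "(kernel \<circ> (*) z) holomorphic_on unit_disc"
    using assms norm_mult_less_one[of z]
    by (intro holomorphic_on_compose_gen[OF _ holomorphic_kernel]) (auto intro!: holomorphic_intros)
  then show ?thesis by (simp add: o_def)
qed

lemma borel_measurable_kernel_mult:
  assumes "cmod z < 1"
  shows "(\<lambda>w. kernel (z * w)) \<in> borel_measurable disc_area"
  using holomorphic_kernel_mult[OF assms]
  by (intro continuous_on_disc_measurable holomorphic_on_imp_continuous_on)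

text \<open>Stated for all f that are integrable against \<omega>, because it serves the functions
  of A^2 in the reproducing property and the truncated monomials in the necessity part.\<close>

lemma integral_kernel_sums:
  fixes f :: "complex \<Rightarrow> complex"
  assumes z: "cmod z < 1" and [measurable]: "f \<in> borel_measurable disc_area"
    and f: "integrable disc_area (\<lambda>w. cmod (f w) * \<omega> (cmod w))"
  shows "(\<lambda>n. z ^ n / of_real (moment n) * (LINT w|disc_area. f w * cnj w ^ n * of_real (\<omega> (cmod w))))
    sums (LINT w|disc_area. f w * cnj (kernel (cnj z * w)) * of_real (\<omega> (cmod w)))"
proof -
  define g where "g n w = z ^ n / of_real (moment n) * (f w * cnj w ^ n * of_real (\<omega> (cmod w)))" for n w
  have [measurable]: "g n \<in> borel_measurable disc_area" for n
    unfolding g_def by measurable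
  have norm_g: "norm (g n w) \<le> (cmod z ^ n / moment n) * (cmod (f w) * \<omega> (cmod w))" if "w \<in> unit_disc" for n w
  proof -
    have "cmod w ^ n \<le> 1" using that by (simp add: power_le_one)
    then have "cmod (f w) * \<omega> (cmod w) * cmod w ^ n \<le> cmod (f w) * \<omega> (cmod w)"
      using weight_nonneg[OF that] by (intro mult_left_le) auto
    then have "(cmod z ^ n / moment n) * (cmod (f w) * \<omega> (cmod w) * cmod w ^ n) \<le> (cmod z ^ n / moment n) * (cmod (f w) * \<omega> (cmod w))"
      using moment_pos[of n] by (intro mult_left_mono) auto
    then show ?thesis
      using weight_nonneg[OF that] moment_pos[of n]
      by (simp add: g_def norm_mult norm_divide norm_power mult_ac)
  qed
  have "(\<lambda>n. integral\<^sup>L disc_area (g n)) sums (LINT w|disc_area. (\<Sum>n. g n w))"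
    using norm_g z by (intro sums_integral_dominated[OF _ f summable_kernel]) auto
  moreover have "(LINT w|disc_area. (\<Sum>n. g n w)) = (LINT w|disc_area. f w * cnj (kernel (cnj z * w)) * of_real (\<omega> (cmod w)))"
  proof (rule Bochner_Integration.integral_cong)
    fix w assume w: "w \<in> space disc_area"
    have "(\<lambda>n. (z * cnj w) ^ n / of_real (moment n) * (f w * of_real (\<omega> (cmod w)))) sums (kernel (z * cnj w) * (f w * of_real (\<omega> (cmod w))))"
      using w z norm_mult_less_one[of z "cnj w"] by (intro sums_mult2 kernel_sums) auto
    moreover have "(\<lambda>n. (z * cnj w) ^ n / of_real (moment n) * (f w * of_real (\<omega> (cmod w)))) = (\<lambda>n. g n w)"
      by (simp add: g_def power_mult_distrib fun_eq_iff)
    ultimately have "(\<lambda>n. g n w) sums (kernel (z * cnj w) * (f w * of_real (\<omega> (cmod w))))"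
      by simp
    then show "(\<Sum>n. g n w) = f w * cnj (kernel (cnj z * w)) * of_real (\<omega> (cmod w))"
      using w z norm_mult_less_one[of "cnj z" w] by (simp add: sums_iff kernel_cnj)
  qed simp
  ultimately have "(\<lambda>n. integral\<^sup>L disc_area (g n)) sums
      (LINT w|disc_area. f w * cnj (kernel (cnj z * w)) * of_real (\<omega> (cmod w)))"
    by simp
  then show ?thesis
    by (simp only: g_def[abs_def] integral_mult_right_zero)
qed

text \<open>The radial factor \<open>h\<close> will be a truncation to a smaller disc or the
  indicator of an annulus; being radial, it does not disturb orthogonality.\<close>

lemma integral_monomial:
  fixes g :: "complex \<Rightarrow> complex"
  assumes [measurable]: "h \<in> borel_measurable borel" and h: "\<And>x. 0 \<le> h x" "\<And>x. h x \<le> 1"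
  shows "(LINT w|disc_area. w ^ k * of_real (h (cmod w)) * cnj w ^ n * of_real (\<omega> (cmod w))) =
    (if k = n then of_real (LINT w|disc_area. cmod w ^ (2 * n) * h (cmod w) * \<omega> (cmod w)) else 0)"
proof (cases "k = n")
  case True
  have eq: "w ^ n * of_real (h (cmod w)) * cnj w ^ n * of_real (\<omega> (cmod w)) =
      complex_of_real (cmod w ^ (2 * n) * h (cmod w) * \<omega> (cmod w))" for w
  proof -
    have "w ^ n * cnj w ^ n = complex_of_real (cmod w ^ (2 * n))"
      by (metis complex_norm_square of_real_power power_mult power_mult_distrib)
    then show ?thesis
      by (simp add: True mult_ac)
  qed
  show ?thesis
    unfolding True eq by (simp only: if_True simp_thms integral_complex_of_real)
next
  case False
  then show ?thesis
    by (auto simp: norm_mult power_mult_distrib intro!: integral_disc_area_eq_0[of _ k n])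
qed

section \<open>The reproducing property and uniqueness of the kernel\<close>

lemma bergman_space_integrable:
  assumes "f \<in> bergman_space 2 (radial \<omega>)"
  shows "f \<in> borel_measurable disc_area" "integrable disc_area (\<lambda>w. cmod (f w) * \<omega> (cmod w))"
proof -
  show [measurable]: "f \<in> borel_measurable disc_area"
    using assms by (simp add: bergman_space_def weighted_Lp_def)
  have int: "integrable disc_area (\<lambda>w. \<omega> (cmod w) + cmod (f w) powr 2 * \<omega> (cmod w))"
    using assms integrable_weight by (auto simp: bergman_space_def weighted_Lp_def radial_def)
  show "integrable disc_area (\<lambda>w. cmod (f w) * \<omega> (cmod w))"
  proof (rule Bochner_Integration.integrable_bound[OF int])
    show "AE w in disc_area. norm (cmod (f w) * \<omega> (cmod w)) \<le> norm (\<omega> (cmod w) + cmod (f w) powr 2 * \<omega> (cmod w))"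
    proof (rule AE_I2)
      fix w assume w: "w \<in> space disc_area"
      have "cmod (f w) \<le> 1 + cmod (f w) ^ 2"
        using zero_le_power2[of "cmod (f w) - 1"] by (simp add: power2_diff) (smt (verit) norm_ge_zero)
      then have "cmod (f w) * \<omega> (cmod w) \<le> (1 + cmod (f w) ^ 2) * \<omega> (cmod w)"
        using weight_nonneg[of w] w by (intro mult_right_mono) auto
      then show "norm (cmod (f w) * \<omega> (cmod w)) \<le> norm (\<omega> (cmod w) + cmod (f w) powr 2 * \<omega> (cmod w))"
        using weight_nonneg[of w] w by (simp add: algebra_simps)
    qed
  qed measurable
qed

text \<open>Termwise integration of the Taylor series is justified only on smaller discs, where the
  series converges uniformly. Orthogonality is therefore applied under a radial truncation, which is
  then removed by dominated convergence.\<close>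

lemma bergman_space_coefficient:
  assumes f: "f \<in> bergman_space 2 (radial \<omega>)"
    and a: "\<And>w. w \<in> unit_disc \<Longrightarrow> (\<lambda>n. a n * w ^ n) sums f w"
  shows "(LINT w|disc_area. f w * cnj w ^ n * of_real (\<omega> (cmod w))) = a n * of_real (moment n)"
proof -
  note [measurable] = bergman_space_integrable(1)[OF f]
  \<comment> \<open>The radii increase to 1; \<open>Suc (Suc i)\<close> keeps them positive from the
    start.\<close>
  define h :: "nat \<Rightarrow> real \<Rightarrow> real" where "h i = indicator {..< 1 - 1 / Suc (Suc i)}" for i
  have [measurable]: "h i \<in> borel_measurable borel" for i
    by (simp add: h_def)
  have h: "0 \<le> h i x" "h i x \<le> 1" for i x
    by (simp_all add: h_def indicator_def)
  have h_lim: "(\<lambda>i. h i x) \<longlonglongrightarrow> 1" if "x < 1" for x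
  proof (rule tendsto_eventually)
    have "(\<lambda>i. 1 - 1 / real (Suc (Suc i))) \<longlonglongrightarrow> 1" by real_asymp
    then have "eventually (\<lambda>i. x < 1 - 1 / real (Suc (Suc i))) sequentially"
      using that by (auto simp: order_tendsto_iff)
    then show "eventually (\<lambda>i. h i x = 1) sequentially"
      by (auto simp: h_def elim!: eventually_mono)
  qed
  have trunc: "(LINT w|disc_area. h i (cmod w) *\<^sub>R (f w * cnj w ^ n * of_real (\<omega> (cmod w)))) =
     a n * of_real (LINT w|disc_area. cmod w ^ (2 * n) * h i (cmod w) * \<omega> (cmod w))" for i
  proof -
    define \<rho> where "\<rho> = 1 - 1 / real (Suc (Suc i))"
    have \<rho>: "0 < \<rho>" "\<rho> < 1" by (auto simp: \<rho>_def field_simps)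
    define g where "g k w = a k * (w ^ k * of_real (h i (cmod w)) * cnj w ^ n * of_real (\<omega> (cmod w)))" for k w
    have [measurable]: "g k \<in> borel_measurable disc_area" for k
      unfolding g_def by measurable
    have h_eq: "h i x = (if x < \<rho> then 1 else 0)" for x
      by (simp add: h_def \<rho>_def)
    have summ: "summable (\<lambda>k. cmod (a k) * \<rho> ^ k)"
    proof -
      \<comment> \<open>Convergence at a point of larger modulus gives absolute convergence at
        radius \<open>\<rho>\<close>.\<close>
      have "summable (\<lambda>k. a k * of_real ((1 + \<rho>) / 2) ^ k)"
      proof (rule sums_summable[OF a])
        have "cmod (of_real ((1 + \<rho>) / 2)) < 1"
          using \<rho> by (simp only: norm_of_real) auto
        then show "of_real ((1 + \<rho>) / 2) \<in> unit_disc" by simp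
      qed
      then have "summable (\<lambda>k. norm (a k * of_real \<rho> ^ k))"
        by (rule powser_insidea) (use \<rho> in \<open>simp only: norm_of_real, auto\<close>)
      then show ?thesis using \<rho> by (simp add: norm_mult norm_power)
    qed
    have norm_g: "norm (g k w) \<le> (cmod (a k) * \<rho> ^ k) * \<omega> (cmod w)" if w: "w \<in> unit_disc" for k w
    proof (cases "cmod w < \<rho>")
      case True
      have "cmod w ^ k * cmod w ^ n \<le> \<rho> ^ k * 1"
        using True w \<rho> by (intro mult_mono power_mono power_le_one) auto
      then have "cmod (a k) * \<omega> (cmod w) * (cmod w ^ k * cmod w ^ n) \<le> cmod (a k) * \<omega> (cmod w) * (\<rho> ^ k * 1)"
        using weight_nonneg[OF w] by (intro mult_left_mono) auto
      then show ?thesis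
        using True weight_nonneg[OF w] by (simp add: g_def norm_mult norm_power h_eq mult_ac)
    qed (use weight_nonneg[OF w] \<rho> in \<open>auto simp: g_def h_eq\<close>)
    have "(\<lambda>k. integral\<^sup>L disc_area (g k)) sums (LINT w|disc_area. (\<Sum>k. g k w))"
      using norm_g by (intro sums_integral_dominated[OF _ integrable_weight summ]) auto
    moreover have "(LINT w|disc_area. (\<Sum>k. g k w)) = (LINT w|disc_area. h i (cmod w) *\<^sub>R (f w * cnj w ^ n * of_real (\<omega> (cmod w))))"
    proof (rule Bochner_Integration.integral_cong)
      fix w assume w: "w \<in> space disc_area"
      have "(\<lambda>k. a k * w ^ k * (of_real (h i (cmod w)) * cnj w ^ n * of_real (\<omega> (cmod w)))) sums 
          (f w * (of_real (h i (cmod w)) * cnj w ^ n * of_real (\<omega> (cmod w))))"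
        using w by (intro sums_mult2 a) simp
      then show "(\<Sum>k. g k w) = h i (cmod w) *\<^sub>R (f w * cnj w ^ n * of_real (\<omega> (cmod w)))"
        by (simp add: g_def sums_iff scaleR_conv_of_real mult_ac)
    qed simp
    moreover have "integral\<^sup>L disc_area (g k) = (if k = n then a n * of_real (LINT w|disc_area. cmod w ^ (2 * n) * h i (cmod w) * \<omega> (cmod w)) else 0)" for k
      unfolding g_def using integral_monomial[of "h i" k n] h by simp
    ultimately have "(\<lambda>k. if k = n then a n * of_real (LINT w|disc_area. cmod w ^ (2 * n) * h i (cmod w) * \<omega> (cmod w)) else 0) sums
       (LINT w|disc_area. h i (cmod w) *\<^sub>R (f w * cnj w ^ n * of_real (\<omega> (cmod w))))"
      by simp
    then show ?thesis
      using sums_If_finite_set[of "{n}" "\<lambda>_. a n * of_real (LINT w|disc_area. cmod w ^ (2 * n) * h i (cmod w) * \<omega> (cmod w))"]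
      by (auto dest: sums_unique2)
  qed
  have "(\<lambda>i. LINT w|disc_area. h i (cmod w) *\<^sub>R (f w * cnj w ^ n * of_real (\<omega> (cmod w)))) \<longlonglongrightarrow>
      (LINT w|disc_area. f w * cnj w ^ n * of_real (\<omega> (cmod w)))"
  proof (rule integral_dominated_convergence)
    show "integrable disc_area (\<lambda>w. cmod (f w) * \<omega> (cmod w))"
      by (rule bergman_space_integrable(2)[OF f])
    show "AE w in disc_area. (\<lambda>i. h i (cmod w) *\<^sub>R (f w * cnj w ^ n * of_real (\<omega> (cmod w)))) \<longlonglongrightarrow> f w * cnj w ^ n * of_real (\<omega> (cmod w))"
    proof (rule AE_I2)
      fix w assume "w \<in> space disc_area"
      then show "(\<lambda>i. h i (cmod w) *\<^sub>R (f w * cnj w ^ n * of_real (\<omega> (cmod w)))) \<longlonglongrightarrow> f w * cnj w ^ n * of_real (\<omega> (cmod w))"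
        using tendsto_scaleR[OF h_lim[of "cmod w"] tendsto_const[of "f w * cnj w ^ n * of_real (\<omega> (cmod w))"]] by simp
    qed
    show "AE w in disc_area. norm (h i (cmod w) *\<^sub>R (f w * cnj w ^ n * of_real (\<omega> (cmod w)))) \<le> cmod (f w) * \<omega> (cmod w)" for i
    proof (rule AE_I2)
      fix w assume w: "w \<in> space disc_area"
      have "h i (cmod w) * cmod w ^ n \<le> 1"
        using h w by (intro mult_le_one power_le_one) auto
      then have "cmod (f w) * \<omega> (cmod w) * (h i (cmod w) * cmod w ^ n) \<le> cmod (f w) * \<omega> (cmod w) * 1"
        using weight_nonneg[of w] w by (intro mult_left_mono) auto
      then show "norm (h i (cmod w) *\<^sub>R (f w * cnj w ^ n * of_real (\<omega> (cmod w)))) \<le> cmod (f w) * \<omega> (cmod w)"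
        using weight_nonneg[of w] w h by (simp add: norm_mult norm_power mult_ac)
    qed
  qed measurable
  moreover have "(\<lambda>i. LINT w|disc_area. h i (cmod w) *\<^sub>R (f w * cnj w ^ n * of_real (\<omega> (cmod w)))) \<longlonglongrightarrow>
      a n * of_real (moment n)"
    unfolding trunc moment_def
  proof (intro tendsto_intros integral_dominated_convergence)
    show "integrable disc_area (\<lambda>w. cmod w ^ (2 * n) * \<omega> (cmod w))"
      by (rule integrable_moment)
    show "AE w in disc_area. (\<lambda>i. cmod w ^ (2 * n) * h i (cmod w) * \<omega> (cmod w)) \<longlonglongrightarrow> cmod w ^ (2 * n) * \<omega> (cmod w)"
    proof (rule AE_I2)
      fix w assume "w \<in> space disc_area"
      then show "(\<lambda>i. cmod w ^ (2 * n) * h i (cmod w) * \<omega> (cmod w)) \<longlonglongrightarrow> cmod w ^ (2 * n) * \<omega> (cmod w)"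
        using tendsto_mult[OF tendsto_mult[OF tendsto_const[of "cmod w ^ (2 * n)"] h_lim[of "cmod w"]] tendsto_const[of "\<omega> (cmod w)"]] by simp
    qed
    show "AE w in disc_area. norm (cmod w ^ (2 * n) * h i (cmod w) * \<omega> (cmod w)) \<le> cmod w ^ (2 * n) * \<omega> (cmod w)" for i
      using h weight_nonneg by (intro AE_I2) (auto simp: abs_mult intro!: mult_right_mono mult_left_le)
  qed measurable
  ultimately show ?thesis
    by (rule LIMSEQ_unique)
qed

lemma reproducing_kernel_at_kernel:
  assumes z: "cmod z < 1"
  shows "reproducing_kernel_at (radial \<omega>) z (\<lambda>w. kernel (cnj z * w))"
  unfolding reproducing_kernel_at_def
proof safe
  have [measurable]: "(\<lambda>w. kernel (cnj z * w)) \<in> borel_measurable disc_area"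
    using z by (intro borel_measurable_kernel_mult) simp
  have bound: "cmod (kernel (cnj z * w)) \<le> (\<Sum>n. cmod z ^ n / moment n)" if "w \<in> unit_disc" for w
    using z that by (intro kernel_bound) (auto simp: norm_mult mult_left_le)
  have "integrable disc_area (\<lambda>w. (cmod (kernel (cnj z * w)) powr 2) * of_real (\<omega> (cmod w)))"
    by (rule integrable_bounded_mult_weight[where C = "(\<Sum>n. cmod z ^ n / moment n) powr 2"])
      (use bound in \<open>auto intro!: powr_mono2 simp del: powr_numeral\<close>)
  then show "(\<lambda>w. kernel (cnj z * w)) \<in> bergman_space 2 (radial \<omega>)"
    using z by (auto simp: bergman_space_def weighted_Lp_def radial_def intro!: holomorphic_kernel_mult)
  fix f assume f: "f \<in> bergman_space 2 (radial \<omega>)"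
  then have hol: "f holomorphic_on unit_disc" by (simp add: bergman_space_def)
  define a where "a n = (deriv ^^ n) f 0 / fact n" for n
  have a: "(\<lambda>n. a n * w ^ n) sums f w" if "w \<in> unit_disc" for w
    using holomorphic_power_series[OF hol that] by (simp add: a_def)
  have "(\<lambda>n. z ^ n / of_real (moment n) * (LINT w|disc_area. f w * cnj w ^ n * of_real (\<omega> (cmod w))))
      sums (LINT w|disc_area. f w * cnj (kernel (cnj z * w)) * of_real (\<omega> (cmod w)))"
    using bergman_space_integrable[OF f] by (intro integral_kernel_sums z)
  moreover have "z ^ n / of_real (moment n) * (LINT w|disc_area. f w * cnj w ^ n * of_real (\<omega> (cmod w))) = a n * z ^ n" for n
    using bergman_space_coefficient[OF f a, of n] moment_pos[of n] by simp
  ultimately have "(\<lambda>n. a n * z ^ n) sums (LINT w|disc_area. f w * cnj (kernel (cnj z * w)) * of_real (\<omega> (cmod w)))"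
    by simp
  then show "f z = (LINT w|disc_area. f w * cnj (kernel (cnj z * w)) * of_real (radial \<omega> w))"
    using a[of z] z by (auto simp: radial_def intro: sums_unique2)
qed

text \<open>The choice operator yields some kernel B. Testing B against the explicit kernel at w,
  and the explicit kernel against B, evaluates the same inner product twice: once as B(w), once as
  the conjugate of the explicit kernel at w evaluated at z.\<close>

lemma bergman_kernel_eq:
  assumes z: "z \<in> unit_disc" and w: "w \<in> unit_disc"
  shows "bergman_kernel (radial \<omega>) z w = kernel (cnj z * w)"
proof -
  define B where "B = bergman_kernel (radial \<omega>) z"
  have B: "reproducing_kernel_at (radial \<omega>) z B"
    unfolding B_def bergman_kernel_def
    by (rule someI[of _ "\<lambda>w. kernel (cnj z * w)"]) (rule reproducing_kernel_at_kernel, use z in simp)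
  have K: "reproducing_kernel_at (radial \<omega>) w (\<lambda>u. kernel (cnj w * u))"
    using reproducing_kernel_at_kernel[of w] w by simp
  note BD = B[unfolded reproducing_kernel_at_def] and KD = K[unfolded reproducing_kernel_at_def]
  have "B w = (LINT u|disc_area. B u * cnj (kernel (cnj w * u)) * of_real (radial \<omega> u))"
    by (rule bspec[OF conjunct2[OF KD] conjunct1[OF BD]])
  also have "\<dots> = (LINT u|disc_area. cnj (kernel (cnj w * u) * cnj (B u) * of_real (radial \<omega> u)))"
    by (simp add: mult_ac)
  also have "\<dots> = cnj (LINT u|disc_area. kernel (cnj w * u) * cnj (B u) * of_real (radial \<omega> u))"
    by (rule Bochner_Integration.integral_cnj)
  also have "(LINT u|disc_area. kernel (cnj w * u) * cnj (B u) * of_real (radial \<omega> u)) = kernel (cnj w * z)"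
    by (rule bspec[OF conjunct2[OF BD] conjunct1[OF KD], symmetric])
  also have "cnj (kernel (cnj w * z)) = kernel (cnj z * w)"
    using norm_mult_less_one[of "cnj w" z] z w by (subst kernel_cnj) (auto simp: mult_ac)
  finally show ?thesis by (simp add: B_def)
qed

end

section \<open>The phase function\<close>

text \<open>Comparing \<open>ln y\<close> with \<open>2 (sqrt y - 1)\<close> bounds \<open>y - 1 - ln y\<close> below by \<open>(sqrt y - 1)\<^sup>2\<close>.\<close>

lemma square_le_minus_ln:
  fixes y :: real
  assumes "0 < y"
  shows "(y - 1)\<^sup>2 \<le> 2 * (1 + y) * (y - 1 - ln y)"
proof -
  define s where "s = sqrt y"
  have s: "0 < s" "s\<^sup>2 = y" using assms by (auto simp: s_def)
  have "ln y = 2 * ln s"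
    using s by (simp add: ln_realpow flip: s(2))
  then have ln: "(s - 1)\<^sup>2 \<le> y - 1 - ln y"
    using ln_le_minus_one[of s] s by (simp add: power2_diff)
  have "(y - 1)\<^sup>2 = (s - 1)\<^sup>2 * (s + 1)\<^sup>2"
    by (simp add: s(2)[symmetric] power2_eq_square algebra_simps)
  also have "(s + 1)\<^sup>2 \<le> 2 * (1 + y)"
    using zero_le_power2[of "s - 1"] by (simp add: s(2)[symmetric] power2_sum power2_diff)
  then have "(s - 1)\<^sup>2 * (s + 1)\<^sup>2 \<le> (y - 1 - ln y) * (2 * (1 + y))"
    using ln ln_le_minus_one[OF assms] by (intro mult_mono) auto
  finally show ?thesis by (simp add: mult_ac)
qed

text \<open>Inverts the previous bound: a small F forces y near 1 at the rate sqrt F, and a large F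
  allows at most linear growth of y.\<close>

lemma square_le_minus_ln':
  fixes y :: real
  assumes "0 < y" "y - 1 - ln y \<le> F"
  shows "(y - 1)\<^sup>2 \<le> 8 * F + 4 * F\<^sup>2" "y \<le> 3 + 2 * F"
proof -
  define G where "G = y - 1 - ln y"
  have G: "0 \<le> G" "G \<le> F"
    using assms ln_le_minus_one[of y] by (auto simp: G_def)
  have "(y - 1)\<^sup>2 \<le> 2 * (1 + y) * G"
    using square_le_minus_ln[OF assms(1)] by (simp add: G_def)
  \<comment> \<open>Write 1 + y = 2 + (y - 1) and absorb the product (y - 1) G by Young's
    inequality.\<close>
  then have *: "(y - 1)\<^sup>2 \<le> 8 * G + 4 * G\<^sup>2"
    using zero_le_power2[of "(y - 1) - 2 * G"] by (simp add: power2_eq_square algebra_simps)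
  also have "\<dots> \<le> 8 * F + 4 * F\<^sup>2"
    using G by (intro add_mono mult_left_mono power_mono) auto
  finally show le: "(y - 1)\<^sup>2 \<le> 8 * F + 4 * F\<^sup>2" .
  also have "\<dots> \<le> (2 * F + 2)\<^sup>2"
    by (simp add: power2_eq_square algebra_simps)
  finally have "y - 1 \<le> 2 * F + 2"
    by (rule power2_le_imp_le) (use G in simp)
  then show "y \<le> 3 + 2 * F" by simp
qed

text \<open>The amount by which the phase at y times the saddle point exceeds its minimum, in units
  of b times the power - B of the saddle. It has a double zero at y = 1.\<close>

definition excess :: "real \<Rightarrow> real \<Rightarrow> real" where
  "excess B y = y powr (- B) - 1 + B * (y - 1)"

text \<open>With Y = y^(-B) the excess is (Y - 1 - ln Y) + B (y - 1 - ln y): the logarithms cancel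
  and both summands are nonnegative.\<close>

lemma excess_ge:
  assumes "0 < B" "0 < y"
  shows "B * (y - 1 - ln y) \<le> excess B y"
    and "y powr (- B) - 1 - ln (y powr (- B)) \<le> excess B y"
    and "0 \<le> excess B y"
proof -
  have 1: "y powr (- B) - 1 - ln (y powr (- B)) \<ge> 0"
    using ln_le_minus_one[of "y powr (- B)"] assms by simp
  have 2: "B * (y - 1 - ln y) \<ge> 0"
    using ln_le_minus_one[of y] assms by simp
  have "excess B y = (y powr (- B) - 1 - ln (y powr (- B))) + B * (y - 1 - ln y)"
    using assms by (simp add: excess_def ln_powr algebra_simps)
  with 1 2 show "B * (y - 1 - ln y) \<le> excess B y"
    and "y powr (- B) - 1 - ln (y powr (- B)) \<le> excess B y"
    and "0 \<le> excess B y" by linarith+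
qed

text \<open>The range y \<ge> 1 is the one used in the lower bound for the moments, which looks only
  to the right of the saddle. With u = B ln y one has y^(-B) \<le> 1 / (1 + u) \<le> 1 - u +
  u^2.\<close>

lemma excess_le:
  assumes "0 < B" "1 \<le> y"
  shows "excess B y \<le> (B + B\<^sup>2) * (y - 1)\<^sup>2"
proof -
  define u where "u = B * ln y"
  have u: "0 \<le> u" using assms by (simp add: u_def)
  have "1 + u \<le> y powr B"
    using exp_ge_add_one_self[of u] assms by (simp add: powr_def u_def)
  then have "y powr (- B) \<le> 1 / (1 + u)"
    using u assms by (simp add: powr_minus divide_simps)
  also have "\<dots> \<le> 1 - u + u\<^sup>2"
    using u by (simp add: divide_simps power2_eq_square algebra_simps)
  finally have "excess B y \<le> B * (y - 1 - ln y) + u\<^sup>2"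
    by (simp add: excess_def u_def algebra_simps)
  also have "u\<^sup>2 \<le> (B * (y - 1))\<^sup>2"
    using u assms ln_le_minus_one[of y] by (auto simp: u_def intro!: power_mono mult_left_mono)
  also have "y - 1 - ln y \<le> (y - 1)\<^sup>2"
  proof -
    have "- ln y \<le> 1 / y - 1"
      using ln_le_minus_one[of "1 / y"] assms by (simp add: ln_div)
    then have "y - 1 - ln y \<le> (y - 1)\<^sup>2 / y"
      using assms by (simp add: field_simps power2_eq_square)
    also have "\<dots> \<le> (y - 1)\<^sup>2"
      using assms divide_left_mono[of 1 y "(y - 1)\<^sup>2"] by simp
    finally show ?thesis .
  qed
  finally show ?thesis
    using assms by (simp add: power_mult_distrib distrib_right)
qed

text \<open>Extracts a factor (y - 1)^2, which the excess controls, at the price of powers of y. The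
  term 1 / y is for y \<le> 1 and y^p for y > 1.\<close>

lemma powr_minus_one_bound:
  fixes y :: real
  assumes "0 < p" "0 < y"
  shows "(y powr p - 1)\<^sup>2 \<le> (p * (1 / y + y powr p))\<^sup>2 * (y - 1)\<^sup>2"
proof -
  have "\<bar>y powr p - 1\<bar> \<le> p * (1 / y + y powr p) * \<bar>y - 1\<bar>"
  proof (cases "y \<le> 1")
    case True
    have "1 - y powr p \<le> - (p * ln y)"
      using ln_le_minus_one[of "y powr p"] assms by (simp add: ln_powr)
    also have "\<dots> \<le> p * (1 / y - 1)"
    proof -
      have "- ln y \<le> 1 / y - 1"
        using ln_le_minus_one[of "1 / y"] assms by (simp add: ln_div)
      from mult_left_mono[OF this, of p] show ?thesis using assms by simp
    qed
    also have "\<dots> = p * (1 / y) * \<bar>y - 1\<bar>"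
      using True assms by (simp add: field_simps)
    also have "\<dots> \<le> p * (1 / y + y powr p) * \<bar>y - 1\<bar>"
      using assms by (intro mult_right_mono mult_left_mono) auto
    finally have "1 - y powr p \<le> p * (1 / y + y powr p) * \<bar>y - 1\<bar>" .
    moreover have "y powr p \<le> 1"
      using True assms by (simp add: powr_le1)
    ultimately show ?thesis by simp
  next
    case False
    have "1 - y powr (-p) \<le> p * ln y"
      using ln_le_minus_one[of "y powr (-p)"] assms by (simp add: ln_powr)
    also have "\<dots> \<le> p * (y - 1)"
      using ln_le_minus_one[of y] assms by simp
    finally have "y powr p * (1 - y powr (-p)) \<le> y powr p * (p * (y - 1))"
      by (intro mult_left_mono) auto
    also have "y powr p * (1 - y powr (-p)) = y powr p - 1"
      using assms by (simp add: right_diff_distrib flip: powr_add)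
    also have "y powr p * (p * (y - 1)) \<le> p * (1 / y + y powr p) * \<bar>y - 1\<bar>"
      using False assms by (simp add: algebra_simps)
    finally have "y powr p - 1 \<le> p * (1 / y + y powr p) * \<bar>y - 1\<bar>" .
    moreover have "1 \<le> y powr p"
      using False assms by (simp add: ge_one_powr_ge_zero)
    ultimately show ?thesis by simp
  qed
  then have "\<bar>y powr p - 1\<bar>\<^sup>2 \<le> (p * (1 / y + y powr p) * \<bar>y - 1\<bar>)\<^sup>2"
    by (intro power_mono) auto
  then show ?thesis by (simp add: power_mult_distrib)
qed

text \<open>The algebraic factors of Laplace's method only matter up to polynomial growth in the
  excess phase \<open>g\<close>. This class is closed under sums, products and powers, so exponents
  and constants need not be tracked.\<close>

definition poly_bounded :: "'a set \<Rightarrow> ('a \<Rightarrow> real) \<Rightarrow> ('a \<Rightarrow> real) \<Rightarrow> bool" where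
  "poly_bounded A g f \<longleftrightarrow> (\<exists>C N. 0 \<le> C \<and> 0 \<le> N \<and> (\<forall>a\<in>A. 0 \<le> f a \<and> f a \<le> C * (1 + g a) powr N))"

lemma poly_boundedE:
  assumes "poly_bounded A g f"
  obtains C N where "0 \<le> C" "0 \<le> N" "\<And>a. a \<in> A \<Longrightarrow> 0 \<le> f a"
    "\<And>a. a \<in> A \<Longrightarrow> f a \<le> C * (1 + g a) powr N"
  using assms unfolding poly_bounded_def by blast

lemma poly_boundedI:
  assumes "0 \<le> N" "\<And>a. a \<in> A \<Longrightarrow> 0 \<le> f a" "\<And>a. a \<in> A \<Longrightarrow> f a \<le> C * (1 + g a) powr N"
  shows "poly_bounded A g f"
  unfolding poly_bounded_def
proof (rule exI[of _ "max C 0"], rule exI[of _ N], intro conjI ballI)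
  fix a assume a: "a \<in> A"
  have "f a \<le> C * (1 + g a) powr N" using assms a by auto
  also have "\<dots> \<le> max C 0 * (1 + g a) powr N"
    by (intro mult_right_mono) auto
  finally show "f a \<le> max C 0 * (1 + g a) powr N" .
qed (use assms in auto)

lemma poly_bounded_mono:
  assumes "poly_bounded A g f" "\<And>a. a \<in> A \<Longrightarrow> 0 \<le> h a" "\<And>a. a \<in> A \<Longrightarrow> h a \<le> f a"
  shows "poly_bounded A g h"
proof -
  obtain C N where f: "0 \<le> C" "0 \<le> N" "\<And>a. a \<in> A \<Longrightarrow> f a \<le> C * (1 + g a) powr N"
    using assms(1) by (rule poly_boundedE) blast
  show ?thesis
    by (rule poly_boundedI[OF f(2) assms(2) order.trans[OF assms(3) f(3)]])
qed

lemma poly_bounded_const: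
  assumes "\<And>a. a \<in> A \<Longrightarrow> 0 \<le> g a" "0 \<le> c"
  shows "poly_bounded A g (\<lambda>_. c)"
proof (rule poly_boundedI[of 0 _ _ c])
  show "c \<le> c * (1 + g a) powr 0" if "a \<in> A" for a
    using assms(1)[OF that] by simp
qed (use assms(2) in simp_all)

lemma poly_bounded_self:
  assumes "\<And>a. a \<in> A \<Longrightarrow> 0 \<le> g a"
  shows "poly_bounded A g g"
proof (rule poly_boundedI[of 1 _ _ 1])
  show "g a \<le> 1 * (1 + g a) powr 1" if "a \<in> A" for a
    using assms[OF that] by simp
qed (use assms in simp_all)

lemma poly_bounded_add:
  assumes g: "\<And>a. a \<in> A \<Longrightarrow> 0 \<le> g a" and "poly_bounded A g f" "poly_bounded A g h"
  shows "poly_bounded A g (\<lambda>a. f a + h a)"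
proof -
  obtain C N where f: "0 \<le> C" "0 \<le> N" "\<And>a. a \<in> A \<Longrightarrow> 0 \<le> f a" "\<And>a. a \<in> A \<Longrightarrow> f a \<le> C * (1 + g a) powr N"
    using assms(2) by (rule poly_boundedE) blast
  obtain D M where h: "0 \<le> D" "0 \<le> M" "\<And>a. a \<in> A \<Longrightarrow> 0 \<le> h a" "\<And>a. a \<in> A \<Longrightarrow> h a \<le> D * (1 + g a) powr M"
    using assms(3) by (rule poly_boundedE) blast
  show ?thesis
  proof (rule poly_boundedI[of "N + M" _ _ "C + D"])
    fix a assume a: "a \<in> A"
    have "C * (1 + g a) powr N \<le> C * (1 + g a) powr (N + M)"
      using g[OF a] f h by (intro mult_left_mono powr_mono) auto
    moreover have "D * (1 + g a) powr M \<le> D * (1 + g a) powr (N + M)"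
      using g[OF a] f h by (intro mult_left_mono powr_mono) auto
    ultimately show "f a + h a \<le> (C + D) * (1 + g a) powr (N + M)"
      using f(4)[OF a] h(4)[OF a] by (simp add: distrib_right)
  qed (use f h in auto)
qed

lemma poly_bounded_mult:
  assumes "poly_bounded A g f" "poly_bounded A g h"
  shows "poly_bounded A g (\<lambda>a. f a * h a)"
proof -
  obtain C N where f: "0 \<le> C" "0 \<le> N" "\<And>a. a \<in> A \<Longrightarrow> 0 \<le> f a" "\<And>a. a \<in> A \<Longrightarrow> f a \<le> C * (1 + g a) powr N"
    using assms(1) by (rule poly_boundedE) blast
  obtain D M where h: "0 \<le> D" "0 \<le> M" "\<And>a. a \<in> A \<Longrightarrow> 0 \<le> h a" "\<And>a. a \<in> A \<Longrightarrow> h a \<le> D * (1 + g a) powr M"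
    using assms(2) by (rule poly_boundedE) blast
  show ?thesis
  proof (rule poly_boundedI[of "N + M" _ _ "C * D"])
    fix a assume a: "a \<in> A"
    have "f a * h a \<le> (C * (1 + g a) powr N) * (D * (1 + g a) powr M)"
      using f h a by (intro mult_mono) auto
    then show "f a * h a \<le> C * D * (1 + g a) powr (N + M)"
      by (simp add: powr_add mult_ac)
  qed (use f h in auto)
qed

lemma poly_bounded_powr:
  assumes "poly_bounded A g f" "0 \<le> r"
  shows "poly_bounded A g (\<lambda>a. f a powr r)"
proof -
  obtain C N where f: "0 \<le> C" "0 \<le> N" "\<And>a. a \<in> A \<Longrightarrow> 0 \<le> f a" "\<And>a. a \<in> A \<Longrightarrow> f a \<le> C * (1 + g a) powr N"
    using assms(1) by (rule poly_boundedE) blast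
  show ?thesis
  proof (rule poly_boundedI[of "N * r" _ _ "C powr r"])
    fix a assume a: "a \<in> A"
    have "f a powr r \<le> (C * (1 + g a) powr N) powr r"
      using f a assms by (intro powr_mono2) auto
    then show "f a powr r \<le> C powr r * (1 + g a) powr (N * r)"
      using f by (simp add: powr_mult powr_powr)
  qed (use f assms in auto)
qed

lemma poly_bounded_power2: "poly_bounded A g f \<Longrightarrow> poly_bounded A g (\<lambda>a. (f a)\<^sup>2)"
  unfolding power2_eq_square by (rule poly_bounded_mult)

lemma poly_bounded_exp:
  assumes "poly_bounded A g f" "0 < \<kappa>" "\<And>a. a \<in> A \<Longrightarrow> 0 \<le> g a"
  obtains K where "0 < K" "\<And>a. a \<in> A \<Longrightarrow> exp (- (\<kappa> * g a)) * f a \<le> K"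
proof -
  obtain C N where f: "0 \<le> C" "0 \<le> N" "\<And>a. a \<in> A \<Longrightarrow> 0 \<le> f a" "\<And>a. a \<in> A \<Longrightarrow> f a \<le> C * (1 + g a) powr N"
    using assms(1) by (rule poly_boundedE) blast
  \<comment> \<open>Adding 1 makes the exponent positive. The constant K below is the maximum of exp
    (- \<kappa> g) (1 + g)^M over g > - 1, attained at 1 + g = M / \<kappa>.\<close>
  define M where "M = N + 1"
  define K where "K = exp (\<kappa> - M - M * ln (\<kappa> / M))"
  have M: "0 < M" using f by (simp add: M_def)
  have "exp (- (\<kappa> * g a)) * f a \<le> (C + 1) * K" if a: "a \<in> A" for a
  proof -
    have "ln (\<kappa> / M * (1 + g a)) \<le> \<kappa> / M * (1 + g a) - 1"
      using assms(2,3) a M by (intro ln_le_minus_one mult_pos_pos) (auto intro: add_pos_nonneg)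
    moreover have "ln (\<kappa> / M * (1 + g a)) = ln (\<kappa> / M) + ln (1 + g a)"
      using assms(2) assms(3)[OF a] M by (intro ln_mult_pos) auto
    ultimately have "M * (ln (\<kappa> / M) + ln (1 + g a)) \<le> M * (\<kappa> / M * (1 + g a) - 1)"
      using M by (intro mult_left_mono) auto
    moreover have "M * (\<kappa> / M * (1 + g a) - 1) = \<kappa> * (1 + g a) - M"
      using M by (simp add: field_simps)
    ultimately have "- (\<kappa> * g a) + M * ln (1 + g a) \<le> \<kappa> - M - M * ln (\<kappa> / M)"
      by (simp add: algebra_simps)
    then have *: "exp (- (\<kappa> * g a)) * (1 + g a) powr M \<le> K"
      using assms(3)[OF a] by (simp add: K_def powr_def flip: exp_add)
    have "f a \<le> C * (1 + g a) powr N" by (rule f(4)[OF a])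
    also have "\<dots> \<le> (C + 1) * (1 + g a) powr M"
      using f assms(3)[OF a] by (intro mult_mono powr_mono) (auto simp: M_def)
    finally have "exp (- (\<kappa> * g a)) * f a \<le> exp (- (\<kappa> * g a)) * ((C + 1) * (1 + g a) powr M)"
      by (intro mult_left_mono) auto
    also have "\<dots> = (C + 1) * (exp (- (\<kappa> * g a)) * (1 + g a) powr M)" by simp
    also have "\<dots> \<le> (C + 1) * K"
      using f * by (intro mult_left_mono) auto
    finally show ?thesis .
  qed
  moreover have "0 < (C + 1) * K" using f by (simp add: K_def)
  ultimately show ?thesis using that by blast
qed

section \<open>The phase, its saddle point and the Laplace scale\<close>

locale exponential_parameters =
  fixes b B :: real
  assumes b_pos: "0 < b" and B_pos: "0 < B"
begin

text \<open>The zero of the derivative x - b B t^(-B-1) of the phase, hence its minimum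
  point.\<close>

definition saddle :: "real \<Rightarrow> real" where
  "saddle x = (b * B / x) powr (1 / (B + 1))"

text \<open>For x = 2 n + 2, exp (- phase) is r^(2n) exp (- b t^(-B)) at r = exp (- t), including
  the factor exp (- 2 t) of the area density.\<close>

definition phase :: "real \<Rightarrow> real \<Rightarrow> real" where
  "phase x t = x * t + b * t powr (- B)"

text \<open>Up to a constant, the inverse square root of the second derivative of the phase at
  t.\<close>

definition width :: "real \<Rightarrow> real" where
  "width t = t powr (1 + B / 2)"

lemma saddle_pos: "0 < x \<Longrightarrow> 0 < saddle x"
  using b_pos B_pos by (simp add: saddle_def)

lemma saddle_powr:
  assumes "0 < x"
  shows "b * B * saddle x powr (- B - 1) = x"
proof -
  have "saddle x powr (- B - 1) = (b * B / x) powr (1 / (B + 1) * (- B - 1))"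
    by (simp add: saddle_def powr_powr)
  also have "1 / (B + 1) * (- B - 1) = -1"
    using B_pos by (simp add: field_simps)
  finally show ?thesis
    using assms b_pos B_pos by (simp add: powr_minus_divide)
qed

lemma saddle_mult:
  assumes "0 < x"
  shows "x * saddle x = b * B * saddle x powr (- B)"
proof -
  have "x * saddle x = b * B * (saddle x powr (- B - 1) * saddle x powr 1)"
    using saddle_powr[OF assms] saddle_pos[OF assms] by simp
  also have "\<dots> = b * B * saddle x powr (- B)"
    by (simp only: powr_add[symmetric]) simp
  finally show ?thesis .
qed

lemma width_pos: "0 < t \<Longrightarrow> 0 < width t"
  by (simp add: width_def)

lemma width_power2: "0 < t \<Longrightarrow> (width t)\<^sup>2 = t powr (2 + B)"
  by (simp add: width_def power2_eq_square flip: powr_add)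

lemma width_power2_div: "0 < t \<Longrightarrow> t powr (- B) / t\<^sup>2 = 1 / (width t)\<^sup>2"
  by (simp add: width_power2 powr_add powr_minus field_simps)

text \<open>The saddle equation turns both terms of the phase into multiples of the same power of
  the saddle, so that this power and the ratio of t to the saddle are the only parameters
  left.\<close>

lemma phase_diff:
  assumes "0 < x" "0 < t"
  shows "phase x t - phase x (saddle x) = b * (saddle x powr (- B) * excess B (t / saddle x))"
proof -
  have "t powr (- B) = saddle x powr (- B) * (t / saddle x) powr (- B)"
    using assms saddle_pos[of x] by (simp add: powr_divide)
  moreover have "x * t = x * saddle x * (t / saddle x)"
    using assms saddle_pos[of x] by simp
  ultimately show ?thesis
    using assms saddle_pos[of x]
    by (simp add: phase_def excess_def saddle_mult algebra_simps)
qed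

lemma phase_saddle_le: "0 < x \<Longrightarrow> 0 < t \<Longrightarrow> phase x (saddle x) \<le> phase x t"
  using phase_diff[of x t] excess_ge(3)[of B "t / saddle x"] saddle_pos[of x] b_pos B_pos
  by (smt (verit) divide_pos_pos mult_nonneg_nonneg powr_ge_zero)

text \<open>Within one width the quadratic bound on the excess costs a constant independent of x.
  This is the lower half of Laplace's method.\<close>

lemma phase_near_saddle:
  assumes "0 < x" "saddle x \<le> t" "t \<le> saddle x + width (saddle x)"
  shows "phase x t \<le> phase x (saddle x) + b * (B + B\<^sup>2)"
proof -
  define \<theta> where "\<theta> = saddle x"
  have \<theta>: "0 < \<theta>" "0 < width \<theta>" using saddle_pos assms width_pos by (auto simp: \<theta>_def)
  have "phase x t - phase x \<theta> = b * (\<theta> powr (- B) * excess B (t / \<theta>))"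
    using assms \<theta> by (auto simp: \<theta>_def intro!: phase_diff)
  also have "\<dots> \<le> b * (\<theta> powr (- B) * ((B + B\<^sup>2) * (t / \<theta> - 1)\<^sup>2))"
    using b_pos B_pos \<theta> assms by (intro mult_left_mono excess_le) (auto simp: \<theta>_def)
  also have "\<theta> powr (- B) * ((B + B\<^sup>2) * (t / \<theta> - 1)\<^sup>2) = (B + B\<^sup>2) * (t - \<theta>)\<^sup>2 * (\<theta> powr (- B) / \<theta>\<^sup>2)"
    using \<theta> by (simp add: field_simps power2_eq_square)
  also have "\<dots> = (B + B\<^sup>2) * ((t - \<theta>) / width \<theta>)\<^sup>2"
    using \<theta> by (simp only: width_power2_div) (simp add: power_divide)
  finally have "phase x t - phase x \<theta> \<le> b * ((B + B\<^sup>2) * ((t - \<theta>) / width \<theta>)\<^sup>2)" .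
  moreover have "((t - \<theta>) / width \<theta>)\<^sup>2 \<le> 1"
    using assms \<theta> by (intro power_le_one) (auto simp: \<theta>_def[symmetric] divide_simps)
  then have "b * ((B + B\<^sup>2) * ((t - \<theta>) / width \<theta>)\<^sup>2) \<le> b * ((B + B\<^sup>2) * 1)"
    using b_pos B_pos by (intro mult_left_mono) auto
  ultimately show ?thesis
    by (simp add: \<theta>_def)
qed

text \<open>Here H stands for the power - B of the saddle and y for t divided by the saddle. The
  lower bound on H expresses x \<ge> 2, which holds for all frequencies 2 n + 2.\<close>

definition parameter_range :: "(real \<times> real) set" where
  "parameter_range = {(H, y). 0 < y \<and> (b * B / 2) powr (- B / (B + 1)) \<le> H}"

definition scaled_excess :: "real \<times> real \<Rightarrow> real" where
  "scaled_excess = (\<lambda>(H, y). H * excess B y)"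

lemma parameter_range_saddle:
  assumes "2 \<le> x" "0 < t"
  shows "(saddle x powr (- B), t / saddle x) \<in> parameter_range"
proof -
  have "saddle x \<le> (b * B / 2) powr (1 / (B + 1))"
    unfolding saddle_def using assms b_pos B_pos by (intro powr_mono2 divide_left_mono) auto
  then have "((b * B / 2) powr (1 / (B + 1))) powr (- B) \<le> saddle x powr (- B)"
    using B_pos saddle_pos[of x] assms by (intro powr_mono2') auto
  then show ?thesis
    using assms saddle_pos[of x] by (simp add: parameter_range_def powr_powr)
qed

lemma parameter_range_pos:
  assumes "(H, y) \<in> parameter_range"
  shows "0 < H" "0 < y"
proof -
  have "0 < (b * B / 2) powr (- B / (B + 1))" using b_pos B_pos by simp
  then show "0 < H" "0 < y" using assms by (auto simp: parameter_range_def simp del: powr_gt_zero)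
qed

lemma scaled_excess_nonneg: "a \<in> parameter_range \<Longrightarrow> 0 \<le> scaled_excess a"
  using excess_ge(3)[OF B_pos, of "snd a"] parameter_range_pos[of "fst a" "snd a"]
  by (simp add: scaled_excess_def split_beta)

abbreviation tame :: "(real \<times> real \<Rightarrow> real) \<Rightarrow> bool" where
  "tame \<equiv> poly_bounded parameter_range scaled_excess"

lemma tame_add: "tame f \<Longrightarrow> tame g \<Longrightarrow> tame (\<lambda>a. f a + g a)"
  by (rule poly_bounded_add) (simp_all add: scaled_excess_nonneg)

lemma tame_const: "0 \<le> c \<Longrightarrow> tame (\<lambda>_. c)"
  by (rule poly_bounded_const) (simp_all add: scaled_excess_nonneg)

lemma tame_scaled_excess: "tame scaled_excess"
  by (rule poly_bounded_self) (simp add: scaled_excess_nonneg)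

text \<open>Since H is bounded below, the scaled excess dominates the excess itself. The latter
  controls F = y - 1 - ln y, and likewise the same expression in y^(-B), so the bounds 8 F + 4 F^2
  and 3 + 2 F apply.\<close>

lemma
  shows tame_excess: "tame (\<lambda>(H, y). excess B y)" (is ?A)
    and tame_square: "tame (\<lambda>(H, y). H * (y - 1)\<^sup>2)" (is ?B)
    and tame_snd: "tame (\<lambda>(H, y). y)" (is ?C)
    and tame_snd_minus: "tame (\<lambda>(H, y). y powr (- B))" (is ?D)
proof -
  define h where "h = (b * B / 2) powr (- B / (B + 1))"
  have h: "0 < h" using b_pos B_pos by (simp add: h_def)
  have H: "h \<le> H" "0 < H" "0 < y" if "(H, y) \<in> parameter_range" for H y
    using parameter_range_pos[OF that] that by (auto simp: parameter_range_def h_def)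
  note intros = tame_add poly_bounded_mult tame_const tame_scaled_excess poly_bounded_power2
  have E: "0 \<le> excess B y" "excess B y \<le> scaled_excess (H, y) / h" if "(H, y) \<in> parameter_range" for H y
    using H[OF that] h excess_ge(3)[OF B_pos, of y] mult_right_mono[of h H "excess B y"]
    by (auto simp: scaled_excess_def field_simps)
  have F: "y - 1 - ln y \<le> excess B y / B" if "(H, y) \<in> parameter_range" for H y
    using excess_ge(1)[OF B_pos, of y] H[OF that] B_pos by (simp add: field_simps)
  show A: ?A
  proof (rule poly_bounded_mono[where f = "\<lambda>a. (1 / h) * scaled_excess a"])
    show "tame (\<lambda>a. (1 / h) * scaled_excess a)"
      using h by (intro intros) simp
  qed (use E in \<open>force simp: split_beta\<close>)+
  have EB: "tame (\<lambda>(H, y). excess B y / B)"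
    using poly_bounded_mult[OF tame_const[of "1 / B"] A] B_pos by (simp add: case_prod_unfold)
  show ?B
  proof (rule poly_bounded_mono[where f = "\<lambda>a. (8 / B) * scaled_excess a + (4 / B) * scaled_excess a * (case a of (H, y) \<Rightarrow> excess B y / B)"])
    show "tame (\<lambda>a. (8 / B) * scaled_excess a + (4 / B) * scaled_excess a * (case a of (H, y) \<Rightarrow> excess B y / B))"
      using B_pos by (intro intros EB) auto
    fix a assume a: "a \<in> parameter_range"
    obtain H y where Hy: "a = (H, y)" by fastforce
    note a' = a[unfolded Hy]
    have "H * (y - 1)\<^sup>2 \<le> H * (8 * (excess B y / B) + 4 * (excess B y / B)\<^sup>2)"
      using H[OF a'] F[OF a'] by (intro mult_left_mono square_le_minus_ln'(1)) auto
    also have "\<dots> = 8 / B * scaled_excess (H, y) + 4 / B * scaled_excess (H, y) * (excess B y / B)"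
      by (simp add: scaled_excess_def power2_eq_square algebra_simps)
    finally show "(case a of (H, y) \<Rightarrow> H * (y - 1)\<^sup>2) \<le> 8 / B * scaled_excess a + 4 / B * scaled_excess a * (case a of (H, y) \<Rightarrow> excess B y / B)"
      by (simp add: Hy)
  qed (use H in \<open>force simp: split_beta\<close>)
  show ?C
  proof (rule poly_bounded_mono[where f = "\<lambda>a. 3 + 2 * (case a of (H, y) \<Rightarrow> excess B y / B)"])
    show "tame (\<lambda>a. 3 + 2 * (case a of (H, y) \<Rightarrow> excess B y / B))"
      by (intro intros EB) auto
    fix a assume a: "a \<in> parameter_range"
    obtain H y where Hy: "a = (H, y)" by fastforce
    show "(case a of (H, y) \<Rightarrow> y) \<le> 3 + 2 * (case a of (H, y) \<Rightarrow> excess B y / B)"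
      using square_le_minus_ln'(2)[OF H(3) F, OF a[unfolded Hy] a[unfolded Hy]] by (simp add: Hy)
  qed (use H in \<open>force simp: split_beta\<close>)
  show ?D
  proof (rule poly_bounded_mono[where f = "\<lambda>a. 3 + 2 * (case a of (H, y) \<Rightarrow> excess B y)"])
    show "tame (\<lambda>a. 3 + 2 * (case a of (H, y) \<Rightarrow> excess B y))"
      by (intro intros A) auto
    fix a assume a: "a \<in> parameter_range"
    obtain H y where Hy: "a = (H, y)" by fastforce
    have "y powr (- B) \<le> 3 + 2 * excess B y"
      using H(3)[OF a[unfolded Hy]] excess_ge(2)[OF B_pos, of y] by (intro square_le_minus_ln'(2)) auto
    then show "(case a of (H, y) \<Rightarrow> y powr (- B)) \<le> 3 + 2 * (case a of (H, y) \<Rightarrow> excess B y)"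
      by (simp add: Hy)
  qed auto
qed

text \<open>Far from the saddle the decay is not Gaussian, but two powers of 1 + v, with v the
  squared distance in widths, are available: one pays for a quadratic factor in the integrand and
  the other leaves an integrable Lorentzian.\<close>

lemma phase_tail_bound:
  obtains C where "0 < C" "\<And>x t. 2 \<le> x \<Longrightarrow> 0 < t \<Longrightarrow>
    exp (phase x (saddle x) - phase x t) * (1 + ((t - saddle x) / width (saddle x))\<^sup>2)\<^sup>2 \<le> C"
proof -
  have pb: "tame (\<lambda>a. (1 + (case a of (H, y) \<Rightarrow> H * (y - 1)\<^sup>2))\<^sup>2)"
    by (intro poly_bounded_power2 tame_add tame_const tame_square) auto
  then obtain C where C: "0 < C" "\<And>a. a \<in> parameter_range \<Longrightarrow>
      exp (- (b * scaled_excess a)) * (1 + (case a of (H, y) \<Rightarrow> H * (y - 1)\<^sup>2))\<^sup>2 \<le> C"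
    using poly_bounded_exp[OF pb b_pos scaled_excess_nonneg] by blast
  show ?thesis
  proof (rule that[OF C(1)])
    fix x t :: real assume x: "2 \<le> x" and t: "0 < t"
    define \<theta> where "\<theta> = saddle x"
    have \<theta>: "0 < \<theta>" using saddle_pos x by (simp add: \<theta>_def)
    have "\<theta> powr (- B) * (t / \<theta> - 1)\<^sup>2 = (t - \<theta>)\<^sup>2 * (\<theta> powr (- B) / \<theta>\<^sup>2)"
      using \<theta> by (simp add: field_simps power2_eq_square)
    also have "\<dots> = ((t - \<theta>) / width \<theta>)\<^sup>2"
      using \<theta> by (simp only: width_power2_div) (simp add: power_divide)
    finally show "exp (phase x (saddle x) - phase x t) * (1 + ((t - saddle x) / width (saddle x))\<^sup>2)\<^sup>2 \<le> C"
      using C(2)[OF parameter_range_saddle[OF x t]] phase_diff[of x t] x t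
      by (simp add: scaled_excess_def \<theta>_def algebra_simps)
  qed
qed

text \<open>After the substitution \<open>y = t / saddle x\<close>, \<open>H = saddle x powr (- B)\<close> all the algebraic factors
  grow at most polynomially in the excess phase, which is then absorbed by the exponential.\<close>

lemma phase_term_bound:
  obtains C where "0 < C" "\<And>x t. 2 \<le> x \<Longrightarrow> 0 < t \<Longrightarrow>
    exp (phase x (saddle x) - phase x t) / width (saddle x) *
      ((width t)\<^sup>2 + ((width (saddle x))\<^sup>2 + (saddle x - t)\<^sup>2)\<^sup>2 / (width t)\<^sup>2) \<le>
    C * (width t / (1 + (width t)\<^sup>2 * (x - b * B * t powr (- B - 1))\<^sup>2))"
proof -
  \<comment> \<open>In the scaled variables \<open>q\<close> is the quantity in the Lorentzian
    denominator, and \<open>f\<close> below is the algebraic factor of the left side divided by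
    \<open>width t\<close>. It thus suffices that \<open>(1 + q) * f\<close> is tame.\<close>
  define q where "q = (\<lambda>(H::real, y). b\<^sup>2 * B\<^sup>2 * y powr (- B) * (H * (y powr (B + 1) - 1)\<^sup>2))"
  define f where "f = (\<lambda>(H, y). y powr (1 + B / 2) * (1 + ((y powr (- B)) powr (1 + 2 / B) * (1 + H * (y - 1)\<^sup>2))\<^sup>2))"
  note intros = tame_add poly_bounded_mult tame_const poly_bounded_powr poly_bounded_power2
  have pf: "tame f"
    unfolding f_def split_beta
    by (intro intros tame_snd[unfolded split_beta] tame_snd_minus[unfolded split_beta] tame_square[unfolded split_beta])
      (use B_pos in auto)
  have pq: "tame q"
  proof (rule poly_bounded_mono)
    show "tame (\<lambda>a. b\<^sup>2 * B\<^sup>2 * (snd a powr (- B)) *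
       (((B + 1) * ((snd a powr (- B)) powr (1 / B) + snd a powr (B + 1)))\<^sup>2 * (fst a * (snd a - 1)\<^sup>2)))"
      by (intro intros tame_snd[unfolded split_beta] tame_snd_minus[unfolded split_beta] tame_square[unfolded split_beta])
        (use B_pos in auto)
    fix a assume a: "a \<in> parameter_range"
    obtain H y where Hy: "a = (H, y)" by fastforce
    have H: "0 \<le> H" "0 < y" using parameter_range_pos[of H y] a by (auto simp: Hy)
    show "0 \<le> q a" using H by (simp add: q_def Hy)
    have y: "(y powr (- B)) powr (1 / B) = 1 / y"
      using B_pos H by (subst powr_powr) (simp add: powr_minus_divide)
    have "H * (y powr (B + 1) - 1)\<^sup>2 \<le> H * (((B + 1) * (1 / y + y powr (B + 1)))\<^sup>2 * (y - 1)\<^sup>2)"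
      using H B_pos by (intro mult_left_mono powr_minus_one_bound) auto
    then have "q a \<le> b\<^sup>2 * B\<^sup>2 * y powr (- B) * (H * (((B + 1) * (1 / y + y powr (B + 1)))\<^sup>2 * (y - 1)\<^sup>2))"
      unfolding q_def Hy prod.case by (rule mult_left_mono) simp
    then show "q a \<le> b\<^sup>2 * B\<^sup>2 * (snd a powr (- B)) *
       (((B + 1) * ((snd a powr (- B)) powr (1 / B) + snd a powr (B + 1)))\<^sup>2 * (fst a * (snd a - 1)\<^sup>2))"
      by (simp add: Hy y mult_ac)
  qed
  have pb: "tame (\<lambda>a. (1 + q a) * f a)"
    by (intro intros pf pq) auto
  then obtain C where C: "0 < C" "\<And>a. a \<in> parameter_range \<Longrightarrow>
      exp (- (b * scaled_excess a)) * ((1 + q a) * f a) \<le> C"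
    using poly_bounded_exp[OF pb b_pos scaled_excess_nonneg] by blast
  show ?thesis
  proof (rule that[OF C(1)])
    fix x t :: real assume x: "2 \<le> x" and t: "0 < t"
    define \<theta> where "\<theta> = saddle x"
    have \<theta>: "0 < \<theta>" using saddle_pos x by (simp add: \<theta>_def)
    define H y where "H = \<theta> powr (- B)" and "y = t / \<theta>"
    have y: "0 < y" "t = \<theta> * y" using t \<theta> by (auto simp: y_def)
    have wt: "width t = width \<theta> * y powr (1 + B / 2)"
      using y \<theta> by (simp add: width_def powr_mult)
    have w: "0 < width \<theta>" "0 < width t" using width_pos \<theta> t by auto
    have q_eq: "(width t)\<^sup>2 * (x - b * B * t powr (- B - 1))\<^sup>2 = q (H, y)"
    proof -
      have "x - b * B * t powr (- B - 1) = b * B * (\<theta> powr (- B - 1) * (1 - y powr (- B - 1)))"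
        using saddle_powr[of x] x y \<theta> by (simp add: \<theta>_def[symmetric] powr_mult algebra_simps)
      also have "1 - y powr (- B - 1) = y powr (- B - 1) * (y powr (B + 1) - 1)"
        using y by (simp add: right_diff_distrib flip: powr_add)
      finally have diff: "x - b * B * t powr (- B - 1) = b * B * (\<theta> powr (- B - 1) * (y powr (- B - 1) * (y powr (B + 1) - 1)))" .
      have wt2: "(width t)\<^sup>2 = \<theta> powr (2 + B) * y powr (2 + B)"
        using y \<theta> t by (simp add: width_power2 powr_mult)
      have sq: "(\<theta> powr (- B - 1))\<^sup>2 = \<theta> powr (- 2 * B - 2)" "(y powr (- B - 1))\<^sup>2 = y powr (- 2 * B - 2)"
        by (simp_all add: power2_eq_square flip: powr_add)
      have "(width t)\<^sup>2 * (x - b * B * t powr (- B - 1))\<^sup>2 =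
          b\<^sup>2 * B\<^sup>2 * (\<theta> powr (2 + B) * y powr (2 + B) * (\<theta> powr (- 2 * B - 2) * (y powr (- 2 * B - 2) * (y powr (B + 1) - 1)\<^sup>2)))"
        unfolding diff wt2 by (simp only: power_mult_distrib sq mult_ac)
      also have "b\<^sup>2 * B\<^sup>2 * (\<theta> powr (2 + B) * y powr (2 + B) * (\<theta> powr (- 2 * B - 2) * (y powr (- 2 * B - 2) * (y powr (B + 1) - 1)\<^sup>2))) =
        b\<^sup>2 * B\<^sup>2 * (y powr (2 + B) * y powr (- 2 * B - 2)) * ((\<theta> powr (2 + B) * \<theta> powr (- 2 * B - 2)) * (y powr (B + 1) - 1)\<^sup>2)"
        by (simp add: mult_ac)
      also have "\<dots> = q (H, y)"
        by (simp add: q_def H_def flip: powr_add)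
      finally show ?thesis .
    qed
    have R: "((width \<theta>)\<^sup>2 + (\<theta> - t)\<^sup>2) / (width t)\<^sup>2 = (y powr (- B)) powr (1 + 2 / B) * (1 + H * (y - 1)\<^sup>2)"
    proof -
      have "(\<theta> - t)\<^sup>2 = \<theta>\<^sup>2 * (y - 1)\<^sup>2"
        by (simp add: y power2_eq_square algebra_simps)
      also have "\<theta>\<^sup>2 = (width \<theta>)\<^sup>2 * H"
        using width_power2_div[OF \<theta>] w \<theta> by (simp add: H_def field_simps)
      finally have "(width \<theta>)\<^sup>2 + (\<theta> - t)\<^sup>2 = (width \<theta>)\<^sup>2 * (1 + H * (y - 1)\<^sup>2)"
        by (simp add: algebra_simps)
      moreover have "(y powr (- B)) powr (1 + 2 / B) = 1 / (y powr (1 + B / 2))\<^sup>2"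
      proof -
        have "(y powr (- B)) powr (1 + 2 / B) = y powr (- B * (1 + 2 / B))"
          by (rule powr_powr)
        also have "- B * (1 + 2 / B) = - (2 + B)"
          using B_pos by (simp add: field_simps)
        also have "y powr (- (2 + B)) = 1 / (y powr (1 + B / 2))\<^sup>2"
          by (simp only: powr_minus_divide power2_eq_square powr_add[symmetric]) simp
        finally show ?thesis .
      qed
      ultimately show ?thesis
        using w by (simp add: wt power_mult_distrib)
    qed
    have exp_eq: "exp (phase x \<theta> - phase x t) = exp (- (b * scaled_excess (H, y)))"
      using phase_diff[of x t] x t by (simp add: \<theta>_def scaled_excess_def H_def y_def algebra_simps)
    have "exp (- (b * scaled_excess (H, y))) / width \<theta> * ((width t)\<^sup>2 + ((width \<theta>)\<^sup>2 + (\<theta> - t)\<^sup>2)\<^sup>2 / (width t)\<^sup>2) =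
        width t * (exp (- (b * scaled_excess (H, y))) * (width t / width \<theta> * (1 + (((width \<theta>)\<^sup>2 + (\<theta> - t)\<^sup>2) / (width t)\<^sup>2)\<^sup>2)))"
      using w by (simp add: field_simps power2_eq_square)
    also have "width t / width \<theta> * (1 + (((width \<theta>)\<^sup>2 + (\<theta> - t)\<^sup>2) / (width t)\<^sup>2)\<^sup>2) = f (H, y)"
      using w by (simp only: R) (simp add: f_def wt)
    also have "exp (- (b * scaled_excess (H, y))) * f (H, y) \<le> C / (1 + q (H, y))"
    proof -
      have "0 \<le> q (H, y)" using y by (simp add: q_def H_def)
      moreover have "(H, y) \<in> parameter_range"
        using parameter_range_saddle[OF x t] by (simp add: H_def y_def \<theta>_def)
      ultimately show ?thesis
        using C(2)[of "(H, y)"] by (simp add: pos_le_divide_eq mult_ac)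
    qed
    finally show "exp (phase x (saddle x) - phase x t) / width (saddle x) *
      ((width t)\<^sup>2 + ((width (saddle x))\<^sup>2 + (saddle x - t)\<^sup>2)\<^sup>2 / (width t)\<^sup>2) \<le>
      C * (width t / (1 + (width t)\<^sup>2 * (x - b * B * t powr (- B - 1))\<^sup>2))"
      unfolding \<theta>_def[symmetric] q_eq exp_eq
      by (simp add: mult_ac mult_right_mono less_imp_le[OF w(2)])
  qed
qed

end

section \<open>Integral inequalities\<close>

lemma nn_integral_inverse_1_plus_square: "(\<integral>\<^sup>+x. ennreal (1 / (1 + x\<^sup>2)) \<partial>lborel) = ennreal pi"
proof -
  have int: "integrable lborel (\<lambda>x::real. inverse (1 + x\<^sup>2))"
    using integrable_inverse_1_plus_square by (simp add: set_integrable_def)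
  have "(LINT x::real|lborel. inverse (1 + x\<^sup>2)) = pi"
    using LBINT_inverse_1_plus_square
    by (simp add: interval_lebesgue_integral_def set_lebesgue_integral_def)
  then show ?thesis
    using nn_integral_eq_integral[OF int] by (simp add: inverse_eq_divide)
qed

lemma nn_integral_lorentzian:
  assumes "0 < w"
  shows "(\<integral>\<^sup>+t. ennreal (1 / (1 + ((t - a) / w)\<^sup>2)) \<partial>lborel) = ennreal (w * pi)"
proof -
  have "ennreal pi = ennreal \<bar>1 / w\<bar> * (\<integral>\<^sup>+t. ennreal (1 / (1 + (- (a / w) + (1 / w) * t)\<^sup>2)) \<partial>lborel)"
    using assms nn_integral_real_affine[of "\<lambda>x. ennreal (1 / (1 + x\<^sup>2))" "1 / w" "- (a / w)"]
    by (simp add: nn_integral_inverse_1_plus_square)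
  also have "(\<lambda>t. - (a / w) + (1 / w) * t) = (\<lambda>t. (t - a) / w)"
    by (simp add: fun_eq_iff diff_divide_distrib)
  then have "(\<integral>\<^sup>+t. ennreal (1 / (1 + (- (a / w) + (1 / w) * t)\<^sup>2)) \<partial>lborel) =
      (\<integral>\<^sup>+t. ennreal (1 / (1 + ((t - a) / w)\<^sup>2)) \<partial>lborel)"
    by (simp add: fun_eq_iff)
  finally have "ennreal w * ennreal pi = (ennreal w * ennreal (1 / w)) * (\<integral>\<^sup>+t. ennreal (1 / (1 + ((t - a) / w)\<^sup>2)) \<partial>lborel)"
    using assms by (simp add: mult.assoc)
  also have "ennreal w * ennreal (1 / w) = 1"
    using assms by (simp flip: ennreal_mult)
  finally show ?thesis
    using assms by (simp add: ennreal_mult)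
qed

text \<open>Comparison with an integral over unit intervals: there 2 u moves by at most 2, and as
  \<tau> \<le> 1 the denominator changes at most by the factor 9. The integral over the line is pi /
  2 wherever the centre lies, so the bound is uniform in x.\<close>

lemma suminf_lorentzian_le:
  assumes "0 < \<tau>" "\<tau> \<le> 1"
  shows "(\<Sum>n. ennreal (\<tau> / (1 + \<tau>\<^sup>2 * (2 * real n + 2 - x)\<^sup>2))) \<le> ennreal (9 * pi / 2)"
proof -
  define h where "h u = 9 * (\<tau> / (1 + \<tau>\<^sup>2 * (2 * u + 2 - x)\<^sup>2))" for u
  have [measurable]: "h \<in> borel_measurable borel" unfolding h_def by measurable
  define A :: "nat \<Rightarrow> real set" where "A n = {real n..<real n + 1}" for n
  have pos: "0 < 1 + \<tau>\<^sup>2 * y\<^sup>2" for y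
    by (simp add: add_pos_nonneg)
  have step: "ennreal (\<tau> / (1 + \<tau>\<^sup>2 * (2 * real n + 2 - x)\<^sup>2)) \<le> emeasure (density lborel h) (A n)" for n
  proof -
    have le: "\<tau> / (1 + \<tau>\<^sup>2 * (2 * real n + 2 - x)\<^sup>2) \<le> h u" if "u \<in> A n" for u
    proof -
      define a \<delta> where "a = 2 * real n + 2 - x" and "\<delta> = 2 * (u - n)"
      have "\<delta>\<^sup>2 \<le> 2\<^sup>2" using that by (intro power_mono) (auto simp: A_def \<delta>_def)
      moreover have "(a + \<delta>)\<^sup>2 \<le> 2 * a\<^sup>2 + 2 * \<delta>\<^sup>2"
        using zero_le_power2[of "a - \<delta>"] by (simp add: power2_eq_square algebra_simps)
      ultimately have "\<tau>\<^sup>2 * (a + \<delta>)\<^sup>2 \<le> \<tau>\<^sup>2 * (2 * a\<^sup>2 + 8)"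
        by (intro mult_left_mono) auto
      also have "\<dots> \<le> 2 * (\<tau>\<^sup>2 * a\<^sup>2) + 8"
        using assms by (simp add: algebra_simps power_le_one)
      finally have "1 + \<tau>\<^sup>2 * (a + \<delta>)\<^sup>2 \<le> 9 * (1 + \<tau>\<^sup>2 * a\<^sup>2)"
        by (smt (verit) mult_nonneg_nonneg zero_le_power2)
      then have "\<tau> * (1 + \<tau>\<^sup>2 * (a + \<delta>)\<^sup>2) \<le> \<tau> * (9 * (1 + \<tau>\<^sup>2 * a\<^sup>2))"
        using assms by (intro mult_left_mono) auto
      moreover have "a + \<delta> = 2 * u + 2 - x" by (simp add: a_def \<delta>_def)
      ultimately have "\<tau> / (1 + \<tau>\<^sup>2 * a\<^sup>2) \<le> 9 * (\<tau> / (1 + \<tau>\<^sup>2 * (2 * u + 2 - x)\<^sup>2))"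
        using pos[of a] pos[of "2 * u + 2 - x"] by (simp add: divide_le_eq mult_ac) (simp add: le_divide_eq mult_ac)
      then show ?thesis by (simp add: h_def a_def)
    qed
    have "ennreal (\<tau> / (1 + \<tau>\<^sup>2 * (2 * real n + 2 - x)\<^sup>2)) =
        (\<integral>\<^sup>+u. ennreal (\<tau> / (1 + \<tau>\<^sup>2 * (2 * real n + 2 - x)\<^sup>2)) * indicator (A n) u \<partial>lborel)"
      by (subst nn_integral_cmult_indicator) (auto simp: A_def)
    also have "\<dots> \<le> (\<integral>\<^sup>+u. ennreal (h u) * indicator (A n) u \<partial>lborel)"
      using le by (intro nn_integral_mono) (auto split: split_indicator intro!: ennreal_leI)
    finally show ?thesis
      by (simp add: emeasure_density A_def)
  qed
  have disj: "disjoint_family A"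
    by (auto simp: disjoint_family_on_def A_def)
  have "(\<Sum>n. ennreal (\<tau> / (1 + \<tau>\<^sup>2 * (2 * real n + 2 - x)\<^sup>2))) \<le> (\<Sum>n. emeasure (density lborel h) (A n))"
    by (intro suminf_le step) auto
  also have "\<dots> = emeasure (density lborel h) (\<Union>n. A n)"
    by (rule suminf_emeasure[OF _ disj]) (auto simp: A_def)
  also have "\<dots> \<le> emeasure (density lborel h) UNIV"
    by (intro emeasure_mono) auto
  also have "\<dots> = (\<integral>\<^sup>+u. ennreal (9 * \<tau>) * ennreal (1 / (1 + ((u - (x / 2 - 1)) / (1 / (2 * \<tau>)))\<^sup>2)) \<partial>lborel)"
  proof -
    have "((u - (x / 2 - 1)) / (1 / (2 * \<tau>)))\<^sup>2 = \<tau>\<^sup>2 * (2 * u + 2 - x)\<^sup>2" for u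
      by (simp add: power_mult_distrib[symmetric]) (simp add: algebra_simps)
    then show ?thesis
      using assms by (simp add: emeasure_density h_def ennreal_mult[symmetric])
  qed
  also have "\<dots> = ennreal (9 * pi / 2)"
    using assms by (subst nn_integral_cmult, simp, subst nn_integral_lorentzian) (simp_all flip: ennreal_mult)
  finally show ?thesis .
qed

text \<open>Expands the nonnegative integral of the squared deviation of h from its weighted mean D
  / m.\<close>

lemma weighted_mean_square:
  fixes h w :: "'a \<Rightarrow> real"
  assumes w: "\<And>x. x \<in> space M \<Longrightarrow> 0 \<le> w x" "integrable M w" "0 < integral\<^sup>L M w"
    and hw: "integrable M (\<lambda>x. h x * w x)" and h2w: "integrable M (\<lambda>x. (h x)\<^sup>2 * w x)"
  shows "(LINT x|M. h x * w x)\<^sup>2 \<le> integral\<^sup>L M w * (LINT x|M. (h x)\<^sup>2 * w x)"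
proof -
  define m D where "m = integral\<^sup>L M w" and "D = (LINT x|M. h x * w x)"
  have "0 \<le> (LINT x|M. (h x - D / m)\<^sup>2 * w x)"
    using w by (intro Bochner_Integration.integral_nonneg) auto
  also have "\<dots> = (LINT x|M. (h x)\<^sup>2 * w x - (2 * (D / m)) * (h x * w x) + (D / m)\<^sup>2 * w x)"
    by (intro Bochner_Integration.integral_cong) (auto simp: power2_eq_square algebra_simps)
  also have "\<dots> = (LINT x|M. (h x)\<^sup>2 * w x) - (2 * (D / m)) * D + (D / m)\<^sup>2 * m"
    using hw h2w w by (simp add: m_def D_def)
  also have "\<dots> = (LINT x|M. (h x)\<^sup>2 * w x) - D\<^sup>2 / m"
    using w by (simp add: m_def[symmetric] power2_eq_square field_simps)
  finally show ?thesis
    using w by (simp add: m_def[symmetric] D_def[symmetric] pos_divide_le_eq mult.commute)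
qed

lemma cmod_power2_sum:
  fixes f :: "'a \<Rightarrow> complex"
  shows "complex_of_real ((cmod (sum f A))\<^sup>2) = (\<Sum>j\<in>A. \<Sum>k\<in>A. f j * cnj (f k))"
  by (simp only: complex_norm_square cnj_sum sum_product)

text \<open>Orthogonality of homogeneous functions of different degree gives Bessel's inequality; the
  limit is Fatou's lemma, so neither side needs to be finite.\<close>

lemma nn_integral_homogeneous_series_le:
  fixes b :: "nat \<Rightarrow> complex \<Rightarrow> complex"
  assumes meas [measurable]: "\<And>n. b n \<in> borel_measurable disc_area"
    and rot: "\<And>n c z. cmod c = 1 \<Longrightarrow> z \<in> unit_disc \<Longrightarrow> b n (c * z) = c ^ n * b n z"
    and F: "\<And>z. z \<in> unit_disc \<Longrightarrow> z \<noteq> 0 \<Longrightarrow> (\<lambda>n. b n z) sums F z"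
  shows "(\<integral>\<^sup>+z. ennreal ((cmod (F z))\<^sup>2) \<partial>disc_area) \<le> (\<Sum>n. \<integral>\<^sup>+z. ennreal ((cmod (b n z))\<^sup>2) \<partial>disc_area)"
proof (cases "\<exists>n. (\<integral>\<^sup>+z. ennreal ((cmod (b n z))\<^sup>2) \<partial>disc_area) = \<infinity>")
  case True
  then obtain n where "(\<integral>\<^sup>+z. ennreal ((cmod (b n z))\<^sup>2) \<partial>disc_area) = \<infinity>" by blast
  then have "\<infinity> \<le> (\<Sum>n. \<integral>\<^sup>+z. ennreal ((cmod (b n z))\<^sup>2) \<partial>disc_area)"
    using sum_le_suminf[of "\<lambda>n. \<integral>\<^sup>+z. ennreal ((cmod (b n z))\<^sup>2) \<partial>disc_area" "{n}"] by simp
  then show ?thesis by (simp add: top_unique)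
next
  case False
  have int: "integrable disc_area (\<lambda>z. (cmod (b n z))\<^sup>2)" for n
    using False by (intro integrableI_bounded) (auto simp: less_top)
  have int2: "integrable disc_area (\<lambda>z. b j z * cnj (b k z))" for j k
  proof (rule Bochner_Integration.integrable_bound[OF Bochner_Integration.integrable_add[OF int[of j] int[of k]]])
    show "AE z in disc_area. norm (b j z * cnj (b k z)) \<le> norm ((cmod (b j z))\<^sup>2 + (cmod (b k z))\<^sup>2)"
    proof (rule AE_I2)
      fix z
      have "2 * (cmod (b j z) * cmod (b k z)) \<le> (cmod (b j z))\<^sup>2 + (cmod (b k z))\<^sup>2"
        using zero_le_power2[of "cmod (b j z) - cmod (b k z)"] by (simp add: power2_eq_square algebra_simps)
      moreover have "0 \<le> cmod (b j z) * cmod (b k z)" by simp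
      ultimately have "norm (b j z * cnj (b k z)) \<le> (cmod (b j z))\<^sup>2 + (cmod (b k z))\<^sup>2"
        unfolding norm_mult complex_mod_cnj by linarith
      then show "norm (b j z * cnj (b k z)) \<le> norm ((cmod (b j z))\<^sup>2 + (cmod (b k z))\<^sup>2)"
        by simp
    qed
  qed measurable
  have orth: "(LINT z|disc_area. b j z * cnj (b k z)) = (if j = k then of_real (LINT z|disc_area. (cmod (b j z))\<^sup>2) else 0)" for j k
  proof (cases "j = k")
    case True
    then show ?thesis
      by (simp add: complex_norm_square[symmetric] del: of_real_power)
  next
    case False
    then show ?thesis
      using integral_disc_area_eq_0[of "\<lambda>z. b j z * cnj (b k z)" j k] by (simp add: rot mult_ac)
  qed
  have fin: "(\<integral>\<^sup>+z. ennreal ((cmod (\<Sum>n<N. b n z))\<^sup>2) \<partial>disc_area) = (\<Sum>n<N. \<integral>\<^sup>+z. ennreal ((cmod (b n z))\<^sup>2) \<partial>disc_area)" for N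
  proof -
    have intS: "integrable disc_area (\<lambda>z. complex_of_real ((cmod (\<Sum>n<N. b n z))\<^sup>2))"
      unfolding cmod_power2_sum by (intro Bochner_Integration.integrable_sum int2)
    have "complex_of_real (LINT z|disc_area. (cmod (\<Sum>n<N. b n z))\<^sup>2) = (LINT z|disc_area. (\<Sum>j<N. \<Sum>k<N. b j z * cnj (b k z)))"
      unfolding integral_complex_of_real[symmetric] cmod_power2_sum ..
    also have "\<dots> = (\<Sum>j<N. \<Sum>k<N. (LINT z|disc_area. b j z * cnj (b k z)))"
      by (simp add: int2 Bochner_Integration.integral_sum Bochner_Integration.integrable_sum)
    also have "\<dots> = of_real (\<Sum>n<N. LINT z|disc_area. (cmod (b n z))\<^sup>2)"
      by (simp add: orth)
    finally have eq: "(LINT z|disc_area. (cmod (\<Sum>n<N. b n z))\<^sup>2) = (\<Sum>n<N. LINT z|disc_area. (cmod (b n z))\<^sup>2)"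
      by (simp only: of_real_eq_iff)
    have "(\<integral>\<^sup>+z. ennreal ((cmod (\<Sum>n<N. b n z))\<^sup>2) \<partial>disc_area) = ennreal (LINT z|disc_area. (cmod (\<Sum>n<N. b n z))\<^sup>2)"
      using intS by (intro nn_integral_eq_integral) (auto simp only: complex_of_real_integrable_eq AE_I2 zero_le_power2)
    also have "\<dots> = (\<Sum>n<N. ennreal (LINT z|disc_area. (cmod (b n z))\<^sup>2))"
      unfolding eq by (intro sum_ennreal[symmetric] Bochner_Integration.integral_nonneg) simp
    also have "\<dots> = (\<Sum>n<N. \<integral>\<^sup>+z. ennreal ((cmod (b n z))\<^sup>2) \<partial>disc_area)"
      using int by (intro sum.cong nn_integral_eq_integral[symmetric]) auto
    finally show ?thesis .
  qed
  have "(\<integral>\<^sup>+z. ennreal ((cmod (F z))\<^sup>2) \<partial>disc_area) = (\<integral>\<^sup>+z. liminf (\<lambda>N. ennreal ((cmod (\<Sum>n<N. b n z))\<^sup>2)) \<partial>disc_area)"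
  proof (rule nn_integral_cong_AE, rule AE_disc_areaI)
    fix z :: complex assume "z \<in> unit_disc" "z \<noteq> 0"
    then have "(\<lambda>N. ennreal ((cmod (\<Sum>n<N. b n z))\<^sup>2)) \<longlonglongrightarrow> ennreal ((cmod (F z))\<^sup>2)"
      using F[of z] unfolding sums_def by (intro tendsto_intros tendsto_ennrealI) auto
    then show "ennreal ((cmod (F z))\<^sup>2) = liminf (\<lambda>N. ennreal ((cmod (\<Sum>n<N. b n z))\<^sup>2))"
      by (intro lim_imp_Liminf[symmetric]) auto
  qed
  also have "\<dots> \<le> liminf (\<lambda>N. \<integral>\<^sup>+z. ennreal ((cmod (\<Sum>n<N. b n z))\<^sup>2) \<partial>disc_area)"
    by (intro nn_integral_liminf) measurable
  also have "\<dots> = liminf (\<lambda>N. \<Sum>n<N. \<integral>\<^sup>+z. ennreal ((cmod (b n z))\<^sup>2) \<partial>disc_area)"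
    by (simp only: fin)
  also have "\<dots> \<le> (\<Sum>n. \<integral>\<^sup>+z. ennreal ((cmod (b n z))\<^sup>2) \<partial>disc_area)"
    by (intro Liminf_le always_eventually allI sum_le_suminf) auto
  finally show ?thesis .
qed

section \<open>Moments of exponential weights\<close>

text \<open>The upper bound carries no constant because 1 - exp (- w) \<le> w; c accounts for a
  bounded error in the exponent on the other side.\<close>

locale exponential_weight = radial_weight \<omega> + exponential_parameters b B for \<omega> b B +
  fixes c :: real
  assumes c_pos: "0 < c"
    and weight_ge: "\<And>t. 0 < t \<Longrightarrow> c * exp (- (b * t powr (- B))) \<le> \<omega> (exp (- t))"
    and weight_le: "\<And>t. 0 < t \<Longrightarrow> \<omega> (exp (- t)) \<le> exp (- (b * t powr (- B)))"
begin

text \<open>Measurability of \<omega> is known only after composition with the modulus. The model is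
  Borel on the line and may therefore enter \<open>nn_integral_disc_area_radial\<close>.\<close>

definition model :: "real \<Rightarrow> real" where
  "model r = exp (- (b * (- ln r) powr (- B)))"

lemma borel_measurable_model [measurable]: "model \<in> borel_measurable borel"
  unfolding model_def by measurable

lemma model_exp [simp]: "model (exp (- t)) = exp (- (b * t powr (- B)))"
  by (simp add: model_def)

lemma model_bounds:
  assumes "z \<in> unit_disc" "z \<noteq> 0"
  shows "c * model (cmod z) \<le> \<omega> (cmod z)" "\<omega> (cmod z) \<le> model (cmod z)"
  using weight_ge[of "- ln (cmod z)"] weight_le[of "- ln (cmod z)"] assms
  by (simp_all add: model_def)

lemma exp_phase:
  "exp (- t) ^ (2 * n) * (exp (- (b * t powr (- B))) * exp (- 2 * t)) = exp (- phase (2 * real n + 2) t)"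
  by (simp add: phase_def algebra_simps flip: exp_of_nat_mult exp_add)

lemma nn_integral_model:
  assumes [measurable]: "g \<in> borel_measurable borel" and "\<And>r. 0 \<le> g r"
  shows "(\<integral>\<^sup>+z. ennreal (cmod z ^ (2 * n) * g (cmod z) * model (cmod z)) \<partial>disc_area) =
    (\<integral>\<^sup>+t\<in>{0<..}. ennreal (2 * g (exp (- t)) * exp (- phase (2 * real n + 2) t)) \<partial>lborel)"
proof -
  have "(\<integral>\<^sup>+z. ennreal (cmod z ^ (2 * n) * g (cmod z) * model (cmod z)) \<partial>disc_area) =
      (\<integral>\<^sup>+t\<in>{0<..}. ennreal (exp (- t) ^ (2 * n) * g (exp (- t)) * model (exp (- t))) * ennreal (2 * exp (- 2 * t)) \<partial>lborel)"
    by (rule nn_integral_disc_area_radial) measurable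
  also have "\<dots> = (\<integral>\<^sup>+t\<in>{0<..}. ennreal (2 * g (exp (- t)) * exp (- phase (2 * real n + 2) t)) \<partial>lborel)"
    unfolding exp_phase[symmetric] model_exp
    using assms(2) by (intro nn_integral_cong arg_cong2[where f = "(*)"] refl) (simp add: mult_ac flip: ennreal_mult)
  finally show ?thesis .
qed

section \<open>Laplace bounds for moments and variances\<close>

abbreviation saddle_n :: "nat \<Rightarrow> real" where
  "saddle_n n \<equiv> saddle (2 * real n + 2)"

lemma saddle_n_pos: "0 < saddle_n n"
  by (rule saddle_pos) simp

text \<open>Only one width to the right of the saddle is kept. There the phase exceeds its minimum
  by at most L, the weight gives c and the area density gives the factor 2.\<close>

lemma moment_ge:
  obtains K where "0 < K"
    "\<And>n. K * (width (saddle_n n) * exp (- phase (2 * real n + 2) (saddle_n n))) \<le> moment n"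
proof
  define L where "L = b * (B + B\<^sup>2)"
  show "0 < 2 * c * exp (- L)" using c_pos by simp
  fix n
  define x \<theta> where "x = 2 * real n + 2" and "\<theta> = saddle x"
  have \<theta>: "0 < \<theta>" "0 < width \<theta>"
    using saddle_n_pos[of n] width_pos by (auto simp: x_def \<theta>_def)
  have "ennreal (2 * c * exp (- L) * (width \<theta> * exp (- phase x \<theta>))) =
      (\<integral>\<^sup>+t. ennreal (2 * c * exp (- L) * exp (- phase x \<theta>)) * indicator {\<theta>..\<theta> + width \<theta>} t \<partial>lborel)"
    using \<theta> c_pos by (subst nn_integral_cmult_indicator) (auto simp: mult_ac simp flip: ennreal_mult)
  also have "\<dots> \<le> (\<integral>\<^sup>+t\<in>{0<..}. ennreal (2 * c * exp (- phase x t)) \<partial>lborel)"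
  proof (rule nn_integral_mono)
    fix t :: real
    show "ennreal (2 * c * exp (- L) * exp (- phase x \<theta>)) * indicator {\<theta>..\<theta> + width \<theta>} t \<le>
        ennreal (2 * c * exp (- phase x t)) * indicator {0<..} t"
    proof (cases "t \<in> {\<theta>..\<theta> + width \<theta>}")
      case True
      then have "phase x t \<le> phase x \<theta> + L"
        using phase_near_saddle[of x t] by (simp add: x_def \<theta>_def L_def)
      then have "exp (- L) * exp (- phase x \<theta>) \<le> exp (- phase x t)"
        by (simp flip: exp_add)
      then have "2 * c * exp (- L) * exp (- phase x \<theta>) \<le> 2 * c * exp (- phase x t)"
        using c_pos by (simp add: mult.assoc)
      then show ?thesis using True \<theta> by (simp add: ennreal_leI)
    qed simp
  qed
  also have "\<dots> = (\<integral>\<^sup>+z. ennreal (cmod z ^ (2 * n) * c * model (cmod z)) \<partial>disc_area)"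
    using nn_integral_model[of "\<lambda>_. c" n] c_pos by (simp add: x_def mult_ac)
  also have "\<dots> \<le> (\<integral>\<^sup>+z. ennreal (cmod z ^ (2 * n) * \<omega> (cmod z)) \<partial>disc_area)"
  proof (rule nn_integral_mono_AE, rule AE_disc_areaI)
    fix z :: complex assume "z \<in> unit_disc" "z \<noteq> 0"
    then have "cmod z ^ (2 * n) * (c * model (cmod z)) \<le> cmod z ^ (2 * n) * \<omega> (cmod z)"
      by (intro mult_left_mono model_bounds) auto
    then show "ennreal (cmod z ^ (2 * n) * c * model (cmod z)) \<le> ennreal (cmod z ^ (2 * n) * \<omega> (cmod z))"
      by (intro ennreal_leI) (simp add: mult.assoc)
  qed
  also have "\<dots> = ennreal (moment n)"
    unfolding moment_def using weight_nonneg by (intro nn_integral_eq_integral integrable_moment AE_I2) simp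
  finally show "2 * c * exp (- L) * (width (saddle_n n) * exp (- phase (2 * real n + 2) (saddle_n n))) \<le> moment n"
    using moment_pos[of n] by (simp add: x_def \<theta>_def ennreal_le_iff)
qed

text \<open>Not normalized by the mass, and taken about an arbitrary s instead of the mean: s will
  be the modulus of the kernel's parameter.\<close>

definition variance :: "nat \<Rightarrow> real \<Rightarrow> real" where
  "variance n s = (LINT z|disc_area. (cmod z - s)\<^sup>2 * (cmod z ^ (2 * n) * \<omega> (cmod z)))"

lemma integrable_polynomial_moment:
  assumes "continuous_on {0..1} g"
  shows "integrable disc_area (\<lambda>z. g (cmod z) * (cmod z ^ k * \<omega> (cmod z)))"
proof -
  have "compact (g ` {0..1})" using assms by (intro compact_continuous_image) auto
  then have "\<exists>C. \<forall>r\<in>{0..1}. \<bar>g r\<bar> \<le> C"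
    by (auto dest!: compact_imp_bounded simp: bounded_iff)
  then obtain C where C: "\<And>r. r \<in> {0..1} \<Longrightarrow> \<bar>g r\<bar> \<le> C"
    by blast
  have meas: "(\<lambda>z. g (cmod z)) \<in> borel_measurable disc_area"
    by (intro continuous_on_disc_measurable continuous_on_compose2[OF assms] continuous_intros) auto
  have "integrable disc_area (\<lambda>z. (g (cmod z) * cmod z ^ k) * of_real (\<omega> (cmod z)))"
  proof (rule integrable_bounded_mult_weight[where C = C])
    show "norm (g (cmod z) * cmod z ^ k) \<le> C" if "z \<in> unit_disc" for z
      using mult_mono[of "\<bar>g (cmod z)\<bar>" C "cmod z ^ k" 1] that C[of "cmod z"] order.trans[OF abs_ge_zero C[of 0]]
      by (auto simp: abs_mult power_le_one)
  qed (use meas in measurable)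
  then show ?thesis by (simp add: mult.assoc)
qed

lemma variance_nonneg: "0 \<le> variance n s"
  unfolding variance_def using weight_nonneg by (intro Bochner_Integration.integral_nonneg) simp

lemma nn_integral_variance:
  "(\<integral>\<^sup>+z. ennreal ((cmod z - s)\<^sup>2 * (cmod z ^ (2 * n) * \<omega> (cmod z))) \<partial>disc_area) = ennreal (variance n s)"
  unfolding variance_def using weight_nonneg
  by (intro nn_integral_eq_integral integrable_polynomial_moment AE_I2 continuous_intros) simp

lemma exp_minus_diff_le:
  assumes "0 \<le> t" "0 \<le> u"
  shows "(exp (- t) - exp (- u))\<^sup>2 \<le> (t - u :: real)\<^sup>2"
proof -
  have *: "exp (- t) - exp (- u) \<le> u - t" if "0 \<le> t" "t \<le> u" for t u :: real
  proof -
    have "exp (- t) - exp (- u) = exp (- t) * (1 - exp (- (u - t)))"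
      by (simp add: right_diff_distrib flip: exp_add)
    also have "\<dots> \<le> 1 * (1 - exp (- (u - t)))"
      using that by (intro mult_right_mono) auto
    also have "\<dots> \<le> u - t"
    proof -
      define e where "e = exp (- (u - t))"
      have "1 + - (u - t) \<le> e" unfolding e_def by (rule exp_ge_add_one_self)
      then show ?thesis unfolding e_def[symmetric] by simp
    qed
    finally show ?thesis .
  qed
  have "\<bar>exp (- t) - exp (- u)\<bar> \<le> \<bar>t - u\<bar>"
    using *[of t u] *[of u t] assms by (cases "t \<le> u") auto
  then show ?thesis
    by (simp add: abs_le_square_iff)
qed

text \<open>The distance to t is split at the saddle into fluctuation and bias. The tail bound
  spends one factor 1 + v on the squared distance and the other on the integration over the
  line.\<close>

lemma variance_le:
  obtains K where "0 < K" "\<And>n t. 0 < t \<Longrightarrow>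
    variance n (exp (- t)) \<le> K * (width (saddle_n n) * exp (- phase (2 * real n + 2) (saddle_n n)) *
      ((width (saddle_n n))\<^sup>2 + (saddle_n n - t)\<^sup>2))"
proof -
  obtain C where C: "0 < C" "\<And>x t. 2 \<le> x \<Longrightarrow> 0 < t \<Longrightarrow>
    exp (phase x (saddle x) - phase x t) * (1 + ((t - saddle x) / width (saddle x))\<^sup>2)\<^sup>2 \<le> C"
    using phase_tail_bound by blast
  show ?thesis
  proof (rule that[of "4 * C * pi"])
    show "0 < 4 * C * pi" using C by simp
    fix n and u :: real assume u: "0 < u"
    define x \<theta> \<sigma> where "x = 2 * real n + 2" and "\<theta> = saddle x" and "\<sigma> = width \<theta>"
    have \<theta>: "0 < \<theta>" "0 < \<sigma>"
      using saddle_n_pos[of n] width_pos by (auto simp: x_def \<theta>_def \<sigma>_def)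
    define R where "R = \<sigma>\<^sup>2 + (\<theta> - u)\<^sup>2"
    have R: "0 \<le> R" by (simp add: R_def)
    have key: "exp (- phase x t) * (exp (- t) - exp (- u))\<^sup>2 \<le> (2 * C * R * exp (- phase x \<theta>)) * (1 / (1 + ((t - \<theta>) / \<sigma>)\<^sup>2))"
      if t: "0 < t" for t
    proof -
      define v where "v = ((t - \<theta>) / \<sigma>)\<^sup>2"
      have v: "0 \<le> v" "(t - \<theta>)\<^sup>2 = \<sigma>\<^sup>2 * v" using \<theta> by (auto simp: v_def power_divide)
      have "(exp (- t) - exp (- u))\<^sup>2 \<le> (t - u)\<^sup>2"
        using t u by (intro exp_minus_diff_le) auto
      also have "\<dots> \<le> 2 * (t - \<theta>)\<^sup>2 + 2 * (\<theta> - u)\<^sup>2"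
        using zero_le_power2[of "(t - \<theta>) - (\<theta> - u)"] by (simp add: power2_eq_square algebra_simps)
      also have "\<dots> \<le> 2 * R * (1 + v)"
        using v by (simp add: R_def algebra_simps)
      finally have 1: "(exp (- t) - exp (- u))\<^sup>2 \<le> 2 * R * (1 + v)" .
      have "exp (phase x \<theta> - phase x t) * (1 + v)\<^sup>2 \<le> C"
        using C(2)[of x t] t by (simp add: x_def \<theta>_def \<sigma>_def v_def)
      then have "exp (phase x \<theta> - phase x t) * (1 + v) \<le> C / (1 + v)"
        using v by (simp add: pos_le_divide_eq power2_eq_square mult.assoc)
      have "exp (- phase x t) * (exp (- t) - exp (- u))\<^sup>2 \<le> exp (- phase x t) * (2 * R * (1 + v))"
        using 1 by (intro mult_left_mono) auto
      also have "\<dots> = 2 * R * exp (- phase x \<theta>) * (exp (phase x \<theta> - phase x t) * (1 + v))"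
        by (simp add: mult_ac flip: exp_add)
      also have "\<dots> \<le> 2 * R * exp (- phase x \<theta>) * (C / (1 + v))"
        using R by (intro mult_left_mono \<open>exp (phase x \<theta> - phase x t) * (1 + v) \<le> C / (1 + v)\<close>) auto
      finally show ?thesis by (simp add: v_def mult_ac)
    qed
    have "ennreal (variance n (exp (- u))) \<le> (\<integral>\<^sup>+z. ennreal (cmod z ^ (2 * n) * (cmod z - exp (- u))\<^sup>2 * model (cmod z)) \<partial>disc_area)"
      unfolding nn_integral_variance[symmetric]
    proof (rule nn_integral_mono_AE, rule AE_disc_areaI)
      fix z :: complex assume "z \<in> unit_disc" "z \<noteq> 0"
      then have "((cmod z - exp (- u))\<^sup>2 * cmod z ^ (2 * n)) * \<omega> (cmod z) \<le> ((cmod z - exp (- u))\<^sup>2 * cmod z ^ (2 * n)) * model (cmod z)"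
        by (intro mult_left_mono model_bounds) auto
      then show "ennreal ((cmod z - exp (- u))\<^sup>2 * (cmod z ^ (2 * n) * \<omega> (cmod z))) \<le>
          ennreal (cmod z ^ (2 * n) * (cmod z - exp (- u))\<^sup>2 * model (cmod z))"
        by (intro ennreal_leI) (simp add: mult_ac)
    qed
    also have "\<dots> = (\<integral>\<^sup>+t\<in>{0<..}. ennreal (2 * (exp (- t) - exp (- u))\<^sup>2 * exp (- phase x t)) \<partial>lborel)"
      using nn_integral_model[of "\<lambda>r. (r - exp (- u))\<^sup>2" n] by (simp add: x_def)
    also have "\<dots> \<le> (\<integral>\<^sup>+t. ennreal (4 * C * R * exp (- phase x \<theta>)) * ennreal (1 / (1 + ((t - \<theta>) / \<sigma>)\<^sup>2)) \<partial>lborel)"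
    proof (rule nn_integral_mono)
      fix t :: real
      show "ennreal (2 * (exp (- t) - exp (- u))\<^sup>2 * exp (- phase x t)) * indicator {0<..} t \<le>
          ennreal (4 * C * R * exp (- phase x \<theta>)) * ennreal (1 / (1 + ((t - \<theta>) / \<sigma>)\<^sup>2))"
      proof (cases "0 < t")
        case True
        have "2 * (exp (- t) - exp (- u))\<^sup>2 * exp (- phase x t) \<le> (4 * C * R * exp (- phase x \<theta>)) * (1 / (1 + ((t - \<theta>) / \<sigma>)\<^sup>2))"
          using mult_left_mono[OF key[OF True], of 2] by (simp add: mult_ac)
        then have "ennreal (2 * (exp (- t) - exp (- u))\<^sup>2 * exp (- phase x t)) \<le> ennreal ((4 * C * R * exp (- phase x \<theta>)) * (1 / (1 + ((t - \<theta>) / \<sigma>)\<^sup>2)))"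
          by (rule ennreal_leI)
        then show ?thesis
          using True C R by (subst ennreal_mult[symmetric]) (auto simp: add_nonneg_nonneg)
      qed simp
    qed
    also have "\<dots> = ennreal (4 * C * R * exp (- phase x \<theta>)) * ennreal (\<sigma> * pi)"
      using \<theta> by (subst nn_integral_cmult) (auto simp: nn_integral_lorentzian)
    also have "\<dots> = ennreal (4 * C * pi * (\<sigma> * exp (- phase x \<theta>) * R))"
      using \<theta> C R by (simp add: mult_ac flip: ennreal_mult)
    finally have "variance n (exp (- u)) \<le> 4 * C * pi * (\<sigma> * exp (- phase x \<theta>) * R)"
      using \<theta> C R by (subst (asm) ennreal_le_iff) auto
    then show "variance n (exp (- u)) \<le> 4 * C * pi * (width (saddle_n n) * exp (- phase (2 * real n + 2) (saddle_n n)) *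
      ((width (saddle_n n))\<^sup>2 + (saddle_n n - u)\<^sup>2))"
      by (simp add: R_def \<sigma>_def \<theta>_def x_def)
  qed
qed

text \<open>Squared fluctuation plus squared bias: up to a constant it bounds the normalized
  variance about exp (- t).\<close>

definition spread :: "nat \<Rightarrow> real \<Rightarrow> real" where
  "spread n t = (width (saddle_n n))\<^sup>2 + (saddle_n n - t)\<^sup>2"

lemma variance_le_spread:
  obtains K where "0 < K" "\<And>n t. 0 < t \<Longrightarrow> variance n (exp (- t)) \<le> K * (moment n * spread n t)"
proof -
  obtain K where K: "0 < K" "\<And>n. K * (width (saddle_n n) * exp (- phase (2 * real n + 2) (saddle_n n))) \<le> moment n"
    using moment_ge by blast
  obtain L where L: "0 < L" "\<And>n t. 0 < t \<Longrightarrow>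
    variance n (exp (- t)) \<le> L * (width (saddle_n n) * exp (- phase (2 * real n + 2) (saddle_n n)) *
      ((width (saddle_n n))\<^sup>2 + (saddle_n n - t)\<^sup>2))"
    using variance_le by blast
  show ?thesis
  proof (rule that[of "L / K"])
    fix n and t :: real assume t: "0 < t"
    define A where "A = width (saddle_n n) * exp (- phase (2 * real n + 2) (saddle_n n))"
    have "A \<le> moment n / K" using K by (simp add: A_def pos_le_divide_eq mult.commute)
    have "variance n (exp (- t)) \<le> L * (A * spread n t)"
      using L(2)[OF t, of n] by (simp add: A_def spread_def)
    also have "\<dots> \<le> L * (moment n / K * spread n t)"
      using L \<open>A \<le> moment n / K\<close> by (intro mult_left_mono mult_right_mono) (auto simp: spread_def)
    finally show "variance n (exp (- t)) \<le> L / K * (moment n * spread n t)"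
      by simp
  qed (use K L in simp)
qed

text \<open>The common majorant for all coefficient estimates. The spread is squared because it
  enters twice, through the coefficients of (z - s) K(s z) and through the weight (|z| - s)^2; the
  division is the one in the weight for the Cauchy-Schwarz inequality.\<close>

definition kernel_term :: "real \<Rightarrow> nat \<Rightarrow> real" where
  "kernel_term t n = exp (- t) ^ (2 * n) / moment n * ((width t)\<^sup>2 + (spread n t)\<^sup>2 / (width t)\<^sup>2)"

lemma kernel_term_nonneg: "0 \<le> kernel_term t n"
  using moment_pos[of n] by (simp add: kernel_term_def)

text \<open>Inserting the lower bound for the moments leaves exp (b t^(-B)) times a Lorentzian in 2
  n + 2, centred at the frequency whose saddle is t. Its sum over n is bounded independently of
  t.\<close>

lemma suminf_kernel_term_le:
  obtains K where "0 < K" "\<And>t. 0 < t \<Longrightarrow> t \<le> 1 \<Longrightarrow> (\<Sum>n. ennreal (kernel_term t n)) \<le> ennreal (K * exp (b * t powr (- B)))"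
proof -
  obtain K where K: "0 < K" "\<And>n. K * (width (saddle_n n) * exp (- phase (2 * real n + 2) (saddle_n n))) \<le> moment n"
    using moment_ge by blast
  obtain C where C: "0 < C" "\<And>x t. 2 \<le> x \<Longrightarrow> 0 < t \<Longrightarrow>
    exp (phase x (saddle x) - phase x t) / width (saddle x) *
      ((width t)\<^sup>2 + ((width (saddle x))\<^sup>2 + (saddle x - t)\<^sup>2)\<^sup>2 / (width t)\<^sup>2) \<le>
    C * (width t / (1 + (width t)\<^sup>2 * (x - b * B * t powr (- B - 1))\<^sup>2))"
    using phase_term_bound by blast
  show ?thesis
  proof (rule that[of "exp 2 / K * C * (9 * pi / 2)"])
    show "0 < exp 2 / K * C * (9 * pi / 2)" using K C by simp
    fix t :: real assume t: "0 < t" "t \<le> 1"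
    define D where "D = exp 2 / K * exp (b * t powr (- B)) * C"
    have D: "0 \<le> D" using K C by (simp add: D_def)
    have wt: "0 < width t" "width t \<le> 1"
      using t width_pos B_pos by (auto simp: width_def intro!: powr_le1)
    have le: "kernel_term t n \<le> D * (width t / (1 + (width t)\<^sup>2 * (2 * real n + 2 - b * B * t powr (- B - 1))\<^sup>2))" for n
    proof -
      define x \<theta> where "x = 2 * real n + 2" and "\<theta> = saddle x"
      have \<theta>: "0 < \<theta>" "0 < width \<theta>"
        using saddle_n_pos[of n] width_pos by (auto simp: x_def \<theta>_def)
      have "exp (- t) ^ (2 * n) = exp (- (2 * n * t))"
        by (simp add: algebra_simps flip: exp_of_nat_mult)
      \<comment> \<open>\<open>x = 2 n + 2\<close> includes the area density, which is absent from
        the coefficient; restoring it costs exp (2 t), at most exp 2.\<close>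
      also have "\<dots> = exp (2 * t) * exp (b * t powr (- B)) * exp (- phase x t)"
        by (simp add: phase_def x_def algebra_simps flip: exp_add)
      also have "\<dots> \<le> exp 2 * exp (b * t powr (- B)) * exp (- phase x t)"
        using t by (intro mult_right_mono) auto
      finally have "exp (- t) ^ (2 * n) / moment n \<le> exp 2 * exp (b * t powr (- B)) * exp (- phase x t) / moment n"
        using moment_pos[of n] by (intro divide_right_mono) auto
      also have "\<dots> \<le> exp 2 * exp (b * t powr (- B)) * exp (- phase x t) / (K * (width \<theta> * exp (- phase x \<theta>)))"
        using K \<theta> moment_pos[of n] by (intro divide_left_mono) (auto simp: x_def \<theta>_def)
      also have "\<dots> = exp 2 / K * exp (b * t powr (- B)) * (exp (phase x \<theta> - phase x t) / width \<theta>)"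
        using K \<theta> by (simp add: exp_diff exp_minus field_simps)
      finally have "kernel_term t n \<le> exp 2 / K * exp (b * t powr (- B)) * (exp (phase x \<theta> - phase x t) / width \<theta>) *
          ((width t)\<^sup>2 + (spread n t)\<^sup>2 / (width t)\<^sup>2)"
        unfolding kernel_term_def by (intro mult_right_mono) auto
      also have "\<dots> = exp 2 / K * exp (b * t powr (- B)) * (exp (phase x \<theta> - phase x t) / width \<theta> *
          ((width t)\<^sup>2 + ((width \<theta>)\<^sup>2 + (\<theta> - t)\<^sup>2)\<^sup>2 / (width t)\<^sup>2))"
        by (simp add: spread_def \<theta>_def x_def)
      also have "\<dots> \<le> exp 2 / K * exp (b * t powr (- B)) * (C * (width t / (1 + (width t)\<^sup>2 * (x - b * B * t powr (- B - 1))\<^sup>2)))"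
        using C(2)[of x t] K t by (intro mult_left_mono) (auto simp: x_def \<theta>_def)
      finally show ?thesis by (simp add: D_def x_def mult_ac)
    qed
    have "(\<Sum>n. ennreal (kernel_term t n)) \<le>
        (\<Sum>n. ennreal D * ennreal (width t / (1 + (width t)\<^sup>2 * (2 * real n + 2 - b * B * t powr (- B - 1))\<^sup>2)))"
    proof (intro suminf_le allI)
      fix n
      have "0 \<le> width t / (1 + (width t)\<^sup>2 * (2 * real n + 2 - b * B * t powr (- B - 1))\<^sup>2)"
        using wt by (intro divide_nonneg_nonneg add_nonneg_nonneg mult_nonneg_nonneg) auto
      then show "ennreal (kernel_term t n) \<le> ennreal D * ennreal (width t / (1 + (width t)\<^sup>2 * (2 * real n + 2 - b * B * t powr (- B - 1))\<^sup>2))"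
        using ennreal_leI[OF le[of n]] D by (simp only: ennreal_mult)
    qed auto
    also have "\<dots> = ennreal D * (\<Sum>n. ennreal (width t / (1 + (width t)\<^sup>2 * (2 * real n + 2 - b * B * t powr (- B - 1))\<^sup>2)))"
      by (rule ennreal_suminf_cmult)
    also have "\<dots> \<le> ennreal D * ennreal (9 * pi / 2)"
      using wt by (intro mult_left_mono suminf_lorentzian_le) auto
    also have "\<dots> = ennreal (exp 2 / K * C * (9 * pi / 2) * exp (b * t powr (- B)))"
      using D by (simp add: D_def mult_ac flip: ennreal_mult)
    finally show "(\<Sum>n. ennreal (kernel_term t n)) \<le> ennreal (exp 2 / K * C * (9 * pi / 2) * exp (b * t powr (- B)))" .
  qed
qed

text \<open>Integrating \<open>(r\<^sup>2 - a) (r ^ (2 n) - a ^ n) \<ge> 0\<close> with \<open>a = moment 1 / moment 0\<close>.\<close>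

lemma moment_Suc_ge:
  obtains a where "0 < a" "\<And>n. a * moment n \<le> moment (Suc n)"
proof
  define a where "a = moment 1 / moment 0"
  show a: "0 < moment 1 / moment 0" using moment_pos by simp
  fix n
  have int: "integrable disc_area (\<lambda>z. cmod z ^ k * \<omega> (cmod z))" for k
    by (rule integrable_moment)
  have "0 \<le> (LINT z|disc_area. ((cmod z)\<^sup>2 - a) * ((cmod z)\<^sup>2 ^ n - a ^ n) * \<omega> (cmod z))"
  proof (rule Bochner_Integration.integral_nonneg, rule mult_nonneg_nonneg)
    fix z assume z: "z \<in> space disc_area"
    show "0 \<le> \<omega> (cmod z)" using weight_nonneg[of z] z by simp
    show "0 \<le> ((cmod z)\<^sup>2 - a) * ((cmod z)\<^sup>2 ^ n - a ^ n)"
    proof (cases "a \<le> (cmod z)\<^sup>2")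
      case True
      then show ?thesis using power_mono[of a "(cmod z)\<^sup>2" n] a by (simp add: a_def)
    next
      case False
      then show ?thesis using power_mono[of "(cmod z)\<^sup>2" a n] by (intro mult_nonpos_nonpos) auto
    qed
  qed
  also have "\<dots> = (LINT z|disc_area. cmod z ^ (2 * Suc n) * \<omega> (cmod z) - a * (cmod z ^ (2 * n) * \<omega> (cmod z))
      - a ^ n * (cmod z ^ (2 * 1) * \<omega> (cmod z)) + a ^ Suc n * (cmod z ^ (2 * 0) * \<omega> (cmod z)))"
    unfolding power_mult by (intro Bochner_Integration.integral_cong) (simp_all add: algebra_simps)
  also have "\<dots> = moment (Suc n) - a * moment n - a ^ n * moment 1 + a ^ Suc n * moment 0"
    unfolding moment_def by (simp only: int Bochner_Integration.integral_diff Bochner_Integration.integral_add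
       Bochner_Integration.integrable_diff Bochner_Integration.integrable_add integrable_mult_right integral_mult_right_zero)
  also have "\<dots> = moment (Suc n) - a * moment n"
    using moment_pos[of 0] by (simp add: a_def)
  finally show "moment 1 / moment 0 * moment n \<le> moment (Suc n)"
    by (simp add: a_def)
qed

end

section \<open>Integral estimate for the kernel\<close>

lemma ennreal_le_of_power2_le:
  assumes "x\<^sup>2 \<le> ennreal (y\<^sup>2)" "0 \<le> y"
  shows "x \<le> ennreal y"
proof (cases x)
  case (real r)
  then have "r\<^sup>2 \<le> y\<^sup>2" using assms by (simp add: ennreal_power)
  then have "r \<le> y" by (rule power2_le_imp_le) (rule assms)
  then show ?thesis using real by (simp add: ennreal_leI)
next
  case top
  then show ?thesis using assms by (simp add: power2_eq_square top_unique)
qed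

text \<open>Angular decay: \<open>\<bar>1 - \<rho> u\<bar> \<le> C (\<tau> + \<bar>z - s\<bar>)\<close> for \<open>u = z / \<bar>z\<bar>\<close>, \<open>\<rho> = 1 - \<tau>\<close>, and the square of the
  geometric series in \<open>\<rho> u\<close> is integrated by orthogonality.\<close>

lemma nn_integral_angular_le:
  assumes \<tau>: "0 < \<tau>" "\<tau> \<le> 1" and [measurable]: "G \<in> borel_measurable borel" and G: "\<And>r. 0 \<le> G r"
  shows "(\<integral>\<^sup>+z. ennreal (G (cmod z) / (cmod (1 - of_real (1 - \<tau>) * (z / of_real (cmod z))))\<^sup>2) \<partial>disc_area) \<le>
    ennreal (1 / \<tau>) * (\<integral>\<^sup>+z. ennreal (G (cmod z)) \<partial>disc_area)"
proof -
  define \<rho> where "\<rho> = 1 - \<tau>"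
  have \<rho>: "0 \<le> \<rho>" "\<rho> < 1" using \<tau> by (auto simp: \<rho>_def)
  define q where "q z = of_real \<rho> * (z / of_real (cmod z))" for z :: complex
  have [measurable]: "q \<in> borel_measurable disc_area"
    unfolding q_def by measurable
  have norm_q: "cmod (q z) \<le> \<rho>" for z
    using \<rho> by (cases "z = 0") (auto simp: q_def norm_mult norm_divide)
  define b where "b n z = q z ^ n * of_real (sqrt (G (cmod z)))" for n z
  have "(\<integral>\<^sup>+z. ennreal ((cmod (1 / (1 - q z) * of_real (sqrt (G (cmod z)))))\<^sup>2) \<partial>disc_area) \<le>
      (\<Sum>n. \<integral>\<^sup>+z. ennreal ((cmod (b n z))\<^sup>2) \<partial>disc_area)"
  proof (rule nn_integral_homogeneous_series_le)
    show "b n \<in> borel_measurable disc_area" for n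
      unfolding b_def by measurable
    show "b n (c * z) = c ^ n * b n z" if "cmod c = 1" for n c z
      using that by (simp add: b_def q_def norm_mult power_mult_distrib power_divide)
    show "(\<lambda>n. b n z) sums (1 / (1 - q z) * of_real (sqrt (G (cmod z))))" for z
      unfolding b_def using norm_q[of z] \<rho> by (intro sums_mult2 geometric_sums) auto
  qed
  also have "(\<lambda>z. (cmod (1 / (1 - q z) * of_real (sqrt (G (cmod z)))))\<^sup>2) = (\<lambda>z. G (cmod z) / (cmod (1 - of_real (1 - \<tau>) * (z / of_real (cmod z))))\<^sup>2)"
    using G by (simp add: norm_mult norm_divide power_mult_distrib power_divide q_def \<rho>_def)
  also have "(\<Sum>n. \<integral>\<^sup>+z. ennreal ((cmod (b n z))\<^sup>2) \<partial>disc_area) \<le> (\<Sum>n. ennreal ((\<rho>\<^sup>2) ^ n) * (\<integral>\<^sup>+z. ennreal (G (cmod z)) \<partial>disc_area))"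
  proof (intro suminf_le allI)
    fix n
    have "(\<integral>\<^sup>+z. ennreal ((cmod (b n z))\<^sup>2) \<partial>disc_area) \<le> (\<integral>\<^sup>+z. ennreal ((\<rho>\<^sup>2) ^ n) * ennreal (G (cmod z)) \<partial>disc_area)"
    proof (rule nn_integral_mono)
      fix z :: complex
      have "(cmod (b n z))\<^sup>2 = (cmod (q z) ^ n)\<^sup>2 * G (cmod z)"
        using G by (simp add: b_def norm_mult norm_power power_mult_distrib)
      also have "\<dots> \<le> (\<rho> ^ n)\<^sup>2 * G (cmod z)"
        using G norm_q by (intro mult_right_mono power_mono) auto
      also have "(\<rho> ^ n)\<^sup>2 = (\<rho>\<^sup>2) ^ n"
        by (simp add: mult.commute flip: power_mult)
      finally have "ennreal ((cmod (b n z))\<^sup>2) \<le> ennreal ((\<rho>\<^sup>2) ^ n * G (cmod z))"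
        by (rule ennreal_leI)
      then show "ennreal ((cmod (b n z))\<^sup>2) \<le> ennreal ((\<rho>\<^sup>2) ^ n) * ennreal (G (cmod z))"
        using G by (simp add: ennreal_mult)
    qed
    then show "(\<integral>\<^sup>+z. ennreal ((cmod (b n z))\<^sup>2) \<partial>disc_area) \<le> ennreal ((\<rho>\<^sup>2) ^ n) * (\<integral>\<^sup>+z. ennreal (G (cmod z)) \<partial>disc_area)"
      by (subst (asm) nn_integral_cmult) (auto intro: borel_measurable_disc_area)
  qed auto
  also have "\<dots> = (\<Sum>n. ennreal ((\<rho>\<^sup>2) ^ n)) * (\<integral>\<^sup>+z. ennreal (G (cmod z)) \<partial>disc_area)"
    by (rule ennreal_suminf_multc)
  also have "(\<Sum>n. ennreal ((\<rho>\<^sup>2) ^ n)) = ennreal (1 / (1 - \<rho>\<^sup>2))"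
  proof (rule suminf_ennreal_eq)
    have "\<rho>\<^sup>2 < 1" using \<rho> by (simp add: power_less_one_iff abs_square_less_1)
    then show "(\<lambda>n. (\<rho>\<^sup>2) ^ n) sums (1 / (1 - \<rho>\<^sup>2))"
      by (intro geometric_sums) auto
  qed simp
  also have "ennreal (1 / (1 - \<rho>\<^sup>2)) \<le> ennreal (1 / \<tau>)"
  proof (rule ennreal_leI)
    have "\<rho>\<^sup>2 \<le> \<rho>" using \<rho> by (simp add: power2_eq_square mult_left_le)
    then have "\<tau> \<le> 1 - \<rho>\<^sup>2" by (simp add: \<rho>_def)
    then show "1 / (1 - \<rho>\<^sup>2) \<le> 1 / \<tau>" using \<tau> by (intro divide_left_mono) auto
  qed
  finally show ?thesis
    by (simp add: mult_right_mono)
qed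

text \<open>The weight for the Cauchy-Schwarz inequality: near the point \<open>s\<close> its inverse is an approximate identity
  at scale \<open>\<tau>\<close> both radially and in angle.\<close>

definition peak :: "real \<Rightarrow> real \<Rightarrow> complex \<Rightarrow> real" where
  "peak \<tau> s z = (\<tau>\<^sup>2 + (cmod (z - of_real s))\<^sup>2) * (\<tau>\<^sup>2 + (cmod z - s)\<^sup>2) / \<tau>\<^sup>2"

lemma peak_pos: "0 < \<tau> \<Longrightarrow> 0 < peak \<tau> s z"
  by (simp add: peak_def add_pos_nonneg)

lemma borel_measurable_peak [measurable]: "peak \<tau> s \<in> borel_measurable disc_area"
  unfolding peak_def by measurable

text \<open>For large v the difference of the exponentials stays bounded while v - t does not. The
  factor exp (- 2 v), which the area density provides, compensates for this.\<close>

lemma exp_minus_diff_ge: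
  assumes "0 \<le> v" "0 \<le> t" "t \<le> 1"
  shows "exp (- 2 * v) * (v - t)\<^sup>2 \<le> exp 2 * (exp (- v) - exp (- t :: real))\<^sup>2"
proof -
  have ineq: "1 + x \<le> exp x" for x :: real by (rule exp_ge_add_one_self)
  have "exp (- v) * \<bar>v - t\<bar> \<le> exp 1 * \<bar>exp (- v) - exp (- t)\<bar>"
  proof (cases "t \<le> v")
    case True
    have "exp (- v) * (v - t) \<le> exp (- v) * (exp (v - t) - 1)"
    proof (rule mult_left_mono)
      show "v - t \<le> exp (v - t) - 1"
        using ineq[of "v - t"] by (simp only: le_diff_eq add.commute)
    qed simp
    also have "\<dots> = exp (- t) - exp (- v)"
      by (simp add: right_diff_distrib flip: exp_add)
    also have "\<dots> \<le> exp 1 * (exp (- t) - exp (- v))"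
      using True mult_right_mono[of 1 "exp 1" "exp (- t) - exp (- v)"] by simp
    finally show ?thesis using True by simp
  next
    case False
    have "exp (- v) * (t - v) \<le> 1 * (t - v)"
      using assms False by (intro mult_right_mono) auto
    also have "\<dots> \<le> exp (t - v) - 1"
      using ineq[of "t - v"] by (simp only: mult_1 le_diff_eq add.commute)
    also have "\<dots> \<le> exp (1 - t) * (exp (t - v) - 1)"
      using assms False mult_right_mono[of 1 "exp (1 - t)" "exp (t - v) - 1"] by simp
    also have "\<dots> = exp 1 * (exp (- v) - exp (- t))"
      by (simp add: right_diff_distrib flip: exp_add)
    finally show ?thesis using False by simp
  qed
  then have "(exp (- v) * \<bar>v - t\<bar>)\<^sup>2 \<le> (exp 1 * \<bar>exp (- v) - exp (- t)\<bar>)\<^sup>2"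
    by (intro power_mono) auto
  moreover have "(exp (- v))\<^sup>2 = exp (- 2 * v)" "(exp 1)\<^sup>2 = exp (2::real)"
    by (simp_all flip: exp_double)
  ultimately show ?thesis
    by (simp add: power_mult_distrib)
qed

text \<open>The distance |z - s| dominates the angular distance of z from the positive axis. This
  leaves a radial Lorentzian, with integral of order \<tau>, times an angular factor that
  contributes 1 / \<tau>.\<close>

lemma nn_integral_inverse_peak_le:
  obtains K where "0 < K" "\<And>t \<tau>. 0 < t \<Longrightarrow> t \<le> 1 \<Longrightarrow> 0 < \<tau> \<Longrightarrow> \<tau> \<le> 1 \<Longrightarrow>
    (\<integral>\<^sup>+z. ennreal (1 / peak \<tau> (exp (- t)) z) \<partial>disc_area) \<le> ennreal K"
proof
  \<comment> \<open>The first factor comes from comparing angular distance with |z - s|, the second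
    from the radial integral.\<close>
  show "0 < (2 + 8 * exp 2) * (2 * exp 2 * pi)" by (simp add: add_pos_pos)
  fix t \<tau> :: real assume t: "0 < t" "t \<le> 1" and \<tau>: "0 < \<tau>" "\<tau> \<le> 1"
  define s where "s = exp (- t)"
  have s: "0 < s" "1 \<le> exp 2 * s\<^sup>2"
    using t by (auto simp: s_def power2_eq_square simp flip: exp_add)
  define G where "G r = \<tau>\<^sup>2 / (\<tau>\<^sup>2 + (r - s)\<^sup>2)" for r
  have G: "0 \<le> G r" for r by (simp add: G_def)
  have [measurable]: "G \<in> borel_measurable borel" unfolding G_def by measurable
  define A where "A z = cmod (1 - of_real (1 - \<tau>) * (z / of_real (cmod z)))" for z :: complex
  have pos: "0 < \<tau>\<^sup>2 + x\<^sup>2" for x using \<tau> by (simp add: add_pos_nonneg)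
  have "(\<integral>\<^sup>+z. ennreal (1 / peak \<tau> s z) \<partial>disc_area) \<le>
      (\<integral>\<^sup>+z. ennreal (2 + 8 * exp 2) * ennreal (G (cmod z) / (A z)\<^sup>2) \<partial>disc_area)"
  proof (rule nn_integral_mono_AE, rule AE_disc_areaI)
    fix z :: complex assume "z \<noteq> 0"
    define u where "u = z / of_real (cmod z)"
    have u: "cmod u = 1" using \<open>z \<noteq> 0\<close> by (simp add: u_def norm_divide)
    \<comment> \<open>The detour runs through s u, the point of modulus s on the ray of z; its
      distance to z is at most |z - s|.\<close>
    have "s * cmod (1 - u) = cmod (of_real s * (1 - u))"
      using s by (simp add: norm_mult)
    also have "of_real s * (1 - u) = (of_real s - z) + (z - of_real s * u)"
      by (simp add: algebra_simps)
    also have "cmod ((of_real s - z) + (z - of_real s * u)) \<le> cmod (of_real s - z) + cmod (z - of_real s * u)"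
      by (rule norm_triangle_ineq)
    also have "z - of_real s * u = of_real (cmod z - s) * u"
      using \<open>z \<noteq> 0\<close> by (simp add: u_def algebra_simps)
    also have "cmod (of_real (cmod z - s) * u) = \<bar>cmod z - s\<bar>"
      using u by (simp add: norm_mult del: of_real_diff)
    also have "\<bar>cmod z - s\<bar> \<le> cmod (z - of_real s)"
      using norm_triangle_ineq3[of z "of_real s"] s by simp
    finally have "s * cmod (1 - u) \<le> 2 * cmod (z - of_real s)"
      by (simp add: norm_minus_commute)
    then have "(s * cmod (1 - u))\<^sup>2 \<le> (2 * cmod (z - of_real s))\<^sup>2"
      using s by (intro power_mono) auto
    then have "s\<^sup>2 * (cmod (1 - u))\<^sup>2 \<le> 4 * (cmod (z - of_real s))\<^sup>2"
      by (simp add: power_mult_distrib)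
    then have "exp 2 * (s\<^sup>2 * (cmod (1 - u))\<^sup>2) \<le> exp 2 * (4 * (cmod (z - of_real s))\<^sup>2)"
      by (intro mult_left_mono) auto
    moreover have "(cmod (1 - u))\<^sup>2 \<le> exp 2 * (s\<^sup>2 * (cmod (1 - u))\<^sup>2)"
      using mult_right_mono[OF s(2), of "(cmod (1 - u))\<^sup>2"] by (simp add: mult.assoc)
    ultimately have "(cmod (1 - u))\<^sup>2 \<le> exp 2 * (4 * (cmod (z - of_real s))\<^sup>2)"
      by (rule order.trans[rotated])
    then have 1: "(cmod (1 - u))\<^sup>2 \<le> 4 * exp 2 * (cmod (z - of_real s))\<^sup>2"
      by (simp add: mult_ac)
    have "A z = cmod (1 - of_real (1 - \<tau>) * u)"
      by (simp only: A_def u_def)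
    also have "1 - of_real (1 - \<tau>) * u = (1 - u) + of_real \<tau> * u"
      by (simp add: algebra_simps)
    also have "cmod ((1 - u) + of_real \<tau> * u) \<le> cmod (1 - u) + \<tau>"
      using norm_triangle_ineq[of "1 - u" "of_real \<tau> * u"] u \<tau> by (simp add: norm_mult)
    finally have "(A z)\<^sup>2 \<le> (cmod (1 - u) + \<tau>)\<^sup>2"
      by (intro power_mono) (auto simp: A_def)
    also have "\<dots> \<le> 2 * (cmod (1 - u))\<^sup>2 + 2 * \<tau>\<^sup>2"
      using zero_le_power2[of "cmod (1 - u) - \<tau>"] by (simp add: power2_eq_square algebra_simps)
    also have "\<dots> \<le> 8 * exp 2 * (cmod (z - of_real s))\<^sup>2 + 2 * \<tau>\<^sup>2"
      using 1 by simp
    also have "\<dots> \<le> (2 + 8 * exp 2) * (\<tau>\<^sup>2 + (cmod (z - of_real s))\<^sup>2)"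
      by (simp add: algebra_simps)
    finally have 2: "(A z)\<^sup>2 \<le> (2 + 8 * exp 2) * (\<tau>\<^sup>2 + (cmod (z - of_real s))\<^sup>2)" .
    have Apos: "0 < (A z)\<^sup>2"
    proof -
      have "cmod (of_real (1 - \<tau>) * u) < 1" using u \<tau> by (simp add: norm_mult del: of_real_diff)
      then have "of_real (1 - \<tau>) * u \<noteq> 1" by auto
      then show ?thesis by (simp add: A_def u_def)
    qed
    have "1 / peak \<tau> s z = G (cmod z) / (\<tau>\<^sup>2 + (cmod (z - of_real s))\<^sup>2)"
      by (simp add: peak_def G_def)
    also have "\<dots> \<le> G (cmod z) * ((2 + 8 * exp 2) / (A z)\<^sup>2)"
    proof -
      have "1 / (\<tau>\<^sup>2 + (cmod (z - of_real s))\<^sup>2) \<le> (2 + 8 * exp 2) / (A z)\<^sup>2"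
        using 2 Apos pos[of "cmod (z - of_real s)"] by (simp add: divide_le_eq le_divide_eq mult_ac)
      from mult_left_mono[OF this G[of "cmod z"]] show ?thesis by simp
    qed
    finally have "ennreal (1 / peak \<tau> s z) \<le> ennreal ((2 + 8 * exp 2) * (G (cmod z) / (A z)\<^sup>2))"
      by (intro ennreal_leI) (simp add: mult_ac)
    then show "ennreal (1 / peak \<tau> s z) \<le> ennreal (2 + 8 * exp 2) * ennreal (G (cmod z) / (A z)\<^sup>2)"
      using G by (subst ennreal_mult[symmetric]) (auto intro: add_nonneg_nonneg)
  qed
  also have "\<dots> = ennreal (2 + 8 * exp 2) * (\<integral>\<^sup>+z. ennreal (G (cmod z) / (A z)\<^sup>2) \<partial>disc_area)"
    unfolding A_def by (rule nn_integral_cmult) measurable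
  also have "\<dots> \<le> ennreal (2 + 8 * exp 2) * (ennreal (1 / \<tau>) * (\<integral>\<^sup>+z. ennreal (G (cmod z)) \<partial>disc_area))"
    unfolding A_def using \<tau> G by (intro mult_left_mono nn_integral_angular_le) auto
  also have "(\<integral>\<^sup>+z. ennreal (G (cmod z)) \<partial>disc_area) \<le> ennreal (2 * exp 2) * ennreal (\<tau> * pi)"
  proof -
    have "(\<integral>\<^sup>+z. ennreal (G (cmod z)) \<partial>disc_area) = (\<integral>\<^sup>+v\<in>{0<..}. ennreal (G (exp (- v))) * ennreal (2 * exp (- 2 * v)) \<partial>lborel)"
      by (rule nn_integral_disc_area_radial) measurable
    also have "\<dots> \<le> (\<integral>\<^sup>+v. ennreal (2 * exp 2) * ennreal (1 / (1 + ((v - t) / \<tau>)\<^sup>2)) \<partial>lborel)"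
    proof (rule nn_integral_mono)
      fix v :: real
      show "ennreal (G (exp (- v))) * ennreal (2 * exp (- 2 * v)) * indicator {0<..} v \<le> ennreal (2 * exp 2) * ennreal (1 / (1 + ((v - t) / \<tau>)\<^sup>2))"
      proof (cases "0 < v")
        case True
        have "exp (- 2 * v) * \<tau>\<^sup>2 \<le> exp 2 * \<tau>\<^sup>2"
          using True by (intro mult_right_mono) auto
        then have "exp (- 2 * v) * (\<tau>\<^sup>2 + (v - t)\<^sup>2) \<le> exp 2 * (\<tau>\<^sup>2 + (exp (- v) - s)\<^sup>2)"
          using exp_minus_diff_ge[of v t] True t by (simp add: distrib_left s_def)
        then have "exp (- 2 * v) / (\<tau>\<^sup>2 + (exp (- v) - s)\<^sup>2) \<le> exp 2 / (\<tau>\<^sup>2 + (v - t)\<^sup>2)"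
          using pos[of "v - t"] pos[of "exp (- v) - s"] by (simp add: divide_le_eq le_divide_eq mult_ac)
        from mult_left_mono[OF this, of "2 * \<tau>\<^sup>2"]
        have "G (exp (- v)) * (2 * exp (- 2 * v)) \<le> 2 * exp 2 * (\<tau>\<^sup>2 / (\<tau>\<^sup>2 + (v - t)\<^sup>2))"
          by (simp add: G_def mult_ac)
        also have "\<tau>\<^sup>2 / (\<tau>\<^sup>2 + (v - t)\<^sup>2) = 1 / (1 + ((v - t) / \<tau>)\<^sup>2)"
          using \<tau> pos[of "v - t"] by (simp add: power_divide divide_simps)
        finally have "ennreal (G (exp (- v)) * (2 * exp (- 2 * v))) \<le> ennreal (2 * exp 2 * (1 / (1 + ((v - t) / \<tau>)\<^sup>2)))"
          by (rule ennreal_leI)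
        then show ?thesis
          using True G by (simp only: indicator_simps greaterThan_iff mult_1_right ennreal_mult[symmetric] divide_nonneg_nonneg
              exp_ge_zero mult_nonneg_nonneg zero_le_numeral add_nonneg_nonneg zero_le_one zero_le_power2)
      qed simp
    qed
    also have "\<dots> = ennreal (2 * exp 2) * ennreal (\<tau> * pi)"
      using \<tau> by (subst nn_integral_cmult) (auto simp: nn_integral_lorentzian)
    finally show ?thesis .
  qed
  finally have "(\<integral>\<^sup>+z. ennreal (1 / peak \<tau> s z) \<partial>disc_area) \<le>
      ennreal (2 + 8 * exp 2) * (ennreal (1 / \<tau>) * (ennreal (2 * exp 2) * ennreal (\<tau> * pi)))"
    by (simp add: mult_left_mono)
  also have "\<dots> = ennreal ((2 + 8 * exp 2) * (1 / \<tau> * (2 * exp 2 * (\<tau> * pi))))"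
    using \<tau> by (simp only: ennreal_mult[symmetric] mult_nonneg_nonneg divide_nonneg_nonneg exp_ge_zero zero_le_numeral
        add_nonneg_nonneg zero_le_one less_imp_le pi_ge_zero)
  also have "(2 + 8 * exp 2) * (1 / \<tau> * (2 * exp 2 * (\<tau> * pi))) = (2 + 8 * exp 2) * (2 * exp 2 * pi)"
    using \<tau> by simp
  finally show "(\<integral>\<^sup>+z. ennreal (1 / peak \<tau> (exp (- t)) z) \<partial>disc_area) \<le> ennreal ((2 + 8 * exp 2) * (2 * exp 2 * pi))"
    by (simp only: s_def)
qed

section \<open>Taylor coefficients of the kernel in weighted norms\<close>

context exponential_weight
begin

text \<open>Multiplication by the square root of a radial weight keeps every term homogeneous under
  rotations, so Bessel's inequality applies.\<close>

lemma nn_integral_power_series_le: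
  fixes a :: "nat \<Rightarrow> real"
  assumes F: "\<And>z. z \<in> unit_disc \<Longrightarrow> (\<lambda>n. of_real (a n) * z ^ n) sums F z"
  shows "(\<integral>\<^sup>+z. ennreal ((cmod (F z))\<^sup>2 * (\<omega> (cmod z) * (\<tau>\<^sup>2 + (cmod z - s)\<^sup>2))) \<partial>disc_area) \<le>
    (\<Sum>n. ennreal ((a n)\<^sup>2 * (\<tau>\<^sup>2 * moment n + variance n s)))"
proof -
  define g where "g r = \<omega> r * (\<tau>\<^sup>2 + (r - s)\<^sup>2)" for r
  have g: "0 \<le> g (cmod z)" if "z \<in> unit_disc" for z
    using weight_nonneg[OF that] by (simp add: g_def)
  have [measurable]: "(\<lambda>z. g (cmod z)) \<in> borel_measurable disc_area"
    unfolding g_def by measurable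
  define b where "b n z = of_real (a n) * z ^ n * of_real (sqrt (g (cmod z)))" for n z
  have "(\<integral>\<^sup>+z. ennreal ((cmod (F z))\<^sup>2 * g (cmod z)) \<partial>disc_area) =
      (\<integral>\<^sup>+z. ennreal ((cmod (F z * of_real (sqrt (g (cmod z)))))\<^sup>2) \<partial>disc_area)"
    using g by (intro nn_integral_cong) (simp add: norm_mult power_mult_distrib)
  also have "\<dots> \<le> (\<Sum>n. \<integral>\<^sup>+z. ennreal ((cmod (b n z))\<^sup>2) \<partial>disc_area)"
  proof (rule nn_integral_homogeneous_series_le)
    show "b n \<in> borel_measurable disc_area" for n
      unfolding b_def by measurable
    show "b n (c * z) = c ^ n * b n z" if "cmod c = 1" for n c z
      using that by (simp add: b_def norm_mult power_mult_distrib)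
    show "(\<lambda>n. b n z) sums (F z * of_real (sqrt (g (cmod z))))" if "z \<in> unit_disc" for z
      unfolding b_def by (intro sums_mult2 F that)
  qed
  also have "\<dots> = (\<Sum>n. ennreal ((a n)\<^sup>2 * (\<tau>\<^sup>2 * moment n + variance n s)))"
  proof (intro suminf_cong)
    fix n
    have "(\<integral>\<^sup>+z. ennreal ((cmod (b n z))\<^sup>2) \<partial>disc_area) =
        (\<integral>\<^sup>+z. ennreal ((a n)\<^sup>2 * (\<tau>\<^sup>2 * (cmod z ^ (2 * n) * \<omega> (cmod z)) + (cmod z - s)\<^sup>2 * (cmod z ^ (2 * n) * \<omega> (cmod z)))) \<partial>disc_area)"
    proof (rule nn_integral_cong)
      fix z assume z: "z \<in> space disc_area"
      have "(cmod z ^ n)\<^sup>2 = cmod z ^ (2 * n)" by (simp add: mult.commute flip: power_mult)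
      then have "(cmod (b n z))\<^sup>2 = (a n)\<^sup>2 * (cmod z ^ (2 * n) * g (cmod z))"
        using g[of z] z by (simp add: b_def norm_mult norm_power power_mult_distrib)
      also have "\<dots> = (a n)\<^sup>2 * (\<tau>\<^sup>2 * (cmod z ^ (2 * n) * \<omega> (cmod z)) + (cmod z - s)\<^sup>2 * (cmod z ^ (2 * n) * \<omega> (cmod z)))"
        by (simp add: g_def algebra_simps)
      finally show "ennreal ((cmod (b n z))\<^sup>2) = ennreal ((a n)\<^sup>2 * (\<tau>\<^sup>2 * (cmod z ^ (2 * n) * \<omega> (cmod z)) + (cmod z - s)\<^sup>2 * (cmod z ^ (2 * n) * \<omega> (cmod z))))"
        by (simp only:)
    qed
    also have "\<dots> = ennreal (LINT z|disc_area. (a n)\<^sup>2 * (\<tau>\<^sup>2 * (cmod z ^ (2 * n) * \<omega> (cmod z)) + (cmod z - s)\<^sup>2 * (cmod z ^ (2 * n) * \<omega> (cmod z))))"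
      using weight_nonneg
      by (intro nn_integral_eq_integral integrable_mult_right Bochner_Integration.integrable_add integrable_moment
          integrable_polynomial_moment AE_I2 continuous_intros) auto
    also have "(LINT z|disc_area. (a n)\<^sup>2 * (\<tau>\<^sup>2 * (cmod z ^ (2 * n) * \<omega> (cmod z)) + (cmod z - s)\<^sup>2 * (cmod z ^ (2 * n) * \<omega> (cmod z)))) =
        (a n)\<^sup>2 * (\<tau>\<^sup>2 * moment n + variance n s)"
    proof -
      have 1: "integrable disc_area (\<lambda>z. (cmod z - s)\<^sup>2 * (cmod z ^ (2 * n) * \<omega> (cmod z)))"
        by (intro integrable_polynomial_moment continuous_intros)
      have 2: "integrable disc_area (\<lambda>z. \<tau>\<^sup>2 * (cmod z ^ (2 * n) * \<omega> (cmod z)))"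
        by (intro integrable_mult_right integrable_moment)
      show ?thesis
        unfolding moment_def variance_def integral_mult_right_zero Bochner_Integration.integral_add[OF 2 1] ..
    qed
    finally show "(\<integral>\<^sup>+z. ennreal ((cmod (b n z))\<^sup>2) \<partial>disc_area) = ennreal ((a n)\<^sup>2 * (\<tau>\<^sup>2 * moment n + variance n s))" .
  qed
  finally show ?thesis by (simp only: g_def)
qed

text \<open>The Taylor coefficients in z of (z - s) K(s z); at n = 0 there is no contribution from z
  K(s z).\<close>

definition shifted_coeff :: "real \<Rightarrow> nat \<Rightarrow> real" where
  "shifted_coeff s n = (if n = 0 then 0 else s ^ (n - 1) / moment (n - 1)) - s * (s ^ n / moment n)"

lemma kernel_real_sums:
  assumes "\<bar>s\<bar> \<le> 1" "z \<in> unit_disc"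
  shows "(\<lambda>n. of_real (s ^ n / moment n) * z ^ n) sums kernel (of_real s * z)"
proof -
  have "cmod (of_real s * z) < 1"
    using assms mult_left_le_one_le[of "cmod z" "\<bar>s\<bar>"] by (auto simp: norm_mult intro: le_less_trans)
  from kernel_sums[OF this] show ?thesis
    by (simp add: power_mult_distrib)
qed

lemma shifted_kernel_sums:
  assumes "\<bar>s\<bar> \<le> 1" "z \<in> unit_disc"
  shows "(\<lambda>n. of_real (shifted_coeff s n) * z ^ n) sums ((z - of_real s) * kernel (of_real s * z))"
proof -
  define d where "d n = (if n = 0 then 0 else complex_of_real (s ^ (n - 1) / moment (n - 1)) * z ^ n)" for n
  have "(\<lambda>n. d (Suc n)) sums (z * kernel (of_real s * z))"
    using sums_mult[OF kernel_real_sums[OF assms], of z] by (simp add: d_def mult_ac)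
  then have "d sums (z * kernel (of_real s * z))"
    using sums_Suc_iff[of d "z * kernel (of_real s * z)"] by (simp add: d_def)
  from sums_diff[OF this sums_mult[OF kernel_real_sums[OF assms], of "of_real s"]]
  have "(\<lambda>n. d n - of_real s * (of_real (s ^ n / moment n) * z ^ n)) sums ((z - of_real s) * kernel (of_real s * z))"
    by (simp add: algebra_simps)
  moreover have "(\<lambda>n. d n - of_real s * (of_real (s ^ n / moment n) * z ^ n)) = (\<lambda>n. of_real (shifted_coeff s n) * z ^ n)"
    by (auto simp: fun_eq_iff d_def shifted_coeff_def algebra_simps)
  ultimately show ?thesis by simp
qed

text \<open>Cauchy-Schwarz bounds the integral of r^2 - s^2 by the variance about s; the factor r +
  s \<le> 2 accounts for the 4.\<close>

lemma shifted_coeff_Suc_le: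
  assumes "0 < s" "s \<le> 1"
  shows "(shifted_coeff s (Suc n))\<^sup>2 \<le> 4 * s ^ (2 * n) * variance n s / (moment n * (moment (Suc n))\<^sup>2)"
proof -
  have int: "integrable disc_area (\<lambda>z. ((cmod z)\<^sup>2 - s\<^sup>2) * (cmod z ^ (2 * n) * \<omega> (cmod z)))"
     "integrable disc_area (\<lambda>z. ((cmod z)\<^sup>2 - s\<^sup>2)\<^sup>2 * (cmod z ^ (2 * n) * \<omega> (cmod z)))"
     "integrable disc_area (\<lambda>z. (cmod z - s)\<^sup>2 * (cmod z ^ (2 * n) * \<omega> (cmod z)))"
    by (intro integrable_polynomial_moment continuous_intros)+
  have "(LINT z|disc_area. ((cmod z)\<^sup>2 - s\<^sup>2) * (cmod z ^ (2 * n) * \<omega> (cmod z))) =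
      (LINT z|disc_area. cmod z ^ (2 * Suc n) * \<omega> (cmod z) - s\<^sup>2 * (cmod z ^ (2 * n) * \<omega> (cmod z)))"
    unfolding power_mult by (intro Bochner_Integration.integral_cong) (simp_all add: algebra_simps)
  also have "\<dots> = moment (Suc n) - s\<^sup>2 * moment n"
    unfolding moment_def by (simp only: integrable_moment Bochner_Integration.integral_diff integrable_mult_right integral_mult_right_zero)
  finally have diff: "(LINT z|disc_area. ((cmod z)\<^sup>2 - s\<^sup>2) * (cmod z ^ (2 * n) * \<omega> (cmod z))) = moment (Suc n) - s\<^sup>2 * moment n" .
  have "(LINT z|disc_area. ((cmod z)\<^sup>2 - s\<^sup>2) * (cmod z ^ (2 * n) * \<omega> (cmod z)))\<^sup>2 \<le>
      (LINT z|disc_area. cmod z ^ (2 * n) * \<omega> (cmod z)) * (LINT z|disc_area. ((cmod z)\<^sup>2 - s\<^sup>2)\<^sup>2 * (cmod z ^ (2 * n) * \<omega> (cmod z)))"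
    using weight_nonneg int moment_pos[of n] by (intro weighted_mean_square integrable_moment) (auto simp: moment_def)
  then have "(moment (Suc n) - s\<^sup>2 * moment n)\<^sup>2 \<le> moment n * (LINT z|disc_area. ((cmod z)\<^sup>2 - s\<^sup>2)\<^sup>2 * (cmod z ^ (2 * n) * \<omega> (cmod z)))"
    unfolding diff moment_def[symmetric] .
  also have "\<dots> \<le> moment n * (LINT z|disc_area. 4 * ((cmod z - s)\<^sup>2 * (cmod z ^ (2 * n) * \<omega> (cmod z))))"
  proof (intro mult_left_mono integral_mono int integrable_mult_right)
    fix z assume z: "z \<in> space disc_area"
    have "((cmod z)\<^sup>2 - s\<^sup>2)\<^sup>2 = (cmod z - s)\<^sup>2 * (cmod z + s)\<^sup>2"
      by (simp add: power2_eq_square algebra_simps)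
    also have "\<dots> \<le> (cmod z - s)\<^sup>2 * 2\<^sup>2"
      using z assms by (intro mult_left_mono power_mono) auto
    finally have "((cmod z)\<^sup>2 - s\<^sup>2)\<^sup>2 * (cmod z ^ (2 * n) * \<omega> (cmod z)) \<le> ((cmod z - s)\<^sup>2 * 2\<^sup>2) * (cmod z ^ (2 * n) * \<omega> (cmod z))"
      using weight_nonneg[of z] z by (intro mult_right_mono) auto
    then show "((cmod z)\<^sup>2 - s\<^sup>2)\<^sup>2 * (cmod z ^ (2 * n) * \<omega> (cmod z)) \<le> 4 * ((cmod z - s)\<^sup>2 * (cmod z ^ (2 * n) * \<omega> (cmod z)))"
      by simp
  qed (use moment_pos[of n] in simp)
  also have "\<dots> = 4 * moment n * variance n s"
    by (simp add: variance_def)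
  finally have le: "(moment (Suc n) - s\<^sup>2 * moment n)\<^sup>2 \<le> 4 * moment n * variance n s" .
  have "shifted_coeff s (Suc n) = s ^ n * (moment (Suc n) - s\<^sup>2 * moment n) / (moment n * moment (Suc n))"
    using moment_pos[of n] moment_pos[of "Suc n"] by (simp add: shifted_coeff_def field_simps power2_eq_square)
  then have "(shifted_coeff s (Suc n))\<^sup>2 = s ^ (2 * n) * (moment (Suc n) - s\<^sup>2 * moment n)\<^sup>2 / ((moment n)\<^sup>2 * (moment (Suc n))\<^sup>2)"
    by (simp add: power_divide power_mult_distrib mult.commute flip: power_mult)
  also have "\<dots> \<le> s ^ (2 * n) * (4 * moment n * variance n s) / ((moment n)\<^sup>2 * (moment (Suc n))\<^sup>2)"
    using assms le by (intro divide_right_mono mult_left_mono) auto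
  also have "\<dots> = 4 * s ^ (2 * n) * variance n s / (moment n * (moment (Suc n))\<^sup>2)"
    using moment_pos[of n] by (simp add: power2_eq_square field_simps)
  finally show ?thesis .
qed

lemma le_sum_square:
  fixes R \<tau> :: real
  assumes "0 < \<tau>"
  shows "R \<le> \<tau>\<^sup>2 + R\<^sup>2 / \<tau>\<^sup>2"
proof -
  have "2 * R \<le> \<tau>\<^sup>2 + R\<^sup>2 / \<tau>\<^sup>2"
    using zero_le_power2[of "\<tau> - R / \<tau>"] assms by (simp add: power2_diff power_divide)
  moreover have "0 \<le> \<tau>\<^sup>2 + R\<^sup>2 / \<tau>\<^sup>2" by simp
  ultimately show ?thesis by linarith
qed

text \<open>The coefficient of (z - s) K(s z) at 0 has no predecessor to cancel against. It is
  harmless because \<open>spread 0 t\<close> is bounded below by a fixed positive number, so the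
  majorant at 0 is already of order at least 1 / \<tau>^2. At n + 1 a product of two consecutive
  spreads appears and is split into squares, hence two majorants.\<close>

lemma coefficient_le_kernel_term:
  obtains K where "0 < K"
    "\<And>t n. 0 < t \<Longrightarrow> t \<le> 1 \<Longrightarrow>
      (exp (- t) ^ n / moment n)\<^sup>2 * ((width t)\<^sup>2 * moment n + variance n (exp (- t))) \<le> K * kernel_term t n"
    "\<And>t. 0 < t \<Longrightarrow> t \<le> 1 \<Longrightarrow>
      (shifted_coeff (exp (- t)) 0)\<^sup>2 * ((width t)\<^sup>2 * moment 0 + variance 0 (exp (- t))) / (width t)\<^sup>2 \<le> K * kernel_term t 0"
    "\<And>t n. 0 < t \<Longrightarrow> t \<le> 1 \<Longrightarrow>
      (shifted_coeff (exp (- t)) (Suc n))\<^sup>2 * ((width t)\<^sup>2 * moment (Suc n) + variance (Suc n) (exp (- t))) / (width t)\<^sup>2 \<le>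
      K * (kernel_term t n + kernel_term t (Suc n))"
proof -
  obtain V where V: "0 < V" "\<And>n t. 0 < t \<Longrightarrow> variance n (exp (- t)) \<le> V * (moment n * spread n t)"
    using variance_le_spread by blast
  obtain a where a: "0 < a" "\<And>n. a * moment n \<le> moment (Suc n)"
    using moment_Suc_ge by blast
  define \<sigma> where "\<sigma> = width (saddle_n 0)"
  have \<sigma>: "0 < \<sigma>" unfolding \<sigma>_def by (rule width_pos[OF saddle_n_pos])
  \<comment> \<open>\<open>K0\<close> is for the index 0. \<open>K1\<close> contains 1 / a for
    replacing the moment at n + 1 by the one at n, and \<open>K2\<close> contains exp 2 for
    replacing s^(2n) by s^(2n+2).\<close>
  define K0 K1 K2 where "K0 = 1 / \<sigma> ^ 4 + V / \<sigma>\<^sup>2" and "K1 = 4 * V * (1 + V) / a" and "K2 = 4 * V\<^sup>2 * exp 2"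
  have K: "0 < K0" "0 < K1" "0 < K2"
    using V a \<sigma> by (auto simp: K0_def K1_def K2_def add_pos_pos)
  show ?thesis
  proof (rule that[of "1 + V + K0 + K1 + K2"])
    show "0 < 1 + V + K0 + K1 + K2" using K V by simp
    fix t :: real assume t: "0 < t" "t \<le> 1"
    define \<tau> s where "\<tau> = width t" and "s = exp (- t)"
    have \<tau>: "0 < \<tau>" "\<tau> \<le> 1"
      using t width_pos B_pos by (auto simp: \<tau>_def width_def intro!: powr_le1)
    have s: "0 < s" "s \<le> 1" using t by (auto simp: s_def)
    have T_eq: "kernel_term t n = s ^ (2 * n) / moment n * (\<tau>\<^sup>2 + (spread n t)\<^sup>2 / \<tau>\<^sup>2)" for n
      by (simp add: kernel_term_def s_def \<tau>_def)
    have T: "0 \<le> kernel_term t n" for n by (rule kernel_term_nonneg)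
    have R: "0 \<le> spread n t" for n by (simp add: spread_def)
    have mono: "x * kernel_term t n \<le> (1 + V + K0 + K1 + K2) * kernel_term t n" if "x \<le> 1 + V + K0 + K1 + K2" for x n
      using that T by (intro mult_right_mono) auto
    have sum_le: "\<tau>\<^sup>2 * moment n + variance n s \<le> moment n * (\<tau>\<^sup>2 + V * spread n t)" for n
      using V(2)[OF t(1), of n] by (simp add: s_def algebra_simps)
    show "(exp (- t) ^ n / moment n)\<^sup>2 * ((width t)\<^sup>2 * moment n + variance n (exp (- t))) \<le> (1 + V + K0 + K1 + K2) * kernel_term t n" for n
    proof -
      have "(s ^ n / moment n)\<^sup>2 * (\<tau>\<^sup>2 * moment n + variance n s) \<le> (s ^ n / moment n)\<^sup>2 * (moment n * (\<tau>\<^sup>2 + V * spread n t))"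
        by (intro mult_left_mono sum_le) auto
      also have "\<dots> = s ^ (2 * n) / moment n * (\<tau>\<^sup>2 + V * spread n t)"
        using moment_pos[of n] by (simp add: power_divide mult.commute power2_eq_square[of "moment n"] flip: power_mult)
      also have "\<dots> \<le> s ^ (2 * n) / moment n * ((1 + V) * (\<tau>\<^sup>2 + (spread n t)\<^sup>2 / \<tau>\<^sup>2))"
      proof (rule mult_left_mono)
        define X where "X = \<tau>\<^sup>2 + (spread n t)\<^sup>2 / \<tau>\<^sup>2"
        have "V * spread n t \<le> V * X"
          unfolding X_def using le_sum_square[OF \<tau>(1)] V by (intro mult_left_mono) auto
        moreover have "\<tau>\<^sup>2 \<le> X" by (simp add: X_def)
        ultimately have "\<tau>\<^sup>2 + V * spread n t \<le> (1 + V) * X"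
          by (simp add: distrib_right)
        then show "\<tau>\<^sup>2 + V * spread n t \<le> (1 + V) * (\<tau>\<^sup>2 + (spread n t)\<^sup>2 / \<tau>\<^sup>2)"
          by (simp only: X_def)
      qed (use s moment_pos[of n] in simp)
      also have "\<dots> = (1 + V) * kernel_term t n" by (simp add: T_eq)
      also have "\<dots> \<le> (1 + V + K0 + K1 + K2) * kernel_term t n"
        using K by (intro mono) auto
      finally show ?thesis by (simp add: s_def \<tau>_def)
    qed
    have div_le: "(\<tau>\<^sup>2 * moment n + variance n s) / \<tau>\<^sup>2 \<le> moment n * (1 + V * spread n t / \<tau>\<^sup>2)" for n
      using divide_right_mono[OF sum_le, of "\<tau>\<^sup>2" n] \<tau> by (simp add: field_simps)
    show "(shifted_coeff (exp (- t)) 0)\<^sup>2 * ((width t)\<^sup>2 * moment 0 + variance 0 (exp (- t))) / (width t)\<^sup>2 \<le> (1 + V + K0 + K1 + K2) * kernel_term t 0"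
    proof -
      have Rge: "\<sigma>\<^sup>2 \<le> spread 0 t" by (simp add: spread_def \<sigma>_def)
      have 1: "1 + V * spread 0 t / \<tau>\<^sup>2 \<le> K0 * ((spread 0 t)\<^sup>2 / \<tau>\<^sup>2)"
      proof -
        have "\<sigma> ^ 4 \<le> (spread 0 t)\<^sup>2"
          using power_mono[OF Rge, of 2] by (simp flip: power_mult)
        moreover have "\<tau>\<^sup>2 \<le> 1" using \<tau> by (simp add: power_le_one)
        ultimately have "\<sigma> ^ 4 * \<tau>\<^sup>2 \<le> (spread 0 t)\<^sup>2 * 1"
          by (intro mult_mono) auto
        then have "1 \<le> 1 / \<sigma> ^ 4 * ((spread 0 t)\<^sup>2 / \<tau>\<^sup>2)"
          using \<sigma> \<tau> by (simp add: field_simps)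
        moreover have "V * spread 0 t / \<tau>\<^sup>2 \<le> V / \<sigma>\<^sup>2 * ((spread 0 t)\<^sup>2 / \<tau>\<^sup>2)"
        proof -
          have "\<sigma>\<^sup>2 * (V * spread 0 t) \<le> spread 0 t * (V * spread 0 t)"
            using Rge R[of 0] V by (intro mult_right_mono) auto
          then show ?thesis
            using \<sigma> \<tau> by (simp add: field_simps power2_eq_square[of "spread 0 t"])
        qed
        ultimately show ?thesis
          unfolding K0_def distrib_right by (rule add_mono)
      qed
      have "(shifted_coeff s 0)\<^sup>2 * (\<tau>\<^sup>2 * moment 0 + variance 0 s) / \<tau>\<^sup>2 = s\<^sup>2 * (1 / moment 0)\<^sup>2 * ((\<tau>\<^sup>2 * moment 0 + variance 0 s) / \<tau>\<^sup>2)"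
        by (simp add: shifted_coeff_def power_mult_distrib power_divide)
      also have "\<dots> \<le> 1 * (1 / moment 0)\<^sup>2 * (moment 0 * (1 + V * spread 0 t / \<tau>\<^sup>2))"
        using s variance_nonneg[of 0 s] moment_pos[of 0] by (intro mult_mono div_le) (auto simp: power_le_one)
      also have "\<dots> = 1 / moment 0 * (1 + V * spread 0 t / \<tau>\<^sup>2)"
        using moment_pos[of 0] by (simp add: power2_eq_square)
      also have "\<dots> \<le> 1 / moment 0 * (K0 * (\<tau>\<^sup>2 + (spread 0 t)\<^sup>2 / \<tau>\<^sup>2))"
      proof (rule mult_left_mono)
        have "K0 * ((spread 0 t)\<^sup>2 / \<tau>\<^sup>2) \<le> K0 * (\<tau>\<^sup>2 + (spread 0 t)\<^sup>2 / \<tau>\<^sup>2)"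
          using K by (intro mult_left_mono) auto
        then show "1 + V * spread 0 t / \<tau>\<^sup>2 \<le> K0 * (\<tau>\<^sup>2 + (spread 0 t)\<^sup>2 / \<tau>\<^sup>2)"
          using 1 by linarith
      qed (use moment_pos[of 0] in simp)
      also have "\<dots> = K0 * kernel_term t 0" by (simp add: T_eq)
      also have "\<dots> \<le> (1 + V + K0 + K1 + K2) * kernel_term t 0"
        using K V by (intro mono) auto
      finally show ?thesis by (simp add: s_def \<tau>_def)
    qed
    show "(shifted_coeff (exp (- t)) (Suc n))\<^sup>2 * ((width t)\<^sup>2 * moment (Suc n) + variance (Suc n) (exp (- t))) / (width t)\<^sup>2 \<le>
      (1 + V + K0 + K1 + K2) * (kernel_term t n + kernel_term t (Suc n))" for n
    proof -
      define m m' r r' where "m = moment n" and "m' = moment (Suc n)" and "r = spread n t" and "r' = spread (Suc n) t"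
      have m: "0 < m" "0 < m'" "a * m \<le> m'" using moment_pos a by (auto simp: m_def m'_def)
      have r: "0 \<le> r" "0 \<le> r'" using R by (auto simp: r_def r'_def)
      have "(shifted_coeff s (Suc n))\<^sup>2 * (\<tau>\<^sup>2 * m' + variance (Suc n) s) / \<tau>\<^sup>2 \<le>
          (4 * s ^ (2 * n) * variance n s / (m * m'\<^sup>2)) * (m' * (1 + V * r' / \<tau>\<^sup>2))"
        unfolding times_divide_eq_right[symmetric] m_def m'_def r'_def
        using shifted_coeff_Suc_le[OF s, of n] div_le[of "Suc n"] variance_nonneg moment_pos[of "Suc n"]
        by (intro mult_mono) (auto intro!: order.trans[OF zero_le_power2 shifted_coeff_Suc_le[OF s, of n]] add_nonneg_nonneg less_imp_le)
      also have "\<dots> \<le> (4 * s ^ (2 * n) * (V * (m * r)) / (m * m'\<^sup>2)) * (m' * (1 + V * r' / \<tau>\<^sup>2))"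
        using V(2)[OF t(1), of n] V r m s by (intro mult_right_mono divide_right_mono mult_left_mono) (auto simp: m_def r_def s_def)
      also have "\<dots> = 4 * V * (s ^ (2 * n) / m') * (r + V * (r * r') / \<tau>\<^sup>2)"
        using m \<tau> by (simp add: field_simps power2_eq_square)
      also have "\<dots> \<le> 4 * V * (s ^ (2 * n) / m') * ((1 + V) * (\<tau>\<^sup>2 + r\<^sup>2 / \<tau>\<^sup>2) + V * (\<tau>\<^sup>2 + r'\<^sup>2 / \<tau>\<^sup>2))"
      proof (rule mult_left_mono)
        have "r * r' \<le> r\<^sup>2 + r'\<^sup>2"
          using zero_le_power2[of "r - r'"] mult_nonneg_nonneg[OF r] unfolding power2_diff by linarith
        then have "V * (r * r') / \<tau>\<^sup>2 \<le> V * (r\<^sup>2 + r'\<^sup>2) / \<tau>\<^sup>2"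
          using V by (intro divide_right_mono mult_left_mono) auto
        moreover have "r \<le> \<tau>\<^sup>2 + r\<^sup>2 / \<tau>\<^sup>2" by (rule le_sum_square[OF \<tau>(1)])
        moreover have "0 \<le> V * \<tau>\<^sup>2" using V by simp
        ultimately show "r + V * (r * r') / \<tau>\<^sup>2 \<le> (1 + V) * (\<tau>\<^sup>2 + r\<^sup>2 / \<tau>\<^sup>2) + V * (\<tau>\<^sup>2 + r'\<^sup>2 / \<tau>\<^sup>2)"
          by (simp add: algebra_simps add_divide_distrib)
      qed (use V s m in simp)
      also have "\<dots> = 4 * V * (1 + V) * (s ^ (2 * n) / m' * (\<tau>\<^sup>2 + r\<^sup>2 / \<tau>\<^sup>2)) + 4 * V\<^sup>2 * (s ^ (2 * n) / m' * (\<tau>\<^sup>2 + r'\<^sup>2 / \<tau>\<^sup>2))"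
      proof -
        have "4 * V * S * ((1 + V) * X + V * Y) = 4 * V * (1 + V) * (S * X) + 4 * V\<^sup>2 * (S * Y)" for S X Y
          by (simp add: power2_eq_square algebra_simps)
        then show ?thesis .
      qed
      also have "\<dots> \<le> 4 * V * (1 + V) * (1 / a * kernel_term t n) + 4 * V\<^sup>2 * (exp 2 * kernel_term t (Suc n))"
      proof (intro add_mono mult_left_mono)
        have "s ^ (2 * n) / m' \<le> s ^ (2 * n) / (a * m)"
          using m a s by (intro divide_left_mono) auto
        then show "s ^ (2 * n) / m' * (\<tau>\<^sup>2 + r\<^sup>2 / \<tau>\<^sup>2) \<le> 1 / a * kernel_term t n"
          using mult_right_mono[of "s ^ (2 * n) / m'" "s ^ (2 * n) / (a * m)" "\<tau>\<^sup>2 + r\<^sup>2 / \<tau>\<^sup>2"]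
          by (simp add: T_eq m_def r_def)
        have "1 \<le> exp 2 * s\<^sup>2" using t by (auto simp: s_def power2_eq_square simp flip: exp_add)
        then have "s ^ (2 * n) * 1 \<le> s ^ (2 * n) * (exp 2 * s\<^sup>2)"
          using s by (intro mult_left_mono) auto
        then have "s ^ (2 * n) / m' \<le> exp 2 * (s ^ (2 * Suc n) / m')"
          using m divide_right_mono[of "s ^ (2 * n)" "s ^ (2 * n) * (exp 2 * s\<^sup>2)" m'] by (simp add: power2_eq_square mult_ac)
        then show "s ^ (2 * n) / m' * (\<tau>\<^sup>2 + r'\<^sup>2 / \<tau>\<^sup>2) \<le> exp 2 * kernel_term t (Suc n)"
          using mult_right_mono[of "s ^ (2 * n) / m'" "exp 2 * (s ^ (2 * Suc n) / m')" "\<tau>\<^sup>2 + r'\<^sup>2 / \<tau>\<^sup>2"]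
          unfolding T_eq m'_def r'_def by (simp add: mult.assoc)
      qed (use V in auto)
      also have "\<dots> = K1 * kernel_term t n + K2 * kernel_term t (Suc n)"
        by (simp add: K1_def K2_def)
      also have "\<dots> \<le> (1 + V + K0 + K1 + K2) * kernel_term t n + (1 + V + K0 + K1 + K2) * kernel_term t (Suc n)"
        using K V by (intro add_mono mono) auto
      finally show ?thesis by (simp add: s_def \<tau>_def m'_def distrib_left)
    qed
  qed
qed

end

lemma suminf_shift_le:
  fixes f :: "nat \<Rightarrow> ennreal"
  shows "(\<Sum>n. if n = 0 then 0 else f (n - 1)) \<le> (\<Sum>n. f n)"
proof (rule suminf_le_const)
  fix N
  show "(\<Sum>n<N. if n = 0 then 0 else f (n - 1)) \<le> (\<Sum>n. f n)"
  proof (cases N)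
    case (Suc M)
    have "(\<Sum>n<Suc M. if n = 0 then 0 else f (n - 1)) = (\<Sum>n<M. f n)"
      by (simp add: sum.lessThan_Suc_shift del: sum.lessThan_Suc)
    also have "\<dots> \<le> (\<Sum>n. f n)" by (intro sum_le_suminf) auto
    finally show ?thesis by (simp add: Suc)
  qed simp
qed simp

section \<open>From coefficients to the integral of the kernel\<close>

context exponential_weight
begin

text \<open>Expanding the first factor of \<open>peak\<close> separates K(s z) from (z - s) K(s z) /
  \<tau>, both in the norm with the radial weight \<omega> (\<tau>^2 + (|z| - s)^2), to which the
  coefficient bounds apply.\<close>

lemma nn_integral_kernel_peak_le:
  obtains K where "0 < K" "\<And>t. 0 < t \<Longrightarrow> t \<le> 1 \<Longrightarrow>
    (\<integral>\<^sup>+z. ennreal ((cmod (kernel (of_real (exp (- t)) * z)))\<^sup>2 * \<omega> (cmod z) * peak (width t) (exp (- t)) z) \<partial>disc_area) \<le>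
    ennreal (K * exp (b * t powr (- B)))"
proof -
  obtain K where K: "0 < K"
    "\<And>t n. 0 < t \<Longrightarrow> t \<le> 1 \<Longrightarrow>
      (exp (- t) ^ n / moment n)\<^sup>2 * ((width t)\<^sup>2 * moment n + variance n (exp (- t))) \<le> K * kernel_term t n"
    "\<And>t. 0 < t \<Longrightarrow> t \<le> 1 \<Longrightarrow>
      (shifted_coeff (exp (- t)) 0)\<^sup>2 * ((width t)\<^sup>2 * moment 0 + variance 0 (exp (- t))) / (width t)\<^sup>2 \<le> K * kernel_term t 0"
    "\<And>t n. 0 < t \<Longrightarrow> t \<le> 1 \<Longrightarrow>
      (shifted_coeff (exp (- t)) (Suc n))\<^sup>2 * ((width t)\<^sup>2 * moment (Suc n) + variance (Suc n) (exp (- t))) / (width t)\<^sup>2 \<le>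
      K * (kernel_term t n + kernel_term t (Suc n))"
    using coefficient_le_kernel_term by blast
  obtain L where L: "0 < L" "\<And>t. 0 < t \<Longrightarrow> t \<le> 1 \<Longrightarrow> (\<Sum>n. ennreal (kernel_term t n)) \<le> ennreal (L * exp (b * t powr (- B)))"
    using suminf_kernel_term_le by blast
  show ?thesis
  \<comment> \<open>One sum of the majorants comes from the kernel and two, one of them shifted,
    from its product with z - s.\<close>
  proof (rule that[of "3 * K * L"])
    show "0 < 3 * K * L" using K L by simp
    fix t :: real assume t: "0 < t" "t \<le> 1"
    define \<tau> s where "\<tau> = width t" and "s = exp (- t)"
    have \<tau>: "0 < \<tau>" using t width_pos by (auto simp: \<tau>_def)
    have s: "0 < s" "s \<le> 1" using t by (auto simp: s_def)
    define T where "T n = ennreal (kernel_term t n)" for n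
    define A where "A n = (s ^ n / moment n)\<^sup>2 * (\<tau>\<^sup>2 * moment n + variance n s)" for n
    define D where "D n = (shifted_coeff s n)\<^sup>2 * (\<tau>\<^sup>2 * moment n + variance n s)" for n
    define g where "g z = \<omega> (cmod z) * (\<tau>\<^sup>2 + (cmod z - s)\<^sup>2)" for z
    have g: "0 \<le> g z" if "z \<in> unit_disc" for z
      using weight_nonneg[OF that] by (simp add: g_def)
    have [measurable]: "g \<in> borel_measurable disc_area"
      unfolding g_def by measurable
    have [measurable]: "(\<lambda>z. kernel (of_real s * z)) \<in> borel_measurable disc_area"
    proof -
      have "cmod (of_real s) < 1" using t by (simp add: s_def)
      then show ?thesis by (rule borel_measurable_kernel_mult)
    qed
    have "(\<integral>\<^sup>+z. ennreal ((cmod (kernel (of_real s * z)))\<^sup>2 * \<omega> (cmod z) * peak \<tau> s z) \<partial>disc_area) =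
        (\<integral>\<^sup>+z. ennreal ((cmod (kernel (of_real s * z)))\<^sup>2 * g z) +
          ennreal (1 / \<tau>\<^sup>2) * ennreal ((cmod ((z - of_real s) * kernel (of_real s * z)))\<^sup>2 * g z) \<partial>disc_area)"
    proof (rule nn_integral_cong)
      fix z assume z: "z \<in> space disc_area"
      have "(cmod (kernel (of_real s * z)))\<^sup>2 * \<omega> (cmod z) * peak \<tau> s z =
          (cmod (kernel (of_real s * z)))\<^sup>2 * g z + 1 / \<tau>\<^sup>2 * ((cmod ((z - of_real s) * kernel (of_real s * z)))\<^sup>2 * g z)"
      proof -
        have "A * W * ((q + Q) * P / q) = A * (W * P) + 1 / q * ((Q * A) * (W * P))" if "0 < q" for A W q Q P :: real
          using that by (simp add: field_simps)
        then show ?thesis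
          using \<tau> by (simp only: peak_def g_def norm_mult power_mult_distrib zero_less_power)
      qed
      then show "ennreal ((cmod (kernel (of_real s * z)))\<^sup>2 * \<omega> (cmod z) * peak \<tau> s z) =
          ennreal ((cmod (kernel (of_real s * z)))\<^sup>2 * g z) + ennreal (1 / \<tau>\<^sup>2) * ennreal ((cmod ((z - of_real s) * kernel (of_real s * z)))\<^sup>2 * g z)"
        using g[of z] z by (simp add: ennreal_mult[symmetric] ennreal_plus[symmetric] del: ennreal_plus)
    qed
    also have "\<dots> = (\<integral>\<^sup>+z. ennreal ((cmod (kernel (of_real s * z)))\<^sup>2 * g z) \<partial>disc_area) +
        ennreal (1 / \<tau>\<^sup>2) * (\<integral>\<^sup>+z. ennreal ((cmod ((z - of_real s) * kernel (of_real s * z)))\<^sup>2 * g z) \<partial>disc_area)"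
      by (subst nn_integral_add, measurable, subst nn_integral_cmult) auto
    also have "\<dots> \<le> (\<Sum>n. ennreal (A n)) + ennreal (1 / \<tau>\<^sup>2) * (\<Sum>n. ennreal (D n))"
      unfolding A_def D_def g_def using s
      by (intro add_mono mult_left_mono nn_integral_power_series_le kernel_real_sums shifted_kernel_sums) auto
    also have "ennreal (1 / \<tau>\<^sup>2) * (\<Sum>n. ennreal (D n)) = (\<Sum>n. ennreal (1 / \<tau>\<^sup>2) * ennreal (D n))"
      by simp
    also have "(\<Sum>n. ennreal (A n)) \<le> (\<Sum>n. ennreal K * T n)"
    proof (intro suminf_le allI)
      show "ennreal (A n) \<le> ennreal K * T n" for n
        using K(2)[OF t, of n] K(1) kernel_term_nonneg[of t n]
        by (simp add: A_def T_def s_def \<tau>_def ennreal_leI flip: ennreal_mult)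
    qed auto
    also have "(\<Sum>n. ennreal (1 / \<tau>\<^sup>2) * ennreal (D n)) \<le> (\<Sum>n. ennreal K * T n + ennreal K * (if n = 0 then 0 else T (n - 1)))"
    proof (intro suminf_le allI)
      fix n
      have D: "0 \<le> D n" using moment_pos[of n] variance_nonneg[of n s] by (simp add: D_def add_nonneg_nonneg)
      have "D n / \<tau>\<^sup>2 \<le> K * (kernel_term t n + (if n = 0 then 0 else kernel_term t (n - 1)))"
        using K(3)[OF t] K(4)[OF t, of "n - 1"] by (cases n) (auto simp: D_def s_def \<tau>_def add.commute)
      then have "ennreal (1 / \<tau>\<^sup>2 * D n) \<le> ennreal (K * kernel_term t n + K * (if n = 0 then 0 else kernel_term t (n - 1)))"
        by (intro ennreal_leI) (simp add: distrib_left)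
      also have "\<dots> = ennreal K * T n + ennreal K * (if n = 0 then 0 else T (n - 1))"
        using K(1) kernel_term_nonneg by (simp add: T_def ennreal_mult)
      finally show "ennreal (1 / \<tau>\<^sup>2) * ennreal (D n) \<le> ennreal K * T n + ennreal K * (if n = 0 then 0 else T (n - 1))"
        using D by (simp flip: ennreal_mult)
    qed auto
    also have "(\<Sum>n. ennreal K * T n + ennreal K * (if n = 0 then 0 else T (n - 1))) =
        ennreal K * (\<Sum>n. T n) + ennreal K * (\<Sum>n. if n = 0 then 0 else T (n - 1))"
      by (subst suminf_add[symmetric]) (auto simp del: mult_zero_right)
    also have "(\<Sum>n. ennreal K * T n) = ennreal K * (\<Sum>n. T n)"
      by simp
    finally have "(\<integral>\<^sup>+z. ennreal ((cmod (kernel (of_real s * z)))\<^sup>2 * \<omega> (cmod z) * peak \<tau> s z) \<partial>disc_area) \<le>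
        ennreal K * (\<Sum>n. T n) + (ennreal K * (\<Sum>n. T n) + ennreal K * (\<Sum>n. if n = 0 then 0 else T (n - 1)))"
      by (simp add: add_mono)
    also have "\<dots> \<le> ennreal K * (\<Sum>n. T n) + (ennreal K * (\<Sum>n. T n) + ennreal K * (\<Sum>n. T n))"
      by (intro add_mono order_refl mult_left_mono suminf_shift_le) auto
    also have "\<dots> = ennreal (3 * K) * (\<Sum>n. T n)"
    proof -
      have "ennreal (3 * K) = ennreal K + (ennreal K + ennreal K)"
        using K(1) by (simp flip: ennreal_plus)
      then show ?thesis by (simp add: distrib_right)
    qed
    also have "\<dots> \<le> ennreal (3 * K) * ennreal (L * exp (b * t powr (- B)))"
      unfolding T_def by (intro mult_left_mono L t) auto
    also have "\<dots> = ennreal (3 * K * L * exp (b * t powr (- B)))"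
      using K L by (simp add: mult.assoc flip: ennreal_mult)
    finally show "(\<integral>\<^sup>+z. ennreal ((cmod (kernel (of_real (exp (- t)) * z)))\<^sup>2 * \<omega> (cmod z) * peak (width t) (exp (- t)) z) \<partial>disc_area) \<le>
      ennreal (3 * K * L * exp (b * t powr (- B)))"
      by (simp only: s_def \<tau>_def)
  qed
qed

lemma nn_integral_kernel_le_aux:
  obtains K where "0 < K" "\<And>t. 0 < t \<Longrightarrow> t \<le> 1 \<Longrightarrow>
    (\<integral>\<^sup>+z. ennreal (cmod (kernel (of_real (exp (- t)) * z)) * sqrt (\<omega> (cmod z))) \<partial>disc_area) \<le>
    ennreal (K * exp (b / 2 * t powr (- B)))"
proof -
  obtain K where K: "0 < K" "\<And>t. 0 < t \<Longrightarrow> t \<le> 1 \<Longrightarrow>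
    (\<integral>\<^sup>+z. ennreal ((cmod (kernel (of_real (exp (- t)) * z)))\<^sup>2 * \<omega> (cmod z) * peak (width t) (exp (- t)) z) \<partial>disc_area) \<le>
    ennreal (K * exp (b * t powr (- B)))"
    using nn_integral_kernel_peak_le by blast
  obtain L where L: "0 < L" "\<And>t \<tau>. 0 < t \<Longrightarrow> t \<le> 1 \<Longrightarrow> 0 < \<tau> \<Longrightarrow> \<tau> \<le> 1 \<Longrightarrow>
    (\<integral>\<^sup>+z. ennreal (1 / peak \<tau> (exp (- t)) z) \<partial>disc_area) \<le> ennreal L"
    using nn_integral_inverse_peak_le by blast
  show ?thesis
  proof (rule that[of "sqrt (K * L)"])
    show "0 < sqrt (K * L)" using K L by simp
    fix t :: real assume t: "0 < t" "t \<le> 1"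
    define \<tau> s where "\<tau> = width t" and "s = exp (- t)"
    have \<tau>: "0 < \<tau>" "\<tau> \<le> 1"
      using t width_pos B_pos by (auto simp: \<tau>_def width_def intro!: powr_le1)
    have [measurable]: "(\<lambda>z. kernel (of_real s * z)) \<in> borel_measurable disc_area"
    proof -
      have "cmod (of_real s) < 1" using t by (simp add: s_def)
      then show ?thesis by (rule borel_measurable_kernel_mult)
    qed
    define f where "f z = ennreal (cmod (kernel (of_real s * z)) * sqrt (\<omega> (cmod z)) * sqrt (peak \<tau> s z))" for z
    define g where "g z = ennreal (1 / sqrt (peak \<tau> s z))" for z
    have P: "0 < peak \<tau> s z" for z by (rule peak_pos[OF \<tau>(1)])
    have "(\<integral>\<^sup>+z. ennreal (cmod (kernel (of_real s * z)) * sqrt (\<omega> (cmod z))) \<partial>disc_area) = (\<integral>\<^sup>+z. f z * g z \<partial>disc_area)"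
    proof (rule nn_integral_cong)
      fix z assume z: "z \<in> space disc_area"
      show "ennreal (cmod (kernel (of_real s * z)) * sqrt (\<omega> (cmod z))) = f z * g z"
        using P[of z] weight_nonneg[of z] z by (simp add: f_def g_def flip: ennreal_mult)
    qed
    also have "(\<integral>\<^sup>+z. f z * g z \<partial>disc_area)\<^sup>2 \<le> (\<integral>\<^sup>+z. (f z)\<^sup>2 \<partial>disc_area) * (\<integral>\<^sup>+z. (g z)\<^sup>2 \<partial>disc_area)"
      unfolding f_def g_def by (rule Cauchy_Schwarz_nn_integral) measurable
    finally have "(\<integral>\<^sup>+z. ennreal (cmod (kernel (of_real s * z)) * sqrt (\<omega> (cmod z))) \<partial>disc_area)\<^sup>2 \<le>
        (\<integral>\<^sup>+z. (f z)\<^sup>2 \<partial>disc_area) * (\<integral>\<^sup>+z. (g z)\<^sup>2 \<partial>disc_area)"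
      by simp
    also have "(\<integral>\<^sup>+z. (f z)\<^sup>2 \<partial>disc_area) = (\<integral>\<^sup>+z. ennreal ((cmod (kernel (of_real s * z)))\<^sup>2 * \<omega> (cmod z) * peak \<tau> s z) \<partial>disc_area)"
      using P weight_nonneg
      by (intro nn_integral_cong) (simp add: f_def ennreal_power power_mult_distrib less_imp_le)
    also have "(\<integral>\<^sup>+z. (g z)\<^sup>2 \<partial>disc_area) = (\<integral>\<^sup>+z. ennreal (1 / peak \<tau> s z) \<partial>disc_area)"
      using P by (intro nn_integral_cong) (simp add: g_def ennreal_power power_divide less_imp_le)
    also have "(\<integral>\<^sup>+z. ennreal ((cmod (kernel (of_real s * z)))\<^sup>2 * \<omega> (cmod z) * peak \<tau> s z) \<partial>disc_area) *
        (\<integral>\<^sup>+z. ennreal (1 / peak \<tau> s z) \<partial>disc_area) \<le> ennreal (K * exp (b * t powr (- B))) * ennreal L"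
      unfolding \<tau>_def s_def using t \<tau> by (intro mult_mono K L) (auto simp: \<tau>_def)
    also have "\<dots> = ennreal ((sqrt (K * L) * exp (b / 2 * t powr (- B)))\<^sup>2)"
      using K L by (simp add: power_mult_distrib mult_ac flip: ennreal_mult exp_double)
    finally show "(\<integral>\<^sup>+z. ennreal (cmod (kernel (of_real (exp (- t)) * z)) * sqrt (\<omega> (cmod z))) \<partial>disc_area) \<le>
      ennreal (sqrt (K * L) * exp (b / 2 * t powr (- B)))"
      unfolding s_def by (rule ennreal_le_of_power2_le) (use K L in simp)
  qed
qed

lemma weight_le_1: "z \<in> unit_disc \<Longrightarrow> z \<noteq> 0 \<Longrightarrow> \<omega> (cmod z) \<le> 1"
  using model_bounds(2)[of z] b_pos by (auto simp: model_def elim!: order.trans)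

theorem nn_integral_kernel_le:
  obtains K where "0 < K" "\<And>z. z \<in> unit_disc \<Longrightarrow>
    (\<integral>\<^sup>+w. ennreal (sqrt (\<omega> (cmod z)) * cmod (kernel (cnj z * w)) * sqrt (\<omega> (cmod w))) \<partial>disc_area) \<le> ennreal K"
proof -
  obtain K where K: "0 < K" "\<And>t. 0 < t \<Longrightarrow> t \<le> 1 \<Longrightarrow>
    (\<integral>\<^sup>+z. ennreal (cmod (kernel (of_real (exp (- t)) * z)) * sqrt (\<omega> (cmod z))) \<partial>disc_area) \<le>
    ennreal (K * exp (b / 2 * t powr (- B)))"
    using nn_integral_kernel_le_aux by blast
  \<comment> \<open>\<open>S\<close> and \<open>W\<close> treat |z| \<le> exp (- 1), outside the
    range t \<le> 1. The bounds of the locale do not reach the origin, hence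
    \<open>\<omega> 0\<close> in \<open>W\<close>.\<close>
  define S where "S = (\<Sum>n. exp (- 1) ^ n / moment n)"
  define W where "W = max 1 (sqrt (\<omega> 0))"
  have S: "0 \<le> S"
    unfolding S_def using moment_pos by (intro suminf_nonneg summable_kernel) (auto simp: less_imp_le)
  have W: "1 \<le> W" by (simp add: W_def)
  have W_ge: "sqrt (\<omega> (cmod z)) \<le> W" if "z \<in> unit_disc" for z
    using weight_le_1[OF that] by (cases "z = 0") (auto simp: W_def le_max_iff_disj)
  show ?thesis
  proof (rule that[of "K + W * S * W"])
    show "0 < K + W * S * W" using K S W by (intro add_pos_nonneg) auto
    fix z assume z: "z \<in> unit_disc"
    have [measurable]: "(\<lambda>w. kernel (cnj z * w)) \<in> borel_measurable disc_area"
      using z by (intro borel_measurable_kernel_mult) simp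
    show "(\<integral>\<^sup>+w. ennreal (sqrt (\<omega> (cmod z)) * cmod (kernel (cnj z * w)) * sqrt (\<omega> (cmod w))) \<partial>disc_area) \<le> ennreal (K + W * S * W)"
    proof (cases "cmod z \<le> exp (- 1)")
      case True
      have "(\<integral>\<^sup>+w. ennreal (sqrt (\<omega> (cmod z)) * cmod (kernel (cnj z * w)) * sqrt (\<omega> (cmod w))) \<partial>disc_area) \<le>
          (\<integral>\<^sup>+w. ennreal (W * S * W) \<partial>disc_area)"
      proof (rule nn_integral_mono, rule ennreal_leI)
        fix w assume w: "w \<in> space disc_area"
        have "cmod (kernel (cnj z * w)) \<le> S"
          unfolding S_def
        proof (rule kernel_bound)
          have "cmod z * cmod w \<le> exp (- 1) * 1"
            using True w by (intro mult_mono) auto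
          then show "cmod (cnj z * w) \<le> exp (- 1)" by (simp add: norm_mult)
        qed simp
        then show "sqrt (\<omega> (cmod z)) * cmod (kernel (cnj z * w)) * sqrt (\<omega> (cmod w)) \<le> W * S * W"
          using W_ge[of z] W_ge[of w] z w W S weight_nonneg[of w] by (intro mult_mono) auto
      qed
      also have "\<dots> = ennreal (W * S * W)"
        using disc_area.emeasure_space_1 by simp
      also have "\<dots> \<le> ennreal (K + W * S * W)" using K by (intro ennreal_leI) simp
      finally show ?thesis .
    next
      case False
      then have "z \<noteq> 0" by auto
      define t where "t = - ln (cmod z)"
      have t: "0 < t" "t \<le> 1" "exp (- t) = cmod z"
        using False z \<open>z \<noteq> 0\<close> ln_ge_iff[of "cmod z" "-1"] by (auto simp: t_def)
      \<comment> \<open>Rotating w makes the argument of the kernel a positive multiple of w, which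
        reduces the claim to z = exp (- t).\<close>
      define u where "u = cnj z / of_real (cmod z)"
      have u: "cmod u = 1" "\<And>w. cnj z * w = of_real (exp (- t)) * (u * w)"
        using \<open>z \<noteq> 0\<close> by (auto simp: u_def norm_divide t(3))
      have [measurable]: "(\<lambda>w. kernel (of_real (exp (- t)) * w)) \<in> borel_measurable disc_area"
        using z by (intro borel_measurable_kernel_mult) (simp add: t(3))
      have "(\<integral>\<^sup>+w. ennreal (cmod (kernel (cnj z * w)) * sqrt (\<omega> (cmod w))) \<partial>disc_area) =
          (\<integral>\<^sup>+w. ennreal (cmod (kernel (of_real (exp (- t)) * (u * w))) * sqrt (\<omega> (cmod (u * w)))) \<partial>disc_area)"
        using u(1) by (simp add: u(2) norm_mult)
      also have "\<dots> = (\<integral>\<^sup>+w. ennreal (cmod (kernel (of_real (exp (- t)) * w)) * sqrt (\<omega> (cmod w))) \<partial>disc_area)"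
        by (rule nn_integral_disc_area_rotate[OF _ u(1)]) measurable
      also have "\<dots> \<le> ennreal (K * exp (b / 2 * t powr (- B)))"
        by (rule K(2)[OF t(1,2)])
      finally have le: "(\<integral>\<^sup>+w. ennreal (cmod (kernel (cnj z * w)) * sqrt (\<omega> (cmod w))) \<partial>disc_area) \<le> ennreal (K * exp (b / 2 * t powr (- B)))" .
      have "sqrt (\<omega> (cmod z)) \<le> sqrt (exp (- (b * t powr (- B))))"
        using weight_le[OF t(1)] by (simp add: t(3))
      also have "\<dots> = exp (- (b / 2 * t powr (- B)))"
        by (simp add: real_sqrt_unique flip: exp_double)
      finally have sq: "sqrt (\<omega> (cmod z)) \<le> exp (- (b / 2 * t powr (- B)))" .
      have "(\<integral>\<^sup>+w. ennreal (sqrt (\<omega> (cmod z)) * cmod (kernel (cnj z * w)) * sqrt (\<omega> (cmod w))) \<partial>disc_area) =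
          (\<integral>\<^sup>+w. ennreal (sqrt (\<omega> (cmod z))) * ennreal (cmod (kernel (cnj z * w)) * sqrt (\<omega> (cmod w))) \<partial>disc_area)"
        using weight_nonneg z by (intro nn_integral_cong) (simp add: mult.assoc flip: ennreal_mult)
      also have "\<dots> = ennreal (sqrt (\<omega> (cmod z))) * (\<integral>\<^sup>+w. ennreal (cmod (kernel (cnj z * w)) * sqrt (\<omega> (cmod w))) \<partial>disc_area)"
        by (rule nn_integral_cmult) measurable
      also have "\<dots> \<le> ennreal (exp (- (b / 2 * t powr (- B)))) * ennreal (K * exp (b / 2 * t powr (- B)))"
        by (intro mult_mono le ennreal_leI sq) auto
      also have "\<dots> = ennreal K"
        using K by (simp add: exp_minus flip: ennreal_mult)
      also have "\<dots> \<le> ennreal (K + W * S * W)"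
        using S W by (intro ennreal_leI) simp
      finally show ?thesis .
    qed
  qed
qed

end

section \<open>Schur's test\<close>

text \<open>The bound \<open>g \<le> q powr (1 - p) * g powr p + q\<close>, with \<open>q\<close> optimized at the end, replaces Hoelder's inequality.\<close>

lemma schur_pointwise:
  fixes k g :: "'a \<Rightarrow> real"
  assumes [measurable]: "k \<in> borel_measurable M" "g \<in> borel_measurable M"
    and nonneg: "\<And>w. w \<in> space M \<Longrightarrow> 0 \<le> k w" "\<And>w. w \<in> space M \<Longrightarrow> 0 \<le> g w"
    and k: "(\<integral>\<^sup>+w. ennreal (k w) \<partial>M) \<le> ennreal K" "0 \<le> K" and p: "1 < p"
    and x: "ennreal x \<le> (\<integral>\<^sup>+w. ennreal (k w * g w) \<partial>M)" "0 \<le> x"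
  shows "ennreal (x powr p) \<le> ennreal ((1 + K) powr p) * (\<integral>\<^sup>+w. ennreal (k w * g w powr p) \<partial>M)"
proof -
  have main: "ennreal x \<le> ennreal (q powr (1 - p)) * (\<integral>\<^sup>+w. ennreal (k w * g w powr p) \<partial>M) + ennreal (q * K)"
    if q: "0 < q" for q
  proof -
    have "(\<integral>\<^sup>+w. ennreal (k w * g w) \<partial>M) \<le> (\<integral>\<^sup>+w. ennreal (q powr (1 - p)) * ennreal (k w * g w powr p) + ennreal q * ennreal (k w) \<partial>M)"
    proof (rule nn_integral_mono)
      fix w assume w: "w \<in> space M"
      have "g w \<le> q powr (1 - p) * g w powr p + q"
      proof (cases "g w \<le> q")
        case False
        then have "(g w / q) powr 1 \<le> (g w / q) powr p"
          using q p by (intro powr_mono) auto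
        then have "g w \<le> q powr (1 - p) * g w powr p"
          using q False by (simp add: powr_divide powr_diff field_simps)
        then show ?thesis using q by simp
      qed (auto intro: add_increasing)
      then have "k w * g w \<le> k w * (q powr (1 - p) * g w powr p + q)"
        using nonneg[OF w] by (intro mult_left_mono) auto
      also have "\<dots> = q powr (1 - p) * (k w * g w powr p) + q * k w"
        by (simp add: algebra_simps)
      finally have "ennreal (k w * g w) \<le> ennreal (q powr (1 - p) * (k w * g w powr p) + q * k w)"
        by (rule ennreal_leI)
      then show "ennreal (k w * g w) \<le> ennreal (q powr (1 - p)) * ennreal (k w * g w powr p) + ennreal q * ennreal (k w)"
        using nonneg[OF w] q by (simp add: ennreal_mult)
    qed
    also have "\<dots> = ennreal (q powr (1 - p)) * (\<integral>\<^sup>+w. ennreal (k w * g w powr p) \<partial>M) + ennreal q * (\<integral>\<^sup>+w. ennreal (k w) \<partial>M)"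
      by (subst nn_integral_add, measurable, subst nn_integral_cmult, measurable, subst nn_integral_cmult) auto
    also have "ennreal q * (\<integral>\<^sup>+w. ennreal (k w) \<partial>M) \<le> ennreal q * ennreal K"
      by (intro mult_left_mono k) simp
    also have "ennreal q * ennreal K = ennreal (q * K)"
      using q k by (simp flip: ennreal_mult)
    finally show ?thesis using x(1) by (auto intro: order.trans add_left_mono)
  qed
  show ?thesis
  proof (cases "\<integral>\<^sup>+w. ennreal (k w * g w powr p) \<partial>M")
    case top
    then show ?thesis
      using k(2) by (simp add: ennreal_mult_top)
  next
    case (real i)
    show ?thesis
    proof (cases "i = 0")
      case True
      have "x \<le> q * K" if "0 < q" for q
        using main[OF that] real True that k by (simp add: ennreal_le_iff)
      \<comment> \<open>For this q the bound reads x \<le> x K / (2 (K + 1)), which is at most x /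
        2.\<close>
      from this[of "x / (2 * (K + 1))"] have "x = 0"
        using x(2) k(2) mult_nonneg_nonneg[OF k(2) x(2)] by (cases "x = 0") (auto simp: field_simps)
      then show ?thesis using p by simp
    next
      case False
      then have i: "0 < i" using real by simp
      \<comment> \<open>Balances the two terms of the bound, since then q^(1-p) i = q.\<close>
      define q where "q = i powr (1 / p)"
      have q: "0 < q" using i by (simp add: q_def)
      have "q powr (1 - p) * i = i powr ((1 / p) * (1 - p)) * i powr 1"
        using i by (simp add: q_def powr_powr)
      also have "\<dots> = i powr ((1 / p) * (1 - p) + 1)" by (rule powr_add[symmetric])
      also have "(1 / p) * (1 - p) + 1 = 1 / p" using p by (simp add: field_simps)
      finally have eq: "q powr (1 - p) * i = q" by (simp add: q_def)
      have "ennreal x \<le> ennreal (q powr (1 - p) * i + q * K)"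
        using main[OF q] real i q k by (simp add: ennreal_mult)
      then have "x \<le> (1 + K) * q"
        using q k(2) unfolding eq by (subst (asm) ennreal_le_iff) (auto simp: algebra_simps)
      then have "x powr p \<le> ((1 + K) * q) powr p"
        using x(2) p by (intro powr_mono2) auto
      also have "\<dots> = (1 + K) powr p * i"
        using k(2) q i p by (simp add: powr_mult q_def powr_powr)
      finally have "ennreal (x powr p) \<le> ennreal ((1 + K) powr p * i)"
        by (rule ennreal_leI)
      then show ?thesis
        using real i by (simp add: ennreal_mult)
    qed
  qed
qed

section \<open>Sufficiency\<close>

context exponential_weight
begin

lemma kernel_swap:
  assumes "z \<in> unit_disc" "w \<in> unit_disc"
  shows "cmod (kernel (cnj z * w)) = cmod (kernel (cnj w * z))"
proof -
  have "cmod (cnj z * w) < 1"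
    using norm_mult_less_one[of "cnj z" w] assms by simp
  from kernel_cnj[OF this] have "kernel (cnj w * z) = cnj (kernel (cnj z * w))"
    by (simp add: mult.commute)
  then show ?thesis by simp
qed

text \<open>Joint measurability is needed for Tonelli's theorem. The series is controlled only
  inside the disc, so a Borel extension by 0 is composed with the product instead.\<close>

lemma measurable_kernel_pair [measurable]:
  "(\<lambda>(z, w). kernel (cnj z * w)) \<in> borel_measurable (disc_area \<Otimes>\<^sub>M disc_area)"
proof -
  define k where "k u = (if u \<in> unit_disc then kernel u else 0)" for u
  have [measurable]: "k \<in> borel_measurable borel"
    unfolding k_def by (intro borel_measurable_if_disc holomorphic_on_imp_continuous_on holomorphic_kernel)
  have "(\<lambda>(z, w). k (cnj z * w)) \<in> borel_measurable (disc_area \<Otimes>\<^sub>M disc_area)"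
    by measurable
  moreover have "k (cnj z * w) = kernel (cnj z * w)" if "z \<in> unit_disc" "w \<in> unit_disc" for z w
    using norm_mult_less_one[of "cnj z" w] that by (simp add: k_def)
  ultimately show ?thesis
    by (subst measurable_cong[where g = "\<lambda>(z, w). k (cnj z * w)"]) (auto simp: space_pair_measure)
qed

lemma integrable_mult_kernel:
  fixes f :: "complex \<Rightarrow> complex"
  assumes z: "z \<in> unit_disc" and [measurable]: "f \<in> borel_measurable disc_area"
    and f: "integrable disc_area (\<lambda>w. cmod (f w) * \<omega> (cmod w))"
  shows "integrable disc_area (\<lambda>w. f w * cnj (kernel (cnj z * w)) * of_real (\<omega> (cmod w)))"
proof (rule Bochner_Integration.integrable_bound[OF integrable_mult_right[OF f, of "\<Sum>n. cmod z ^ n / moment n"]])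
  have [measurable]: "(\<lambda>w. kernel (cnj z * w)) \<in> borel_measurable disc_area"
    using z by (intro borel_measurable_kernel_mult) simp
  show "(\<lambda>w. f w * cnj (kernel (cnj z * w)) * of_real (\<omega> (cmod w))) \<in> borel_measurable disc_area"
    by measurable
  show "AE w in disc_area. norm (f w * cnj (kernel (cnj z * w)) * of_real (\<omega> (cmod w))) \<le>
      norm ((\<Sum>n. cmod z ^ n / moment n) * (cmod (f w) * \<omega> (cmod w)))"
  proof (rule AE_I2)
    fix w assume w: "w \<in> space disc_area"
    have "cmod (kernel (cnj z * w)) \<le> (\<Sum>n. cmod z ^ n / moment n)"
      using z w by (intro kernel_bound) (auto simp: norm_mult mult_left_le)
    then have "cmod (kernel (cnj z * w)) * (cmod (f w) * \<omega> (cmod w)) \<le> (\<Sum>n. cmod z ^ n / moment n) * (cmod (f w) * \<omega> (cmod w))"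
      using weight_nonneg[of w] w by (intro mult_right_mono) auto
    also have "\<dots> \<le> norm ((\<Sum>n. cmod z ^ n / moment n) * (cmod (f w) * \<omega> (cmod w)))"
      by simp
    finally show "norm (f w * cnj (kernel (cnj z * w)) * of_real (\<omega> (cmod w))) \<le>
        norm ((\<Sum>n. cmod z ^ n / moment n) * (cmod (f w) * \<omega> (cmod w)))"
      using weight_nonneg[of w] w by (simp add: norm_mult mult_ac)
  qed
qed

lemma bergman_projection_eq:
  assumes "z \<in> unit_disc"
  shows "bergman_projection (radial \<omega>) f z = (LINT w|disc_area. f w * cnj (kernel (cnj z * w)) * of_real (\<omega> (cmod w)))"
  unfolding bergman_projection_def radial_def
  using assms by (intro Bochner_Integration.integral_cong) (auto simp: bergman_kernel_eq[unfolded radial_def])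

lemma borel_measurable_bergman_projection:
  assumes [measurable]: "f \<in> borel_measurable disc_area"
  shows "bergman_projection (radial \<omega>) f \<in> borel_measurable disc_area"
proof -
  have "(\<lambda>z. LINT w|disc_area. f w * cnj (kernel (cnj z * w)) * of_real (\<omega> (cmod w))) \<in> borel_measurable disc_area"
    by measurable
  then show ?thesis
    by (rule measurable_cong[THEN iffD2, rotated]) (simp add: bergman_projection_eq)
qed

text \<open>Because \<nu> is comparable with \<omega>^(p/2), passing from f to |f| \<omega>^(1/2)
  turns the claim into boundedness on unweighted L^p of an integral operator whose kernel
  \<open>k\<close> is symmetric. A single integral bound therefore serves both marginals of Schur's
  test, for every p.\<close>

theorem bergman_projection_bounded_if_comparable:
  fixes \<nu> :: "real \<Rightarrow> real"
  assumes p: "1 < p" and [measurable]: "(\<lambda>z. \<nu> (cmod z)) \<in> borel_measurable disc_area"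
    and c: "0 < c1" "0 < c2"
    and \<nu>: "\<And>r. 0 < r \<Longrightarrow> r < 1 \<Longrightarrow> c1 * \<omega> r powr (p / 2) \<le> \<nu> r"
      "\<And>r. 0 < r \<Longrightarrow> r < 1 \<Longrightarrow> \<nu> r \<le> c2 * \<omega> r powr (p / 2)"
  shows "bergman_projection_bounded (radial \<omega>) p (radial \<nu>)"
proof -
  obtain K where K: "0 < K" "\<And>z. z \<in> unit_disc \<Longrightarrow>
    (\<integral>\<^sup>+w. ennreal (sqrt (\<omega> (cmod z)) * cmod (kernel (cnj z * w)) * sqrt (\<omega> (cmod w))) \<partial>disc_area) \<le> ennreal K"
    using nn_integral_kernel_le by blast
  define k where "k z w = sqrt (\<omega> (cmod z)) * cmod (kernel (cnj z * w)) * sqrt (\<omega> (cmod w))" for z w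
  have k_nonneg: "0 \<le> k z w" if "z \<in> unit_disc" "w \<in> unit_disc" for z w
    using weight_nonneg that by (simp add: k_def)
  have k_swap: "k z w = k w z" if "z \<in> unit_disc" "w \<in> unit_disc" for z w
    using kernel_swap[OF that] by (simp add: k_def mult_ac)
  have [measurable]: "(\<lambda>(z, w). k z w) \<in> borel_measurable (disc_area \<Otimes>\<^sub>M disc_area)"
    unfolding k_def by measurable
  have \<nu>_nonneg: "0 \<le> \<nu> (cmod z)" if "z \<in> unit_disc" "z \<noteq> 0" for z
    using \<nu>(1)[of "cmod z"] c that by (auto intro: order.trans[rotated])
  define C where "C = c2 * ((1 + K) powr p * (K * (1 / c1)))"
  have C: "0 \<le> C" using c K by (simp add: C_def)
  have main: "integrable disc_area (\<lambda>w. cmod (f w) * \<omega> (cmod w)) \<and>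
      (\<integral>\<^sup>+z. ennreal (cmod (bergman_projection (radial \<omega>) f z) powr p * \<nu> (cmod z)) \<partial>disc_area) \<le>
      ennreal (C * (LINT z|disc_area. cmod (f z) powr p * \<nu> (cmod z)))"
    if f: "f \<in> weighted_Lp p (radial \<nu>)" for f
  proof -
    have [measurable]: "f \<in> borel_measurable disc_area" and int: "integrable disc_area (\<lambda>z. cmod (f z) powr p * \<nu> (cmod z))"
      using f by (auto simp: weighted_Lp_def radial_def)
    define N where "N = (LINT z|disc_area. cmod (f z) powr p * \<nu> (cmod z))"
    define g where "g w = cmod (f w) * sqrt (\<omega> (cmod w))" for w
    have [measurable]: "g \<in> borel_measurable disc_area"
      unfolding g_def by measurable
    have g_nonneg: "0 \<le> g w" if "w \<in> unit_disc" for w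
      using weight_nonneg[OF that] by (simp add: g_def)
    have sqrt_powr: "sqrt (\<omega> (cmod w)) powr p = \<omega> (cmod w) powr (p / 2)" if "w \<in> unit_disc" for w
      using weight_nonneg[OF that] by (simp add: powr_half_sqrt[symmetric] powr_powr)
    have g_powr: "g w powr p = cmod (f w) powr p * \<omega> (cmod w) powr (p / 2)" if "w \<in> unit_disc" for w
      using weight_nonneg[OF that] sqrt_powr[OF that] by (simp add: g_def powr_mult)
    have g_le: "g w powr p \<le> 1 / c1 * (cmod (f w) powr p * \<nu> (cmod w))" if "w \<in> unit_disc" "w \<noteq> 0" for w
    proof -
      have "\<omega> (cmod w) powr (p / 2) \<le> \<nu> (cmod w) / c1"
        using \<nu>(1)[of "cmod w"] that c by (simp add: pos_le_divide_eq mult.commute)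
      then have "cmod (f w) powr p * \<omega> (cmod w) powr (p / 2) \<le> cmod (f w) powr p * (\<nu> (cmod w) / c1)"
        by (intro mult_left_mono) auto
      then show ?thesis using g_powr[OF that(1)] by simp
    qed
    have int_g: "integrable disc_area (\<lambda>w. g w powr p)"
    proof (rule Bochner_Integration.integrable_bound[OF integrable_mult_right[OF int, of "1 / c1"]])
      show "AE w in disc_area. norm (g w powr p) \<le> norm (1 / c1 * (cmod (f w) powr p * \<nu> (cmod w)))"
      proof (rule AE_disc_areaI)
        fix w assume w: "w \<in> unit_disc" "w \<noteq> 0"
        show "norm (g w powr p) \<le> norm (1 / c1 * (cmod (f w) powr p * \<nu> (cmod w)))"
          using order.trans[OF g_le[OF w] abs_ge_self] by simp
      qed
    qed measurable
    have nn_g: "(\<integral>\<^sup>+w. ennreal (g w powr p) \<partial>disc_area) \<le> ennreal (1 / c1 * N)"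
    proof -
      have "(\<integral>\<^sup>+w. ennreal (g w powr p) \<partial>disc_area) = ennreal (LINT w|disc_area. g w powr p)"
        by (intro nn_integral_eq_integral int_g) simp
      also have "(LINT w|disc_area. g w powr p) \<le> (LINT w|disc_area. 1 / c1 * (cmod (f w) powr p * \<nu> (cmod w)))"
        by (intro integral_mono_AE int_g integrable_mult_right int AE_disc_areaI g_le)
      then have "ennreal (LINT w|disc_area. g w powr p) \<le> ennreal (1 / c1 * N)"
        by (intro ennreal_leI) (simp add: N_def)
      finally show ?thesis .
    qed
    \<comment> \<open>Well-definedness of the projection: away from 0 the weight is at most 1, so
      |f| \<omega> \<le> g \<le> 1 + g^p.\<close>
    have f_int: "integrable disc_area (\<lambda>w. cmod (f w) * \<omega> (cmod w))"
    proof (rule Bochner_Integration.integrable_bound[where f = "\<lambda>w. 1 + g w powr p"])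
      show "integrable disc_area (\<lambda>w. 1 + g w powr p)"
        using int_g by simp
      show "AE w in disc_area. norm (cmod (f w) * \<omega> (cmod w)) \<le> norm (1 + g w powr p)"
      proof (rule AE_disc_areaI)
        fix w assume w: "w \<in> unit_disc" "w \<noteq> 0"
        have "cmod (f w) * \<omega> (cmod w) = g w * sqrt (\<omega> (cmod w))"
          using weight_nonneg[OF w(1)] by (simp add: g_def mult.assoc)
        also have "\<dots> \<le> g w * 1"
          using g_nonneg[OF w(1)] weight_le_1[OF w] by (intro mult_left_mono) auto
        also have "\<dots> \<le> 1 + g w powr p"
        proof (cases "g w \<le> 1")
          case False
          then have "g w powr 1 \<le> g w powr p" using p by (intro powr_mono) auto
          then show ?thesis using False by simp
        qed (auto intro: add_increasing2)
        finally show "norm (cmod (f w) * \<omega> (cmod w)) \<le> norm (1 + g w powr p)"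
          using weight_nonneg[OF w(1)] by (simp add: add_nonneg_nonneg)
      qed
    qed measurable
    have point: "ennreal (cmod (bergman_projection (radial \<omega>) f z) powr p * \<omega> (cmod z) powr (p / 2)) \<le>
        ennreal ((1 + K) powr p) * (\<integral>\<^sup>+w. ennreal (k z w * g w powr p) \<partial>disc_area)" if z: "z \<in> unit_disc" for z
    proof -
      have kz [measurable]: "k z \<in> borel_measurable disc_area"
        using measurable_Pair2[of "\<lambda>(z, w). k z w" disc_area disc_area borel z] z by simp
      define x where "x = cmod (bergman_projection (radial \<omega>) f z) * sqrt (\<omega> (cmod z))"
      have x: "0 \<le> x" using weight_nonneg[OF z] by (simp add: x_def)
      have "ennreal x = ennreal (sqrt (\<omega> (cmod z))) * ennreal (cmod (bergman_projection (radial \<omega>) f z))"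
        using weight_nonneg[OF z] by (simp add: x_def mult.commute flip: ennreal_mult)
      also have "\<dots> \<le> ennreal (sqrt (\<omega> (cmod z))) * (\<integral>\<^sup>+w. ennreal (norm (f w * cnj (kernel (cnj z * w)) * of_real (\<omega> (cmod w)))) \<partial>disc_area)"
        unfolding bergman_projection_eq[OF z]
        by (intro mult_left_mono integral_norm_bound_ennreal integrable_mult_kernel z f_int) auto
      also have "\<dots> = (\<integral>\<^sup>+w. ennreal (sqrt (\<omega> (cmod z))) * ennreal (norm (f w * cnj (kernel (cnj z * w)) * of_real (\<omega> (cmod w)))) \<partial>disc_area)"
      proof (rule nn_integral_cmult[symmetric])
        have [measurable]: "(\<lambda>w. kernel (cnj z * w)) \<in> borel_measurable disc_area"
          using z by (intro borel_measurable_kernel_mult) simp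
        show "(\<lambda>w. ennreal (norm (f w * cnj (kernel (cnj z * w)) * of_real (\<omega> (cmod w))))) \<in> borel_measurable disc_area"
          by measurable
      qed
      also have "\<dots> = (\<integral>\<^sup>+w. ennreal (k z w * g w) \<partial>disc_area)"
      proof (rule nn_integral_cong)
        fix w assume "w \<in> space disc_area"
        then have "0 \<le> \<omega> (cmod w)" using weight_nonneg[of w] by simp
        then show "ennreal (sqrt (\<omega> (cmod z))) * ennreal (norm (f w * cnj (kernel (cnj z * w)) * of_real (\<omega> (cmod w)))) = ennreal (k z w * g w)"
          using weight_nonneg[OF z] by (simp add: k_def g_def norm_mult mult_ac flip: ennreal_mult)
      qed
      finally have "ennreal (x powr p) \<le> ennreal ((1 + K) powr p) * (\<integral>\<^sup>+w. ennreal (k z w * g w powr p) \<partial>disc_area)"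
        using K(2)[OF z] K(1) k_nonneg[OF z] g_nonneg p x
        by (intro schur_pointwise kz) (auto simp: k_def)
      also have "x powr p = cmod (bergman_projection (radial \<omega>) f z) powr p * \<omega> (cmod z) powr (p / 2)"
        using weight_nonneg[OF z] sqrt_powr[OF z] by (simp add: x_def powr_mult)
      finally show ?thesis .
    qed
    have "(\<integral>\<^sup>+z. ennreal (cmod (bergman_projection (radial \<omega>) f z) powr p * \<nu> (cmod z)) \<partial>disc_area) \<le>
        (\<integral>\<^sup>+z. ennreal c2 * (ennreal ((1 + K) powr p) * (\<integral>\<^sup>+w. ennreal (k z w * g w powr p) \<partial>disc_area)) \<partial>disc_area)"
    proof (rule nn_integral_mono_AE, rule AE_disc_areaI)
      fix z assume z: "z \<in> unit_disc" "z \<noteq> 0"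
      have "cmod (bergman_projection (radial \<omega>) f z) powr p * \<nu> (cmod z) \<le>
          cmod (bergman_projection (radial \<omega>) f z) powr p * (c2 * \<omega> (cmod z) powr (p / 2))"
        using \<nu>(2)[of "cmod z"] z by (intro mult_left_mono) auto
      then have "ennreal (cmod (bergman_projection (radial \<omega>) f z) powr p * \<nu> (cmod z)) \<le>
          ennreal (c2 * (cmod (bergman_projection (radial \<omega>) f z) powr p * \<omega> (cmod z) powr (p / 2)))"
        by (intro ennreal_leI) (simp add: mult_ac)
      also have "\<dots> = ennreal c2 * ennreal (cmod (bergman_projection (radial \<omega>) f z) powr p * \<omega> (cmod z) powr (p / 2))"
        using c by (simp add: ennreal_mult)
      also have "\<dots> \<le> ennreal c2 * (ennreal ((1 + K) powr p) * (\<integral>\<^sup>+w. ennreal (k z w * g w powr p) \<partial>disc_area))"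
        by (intro mult_left_mono point z) auto
      finally show "ennreal (cmod (bergman_projection (radial \<omega>) f z) powr p * \<nu> (cmod z)) \<le>
          ennreal c2 * (ennreal ((1 + K) powr p) * (\<integral>\<^sup>+w. ennreal (k z w * g w powr p) \<partial>disc_area))" .
    qed
    also have "\<dots> = ennreal c2 * (ennreal ((1 + K) powr p) * (\<integral>\<^sup>+z. \<integral>\<^sup>+w. ennreal (k z w * g w powr p) \<partial>disc_area \<partial>disc_area))"
      by (subst nn_integral_cmult, measurable, subst nn_integral_cmult, measurable)
    also have "(\<integral>\<^sup>+z. \<integral>\<^sup>+w. ennreal (k z w * g w powr p) \<partial>disc_area \<partial>disc_area) = (\<integral>\<^sup>+w. \<integral>\<^sup>+z. ennreal (k z w * g w powr p) \<partial>disc_area \<partial>disc_area)"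
    proof -
      interpret pair_sigma_finite disc_area disc_area
        by unfold_locales
      show ?thesis by (rule Fubini'[symmetric]) measurable
    qed
    also have "\<dots> \<le> (\<integral>\<^sup>+w. ennreal K * ennreal (g w powr p) \<partial>disc_area)"
    proof (rule nn_integral_mono)
      fix w assume w: "w \<in> space disc_area"
      have [measurable]: "k w \<in> borel_measurable disc_area"
        using measurable_Pair2[of "\<lambda>(z, w). k z w" disc_area disc_area borel w] w by simp
      have "(\<integral>\<^sup>+z. ennreal (k z w * g w powr p) \<partial>disc_area) = (\<integral>\<^sup>+z. ennreal (k w z) * ennreal (g w powr p) \<partial>disc_area)"
        using w k_swap[of _ w] k_nonneg[of w] by (intro nn_integral_cong) (simp add: ennreal_mult)
      also have "\<dots> = (\<integral>\<^sup>+z. ennreal (k w z) \<partial>disc_area) * ennreal (g w powr p)"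
        by (rule nn_integral_multc) measurable
      also have "\<dots> \<le> ennreal K * ennreal (g w powr p)"
        using K(2)[of w] w by (intro mult_right_mono) (auto simp: k_def)
      finally show "(\<integral>\<^sup>+z. ennreal (k z w * g w powr p) \<partial>disc_area) \<le> ennreal K * ennreal (g w powr p)" .
    qed
    also have "\<dots> = ennreal K * (\<integral>\<^sup>+w. ennreal (g w powr p) \<partial>disc_area)"
      by (rule nn_integral_cmult) measurable
    also have "\<dots> \<le> ennreal K * ennreal (1 / c1 * N)"
      by (intro mult_left_mono nn_g) simp
    finally have "(\<integral>\<^sup>+z. ennreal (cmod (bergman_projection (radial \<omega>) f z) powr p * \<nu> (cmod z)) \<partial>disc_area) \<le>
        ennreal c2 * (ennreal ((1 + K) powr p) * (ennreal K * ennreal (1 / c1 * N)))"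
      by (simp add: mult_left_mono)
    also have "\<dots> = ennreal (C * N)"
    proof -
      have "0 \<le> N" unfolding N_def
        by (intro Bochner_Integration.integral_nonneg_AE AE_disc_areaI mult_nonneg_nonneg \<nu>_nonneg) auto
      then show ?thesis
        using c K by (simp add: C_def mult.assoc flip: ennreal_mult)
    qed
    finally show ?thesis using f_int by (simp add: N_def)
  qed
  show ?thesis
    unfolding bergman_projection_bounded_def
  proof (intro conjI ballI exI[of _ "C powr (1 / p)"])
    fix f z assume f: "f \<in> weighted_Lp p (radial \<nu>)" and z: "z \<in> unit_disc"
    have "integrable disc_area (\<lambda>w. f w * cnj (kernel (cnj z * w)) * of_real (\<omega> (cmod w)))"
      using main[OF f] f z by (intro integrable_mult_kernel) (auto simp: weighted_Lp_def)
    then show "integrable disc_area (\<lambda>\<zeta>. f \<zeta> * cnj (bergman_kernel (radial \<omega>) z \<zeta>) * complex_of_real (radial \<omega> \<zeta>))"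
      by (rule Bochner_Integration.integrable_cong[THEN iffD2, rotated 2])
        (use z in \<open>simp_all add: bergman_kernel_eq\<close>, simp add: radial_def)
  next
    fix f assume f: "f \<in> weighted_Lp p (radial \<nu>)"
    define F where "F = bergman_projection (radial \<omega>) f"
    have [measurable]: "F \<in> borel_measurable disc_area"
      using f unfolding F_def by (intro borel_measurable_bergman_projection) (simp add: weighted_Lp_def)
    have nonneg: "AE z in disc_area. 0 \<le> cmod (h z) powr p * \<nu> (cmod z)" for h :: "complex \<Rightarrow> complex"
      using \<nu>_nonneg by (intro AE_disc_areaI) simp
    have le: "(\<integral>\<^sup>+z. ennreal (cmod (F z) powr p * \<nu> (cmod z)) \<partial>disc_area) \<le>
        ennreal (C * (LINT z|disc_area. cmod (f z) powr p * \<nu> (cmod z)))"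
      using main[OF f] by (simp add: F_def)
    have int: "integrable disc_area (\<lambda>z. cmod (F z) powr p * \<nu> (cmod z))"
      using nonneg[of F] le by (intro integrableI_nonneg) (auto intro: le_less_trans)
    then show "bergman_projection (radial \<omega>) f \<in> weighted_Lp p (radial \<nu>)"
      by (simp add: F_def[symmetric] weighted_Lp_def radial_def)
    have N: "0 \<le> (LINT z|disc_area. cmod (f z) powr p * \<nu> (cmod z))" "0 \<le> (LINT z|disc_area. cmod (F z) powr p * \<nu> (cmod z))"
      by (intro Bochner_Integration.integral_nonneg_AE nonneg)+
    have "(LINT z|disc_area. cmod (F z) powr p * \<nu> (cmod z)) \<le> C * (LINT z|disc_area. cmod (f z) powr p * \<nu> (cmod z))"
      using le nn_integral_eq_integral[OF int nonneg] C N by (simp add: ennreal_le_iff)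
    then have "(LINT z|disc_area. cmod (F z) powr p * \<nu> (cmod z)) powr (1 / p) \<le> (C * (LINT z|disc_area. cmod (f z) powr p * \<nu> (cmod z))) powr (1 / p)"
      using p N by (intro powr_mono2) auto
    also have "\<dots> = C powr (1 / p) * (LINT z|disc_area. cmod (f z) powr p * \<nu> (cmod z)) powr (1 / p)"
      using C N by (simp add: powr_mult)
    finally show "weighted_Lp_norm p (radial \<nu>) (bergman_projection (radial \<omega>) f) \<le> C powr (1 / p) * weighted_Lp_norm p (radial \<nu>) f"
      by (simp add: weighted_Lp_norm_def radial_def F_def)
  qed
qed

end

section \<open>Necessity\<close>

definition annulus :: "real \<Rightarrow> real \<Rightarrow> real \<Rightarrow> real" where
  "annulus u \<delta> = indicator {exp (- (u + \<delta>))..<exp (- u)}"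

lemma borel_measurable_annulus [measurable]: "annulus u \<delta> \<in> borel_measurable borel"
  by (simp add: annulus_def)

lemma annulus_bounds: "0 \<le> annulus u \<delta> r" "annulus u \<delta> r \<le> 1"
  by (simp_all add: annulus_def indicator_def)

lemma integral_annulus_ge:
  assumes "0 < u" "0 < \<delta>"
  shows "2 * \<delta> * exp (- 2 * (u + \<delta>)) \<le> (LINT z|disc_area. annulus u \<delta> (cmod z))"
proof -
  have sets: "ball 0 (exp (- u)) \<in> sets disc_area" "ball 0 (exp (- (u + \<delta>))) \<in> sets disc_area"
    using assms by (auto intro!: sets_disc_area_ball)
  define S where "S = ball 0 (exp (- u)) - ball (0 :: complex) (exp (- (u + \<delta>)))"
  have eq: "annulus u \<delta> (cmod z) = indicator S z" for z
    by (auto simp: annulus_def indicator_def S_def)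
  have "S \<subseteq> unit_disc"
    using subset_ball[of "exp (- u)" 1 "0 :: complex"] assms by (auto simp: S_def)
  then have S: "S \<inter> unit_disc = S" by blast
  have meas: "measure disc_area (ball 0 (exp (- v))) = exp (- 2 * v)" if "0 < v" for v
    using that emeasure_disc_area_ball[of "exp (- v)"]
    by (simp add: measure_def exp_double[symmetric])
  have sub: "ball 0 (exp (- (u + \<delta>))) \<subseteq> (ball 0 (exp (- u)) :: complex set)"
    using assms by (intro subset_ball) simp
  have "(LINT z|disc_area. annulus u \<delta> (cmod z)) = measure disc_area S"
    unfolding eq by (simp add: S)
  also have "\<dots> = exp (- 2 * u) - exp (- 2 * (u + \<delta>))"
    using sets sub assms meas[of u] meas[of "u + \<delta>"]
    unfolding S_def by (subst disc_area.finite_measure_Diff) auto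
  also have "\<dots> = exp (- 2 * (u + \<delta>)) * (exp (2 * \<delta>) - 1)"
    by (simp add: right_diff_distrib flip: exp_add)
  also have "\<dots> \<ge> exp (- 2 * (u + \<delta>)) * (2 * \<delta>)"
  proof (rule mult_left_mono)
    have "1 + 2 * \<delta> \<le> exp (2 * \<delta>)" by (rule exp_ge_add_one_self)
    then show "2 * \<delta> \<le> exp (2 * \<delta>) - 1" by (simp only: le_diff_eq add.commute)
  qed simp
  finally show ?thesis by (simp add: mult_ac)
qed

section \<open>Truncated monomials and their projections\<close>

context exponential_weight
begin

lemma integrable_powr_annulus:
  assumes "0 \<le> q"
  shows "integrable disc_area (\<lambda>z. cmod z powr q * annulus u \<delta> (cmod z) * \<omega> (cmod z))"
    and "integrable disc_area (\<lambda>z. cmod z powr q * \<omega> (cmod z))"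
proof -
  have "integrable disc_area (\<lambda>z. (cmod z powr q * annulus u \<delta> (cmod z)) * of_real (\<omega> (cmod z)))"
    using assms annulus_bounds
    by (intro integrable_bounded_mult_weight[where C = 1]) (auto intro!: mult_le_one powr_le1)
  then show "integrable disc_area (\<lambda>z. cmod z powr q * annulus u \<delta> (cmod z) * \<omega> (cmod z))" by simp
  have "integrable disc_area (\<lambda>z. (cmod z powr q) * of_real (\<omega> (cmod z)))"
    using assms by (intro integrable_bounded_mult_weight[where C = 1]) (auto intro!: powr_le1)
  then show "integrable disc_area (\<lambda>z. cmod z powr q * \<omega> (cmod z))" by simp
qed

text \<open>Each factor is replaced by its minimum on the annulus: the power of |z| by its value at
  the inner circle, the weight by the bound at the outer one. The exponent q is real because p-th
  powers of monomials occur.\<close>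

lemma annulus_integral_ge:
  assumes "0 \<le> q" "0 < u" "0 < \<delta>"
  shows "c * (2 * \<delta>) * exp (- 2 * (u + \<delta>) - q * (u + \<delta>) - b * u powr (- B)) \<le>
    (LINT z|disc_area. cmod z powr q * annulus u \<delta> (cmod z) * \<omega> (cmod z))"
proof -
  define \<kappa> where "\<kappa> = c * exp (- q * (u + \<delta>) - b * u powr (- B))"
  have \<kappa>: "0 \<le> \<kappa>" using c_pos by (simp add: \<kappa>_def)
  have "c * (2 * \<delta>) * exp (- 2 * (u + \<delta>) - q * (u + \<delta>) - b * u powr (- B)) = \<kappa> * (2 * \<delta> * exp (- 2 * (u + \<delta>)))"
  proof -
    have "- 2 * (u + \<delta>) - q * (u + \<delta>) - b * u powr (- B) = (- q * (u + \<delta>) - b * u powr (- B)) + (- 2 * (u + \<delta>))"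
      by simp
    then show ?thesis unfolding \<kappa>_def by (simp only: exp_add mult_ac)
  qed
  also have "\<dots> \<le> \<kappa> * (LINT z|disc_area. annulus u \<delta> (cmod z))"
    using assms \<kappa> by (intro mult_left_mono integral_annulus_ge) auto
  also have "\<dots> = (LINT z|disc_area. \<kappa> * annulus u \<delta> (cmod z))"
    by simp
  also have "\<dots> \<le> (LINT z|disc_area. cmod z powr q * annulus u \<delta> (cmod z) * \<omega> (cmod z))"
  proof (intro integral_mono integrable_powr_annulus assms)
    show "integrable disc_area (\<lambda>z. \<kappa> * annulus u \<delta> (cmod z))"
      by (intro integrable_mult_right disc_area.integrable_const_bound[where B = 1]) (auto intro!: AE_I2 simp: annulus_bounds)
    fix z assume z: "z \<in> space disc_area"
    show "\<kappa> * annulus u \<delta> (cmod z) \<le> cmod z powr q * annulus u \<delta> (cmod z) * \<omega> (cmod z)"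
    proof (cases "cmod z \<in> {exp (- (u + \<delta>))..<exp (- u)}")
      case True
      have z0: "0 < cmod z" using True by (auto intro: less_le_trans)
      define t where "t = - ln (cmod z)"
      have t: "cmod z = exp (- t)" using z0 by (simp add: t_def)
      have tu: "u \<le> t" "t \<le> u + \<delta>" using True by (auto simp: t)
      have "exp (- q * (u + \<delta>)) \<le> exp (- q * t)"
        using tu assms by (simp add: mult_left_mono)
      also have "\<dots> = cmod z powr q" by (simp add: t powr_def)
      finally have 1: "exp (- q * (u + \<delta>)) \<le> cmod z powr q" .
      have "t powr (- B) \<le> u powr (- B)"
        using tu assms B_pos by (intro powr_mono2') auto
      then have "c * exp (- (b * u powr (- B))) \<le> c * exp (- (b * t powr (- B)))"
        using c_pos b_pos by (simp add: mult_left_mono)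
      also have "\<dots> \<le> \<omega> (cmod z)" using weight_ge[of t] tu assms by (simp add: t)
      finally have 2: "c * exp (- (b * u powr (- B))) \<le> \<omega> (cmod z)" .
      have "exp (- q * (u + \<delta>)) * (c * exp (- (b * u powr (- B)))) \<le> cmod z powr q * \<omega> (cmod z)"
        using 1 2 c_pos by (intro mult_mono) auto
      moreover have "\<kappa> = exp (- q * (u + \<delta>)) * (c * exp (- (b * u powr (- B))))"
        unfolding \<kappa>_def diff_conv_add_uminus exp_add by (simp only: mult_ac)
      ultimately have "\<kappa> \<le> cmod z powr q * \<omega> (cmod z)"
        by simp
      then show ?thesis using True by (simp add: annulus_def)
    qed (simp add: annulus_def)
  qed
  finally show ?thesis .
qed

lemma annulus_integral_le:
  assumes "0 \<le> q" "0 < u" "0 < \<delta>"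
  shows "(LINT z|disc_area. cmod z powr q * annulus u \<delta> (cmod z) * \<omega> (cmod z)) \<le> exp (- q * u - b * (u + \<delta>) powr (- B))"
proof -
  have "(LINT z|disc_area. cmod z powr q * annulus u \<delta> (cmod z) * \<omega> (cmod z)) \<le>
      (LINT z|disc_area. exp (- q * u - b * (u + \<delta>) powr (- B)))"
  proof (intro integral_mono integrable_powr_annulus assms)
    fix z assume z: "z \<in> space disc_area"
    show "cmod z powr q * annulus u \<delta> (cmod z) * \<omega> (cmod z) \<le> exp (- q * u - b * (u + \<delta>) powr (- B))"
    proof (cases "cmod z \<in> {exp (- (u + \<delta>))..<exp (- u)}")
      case True
      have z0: "0 < cmod z" using True by (auto intro: less_le_trans)
      define t where "t = - ln (cmod z)"
      have t: "cmod z = exp (- t)" using z0 by (simp add: t_def)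
      have tu: "u \<le> t" "t \<le> u + \<delta>" using True by (auto simp: t)
      have "cmod z powr q = exp (- q * t)" by (simp add: t powr_def)
      also have "\<dots> \<le> exp (- q * u)" using tu assms by (simp add: mult_left_mono)
      finally have 1: "cmod z powr q \<le> exp (- q * u)" .
      have "\<omega> (cmod z) \<le> exp (- (b * t powr (- B)))"
        using weight_le[of t] tu assms by (simp add: t)
      also have "(u + \<delta>) powr (- B) \<le> t powr (- B)"
        using tu assms B_pos by (intro powr_mono2') auto
      then have "exp (- (b * t powr (- B))) \<le> exp (- (b * (u + \<delta>) powr (- B)))"
        using b_pos by simp
      finally have 2: "\<omega> (cmod z) \<le> exp (- (b * (u + \<delta>) powr (- B)))" .
      have "cmod z powr q * \<omega> (cmod z) \<le> exp (- q * u) * exp (- (b * (u + \<delta>) powr (- B)))"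
        using 1 2 weight_nonneg[of z] z by (intro mult_mono) auto
      also have "\<dots> = exp (- q * u - b * (u + \<delta>) powr (- B))" by (simp flip: exp_add)
      finally show ?thesis using True by (simp add: annulus_def)
    qed (simp add: annulus_def)
  qed simp
  then show ?thesis using disc_area.prob_space by simp
qed

lemma integral_powr_ge:
  assumes "0 \<le> q" "0 < u" "0 < \<delta>"
  shows "c * (2 * \<delta>) * exp (- 2 * (u + \<delta>) - q * (u + \<delta>) - b * u powr (- B)) \<le>
    (LINT z|disc_area. cmod z powr q * \<omega> (cmod z))"
proof (rule order.trans[OF annulus_integral_ge[OF assms]], intro integral_mono integrable_powr_annulus assms)
  fix z assume "z \<in> space disc_area"
  then show "cmod z powr q * annulus u \<delta> (cmod z) * \<omega> (cmod z) \<le> cmod z powr q * \<omega> (cmod z)"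
    using weight_nonneg[of z] annulus_bounds[of u \<delta> "cmod z"]
    by (intro mult_right_mono mult_left_le) auto
qed

text \<open>The supremum of the integrand over a disc of total area 1. Without the area density the
  frequency is 2 n, and the missing width factor is only logarithmic in the exponent.\<close>

lemma moment_le:
  assumes "0 < n"
  shows "moment n \<le> exp (- phase (2 * real n) (saddle (2 * real n)))"
proof -
  have "moment n \<le> (LINT z|disc_area. exp (- phase (2 * real n) (saddle (2 * real n))))"
    unfolding moment_def
  proof (intro integral_mono_AE integrable_moment AE_disc_areaI)
    fix z assume z: "z \<in> unit_disc" "z \<noteq> 0"
    define t where "t = - ln (cmod z)"
    have t: "cmod z = exp (- t)" "0 < t" using z by (auto simp: t_def)
    have "cmod z ^ (2 * n) * \<omega> (cmod z) \<le> exp (- t) ^ (2 * n) * exp (- (b * t powr (- B)))"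
      using weight_le[OF t(2)] by (simp add: t(1))
    also have "\<dots> = exp (- phase (2 * real n) t)"
      by (simp add: phase_def algebra_simps flip: exp_of_nat_mult exp_add)
    also have "\<dots> \<le> exp (- phase (2 * real n) (saddle (2 * real n)))"
      using phase_saddle_le[of "2 * real n" t] t assms by simp
    finally show "cmod z ^ (2 * n) * \<omega> (cmod z) \<le> exp (- phase (2 * real n) (saddle (2 * real n)))" .
  qed simp
  then show ?thesis using disc_area.prob_space by simp
qed

text \<open>A radial truncation of z^n is orthogonal to all other monomials, so the projection
  returns a multiple of z^n on the whole disc.\<close>

lemma bergman_projection_monomial:
  assumes [measurable]: "h \<in> borel_measurable borel" and h: "\<And>x. 0 \<le> h x" "\<And>x. h x \<le> 1" and z: "z \<in> unit_disc"
  shows "bergman_projection (radial \<omega>) (\<lambda>w. w ^ n * of_real (h (cmod w))) z =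
    z ^ n / of_real (moment n) * of_real (LINT w|disc_area. cmod w ^ (2 * n) * h (cmod w) * \<omega> (cmod w))"
proof -
  have "integrable disc_area (\<lambda>w. cmod (w ^ n * of_real (h (cmod w))) * of_real (\<omega> (cmod w)))"
  proof (rule integrable_bounded_mult_weight[where C = 1])
    show "norm (cmod (w ^ n * of_real (h (cmod w)))) \<le> 1" if "w \<in> unit_disc" for w
      using h that by (auto simp: norm_mult norm_power intro!: mult_le_one power_le_one)
  qed (auto intro: borel_measurable_disc_area)
  then have "(\<lambda>k. z ^ k / of_real (moment k) * (LINT w|disc_area. w ^ n * of_real (h (cmod w)) * cnj w ^ k * of_real (\<omega> (cmod w))))
    sums (LINT w|disc_area. w ^ n * of_real (h (cmod w)) * cnj (kernel (cnj z * w)) * of_real (\<omega> (cmod w)))"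
    using z by (intro integral_kernel_sums) auto
  moreover have "(\<lambda>k. z ^ k / of_real (moment k) * (LINT w|disc_area. w ^ n * of_real (h (cmod w)) * cnj w ^ k * of_real (\<omega> (cmod w)))) =
     (\<lambda>k. if k = n then z ^ k / of_real (moment k) * of_real (LINT w|disc_area. cmod w ^ (2 * k) * h (cmod w) * \<omega> (cmod w)) else 0)"
    by (simp add: fun_eq_iff integral_monomial[OF assms(1) h])
  ultimately show ?thesis
    unfolding bergman_projection_eq[OF z]
    using sums_single[of n "\<lambda>k. z ^ k / of_real (moment k) * of_real (LINT w|disc_area. cmod w ^ (2 * k) * h (cmod w) * \<omega> (cmod w))"]
    by (auto intro: sums_unique2)
qed

end

lemma necessary_norm_inequality:
  assumes "exponential_weight \<omega> b B c" "exponential_weight \<nu> d A c'" and p: "1 < p"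
    and bounded: "bergman_projection_bounded (radial \<omega>) p (radial \<nu>)"
  obtains C where "0 < C" "\<And>n u \<delta>. 0 < n \<Longrightarrow>
    (LINT z|disc_area. cmod z powr (2 * real n) * annulus u \<delta> (cmod z) * \<omega> (cmod z)) / radial_weight.moment \<omega> n *
      (LINT z|disc_area. cmod z powr (real n * p) * \<nu> (cmod z)) powr (1 / p) \<le>
    C * (LINT z|disc_area. cmod z powr (real n * p) * annulus u \<delta> (cmod z) * \<nu> (cmod z)) powr (1 / p)"
proof -
  interpret w: exponential_weight \<omega> b B c by fact
  interpret v: exponential_weight \<nu> d A c' by fact
  obtain C where C: "\<And>f. f \<in> weighted_Lp p (radial \<nu>) \<Longrightarrow>
      weighted_Lp_norm p (radial \<nu>) (bergman_projection (radial \<omega>) f) \<le> C * weighted_Lp_norm p (radial \<nu>) f"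
    using bounded by (auto simp: bergman_projection_bounded_def)
  show ?thesis
  \<comment> \<open>Positivity makes the logarithm of the constant available later.\<close>
  proof (rule that[of "max C 1"])
    fix n :: nat and u \<delta> :: real assume n: "0 < n"
    define f where "f w = w ^ n * of_real (annulus u \<delta> (cmod w))" for w :: complex
    define M where "M = (LINT z|disc_area. cmod z powr (2 * real n) * annulus u \<delta> (cmod z) * \<omega> (cmod z))"
    have M: "M = (LINT z|disc_area. cmod z ^ (2 * n) * annulus u \<delta> (cmod z) * \<omega> (cmod z))"
      unfolding M_def
    proof (intro integral_cong_AE)
      show "AE z in disc_area. cmod z powr (2 * real n) * annulus u \<delta> (cmod z) * \<omega> (cmod z) = cmod z ^ (2 * n) * annulus u \<delta> (cmod z) * \<omega> (cmod z)"
        by (rule AE_disc_areaI) (simp flip: powr_realpow)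
    qed measurable
    have M_nonneg: "0 \<le> M"
      unfolding M using w.weight_nonneg annulus_bounds by (intro Bochner_Integration.integral_nonneg) auto
    \<comment> \<open>This uses n > 0: for n = 0 and z = 0 the sides would be 1 and 0, since
      \<open>0 powr 0 = 0\<close>.\<close>
    have powr_eq: "(cmod z ^ n) powr p = cmod z powr (real n * p)" for z :: complex
      using n p by (cases "z = 0") (auto simp: powr_powr simp flip: powr_realpow)
    have f_powr: "cmod (f z) powr p = cmod z powr (real n * p) * annulus u \<delta> (cmod z)" for z
      using p by (auto simp: f_def norm_mult norm_power powr_eq annulus_def indicator_def)
    have f: "f \<in> weighted_Lp p (radial \<nu>)"
    proof -
      have "f \<in> borel_measurable disc_area"
        unfolding f_def by measurable
      then show ?thesis
        using p by (simp add: weighted_Lp_def f_powr radial_def v.integrable_powr_annulus)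
    qed
    have Pf: "bergman_projection (radial \<omega>) f z = z ^ n * of_real (M / w.moment n)" if "z \<in> unit_disc" for z
      using w.bergman_projection_monomial[OF borel_measurable_annulus annulus_bounds that, of n u \<delta>]
      by (simp add: f_def[abs_def] M)
    have "(LINT z|disc_area. cmod (bergman_projection (radial \<omega>) f z) powr p * radial \<nu> z) =
        (LINT z|disc_area. (M / w.moment n) powr p * (cmod z powr (real n * p) * \<nu> (cmod z)))"
    proof (rule Bochner_Integration.integral_cong)
      fix z assume z: "z \<in> space disc_area"
      have "cmod (z ^ n * of_real (M / w.moment n)) = cmod z ^ n * (M / w.moment n)"
        using M_nonneg w.moment_pos[of n] by (simp add: norm_mult norm_power norm_divide)
      moreover have "(cmod z ^ n * (M / w.moment n)) powr p = cmod z powr (real n * p) * (M / w.moment n) powr p"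
        unfolding powr_eq[symmetric] by (rule powr_mult)
      moreover have "bergman_projection (radial \<omega>) f z = z ^ n * of_real (M / w.moment n)"
        using z by (intro Pf) simp
      ultimately show "cmod (bergman_projection (radial \<omega>) f z) powr p * radial \<nu> z = (M / w.moment n) powr p * (cmod z powr (real n * p) * \<nu> (cmod z))"
        by (simp only: radial_def mult_ac)
    qed simp
    also have "\<dots> = (M / w.moment n) powr p * (LINT z|disc_area. cmod z powr (real n * p) * \<nu> (cmod z))"
      by simp
    finally have norm_P: "weighted_Lp_norm p (radial \<nu>) (bergman_projection (radial \<omega>) f) =
        M / w.moment n * (LINT z|disc_area. cmod z powr (real n * p) * \<nu> (cmod z)) powr (1 / p)"
    proof -
      assume *: "(LINT z|disc_area. cmod (bergman_projection (radial \<omega>) f z) powr p * radial \<nu> z) =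
        (M / w.moment n) powr p * (LINT z|disc_area. cmod z powr (real n * p) * \<nu> (cmod z))"
      have "0 \<le> (LINT z|disc_area. cmod z powr (real n * p) * \<nu> (cmod z))"
        using v.weight_nonneg by (intro Bochner_Integration.integral_nonneg) simp
      then show ?thesis
        using M_nonneg w.moment_pos[of n] p by (simp add: weighted_Lp_norm_def * powr_mult powr_powr)
    qed
    have norm_f: "weighted_Lp_norm p (radial \<nu>) f = (LINT z|disc_area. cmod z powr (real n * p) * annulus u \<delta> (cmod z) * \<nu> (cmod z)) powr (1 / p)"
      by (simp add: weighted_Lp_norm_def f_powr radial_def)
    have "C * weighted_Lp_norm p (radial \<nu>) f \<le> max C 1 * weighted_Lp_norm p (radial \<nu>) f"
      by (intro mult_right_mono) (auto simp: weighted_Lp_norm_def)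
    with C[OF f] show "M / w.moment n * (LINT z|disc_area. cmod z powr (real n * p) * \<nu> (cmod z)) powr (1 / p) \<le>
      max C 1 * (LINT z|disc_area. cmod z powr (real n * p) * annulus u \<delta> (cmod z) * \<nu> (cmod z)) powr (1 / p)"
      unfolding norm_P norm_f by linarith
  qed simp
qed

text \<open>The test function \<open>z ^ n\<close> on a thin annulus at \<open>t = \<theta> (1 + \<eta>)\<close> is compared with the norm of
  \<open>z ^ n\<close> seen at the reflected point \<open>\<theta> (1 - \<eta>)\<close>, so that all terms linear in \<open>n\<close> cancel. The
  thickness \<open>\<theta> powr (B + 2)\<close> keeps the remaining errors logarithmic.\<close>

lemma necessary_inequality:
  assumes "exponential_weight \<omega> b B c" "exponential_weight \<nu> d A c'" and p: "1 < p"
    and bounded: "bergman_projection_bounded (radial \<omega>) p (radial \<nu>)"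
  obtains K where "\<And>n \<theta> \<eta>. 0 < n \<Longrightarrow> \<theta> = exponential_parameters.saddle b B (2 * real n) \<Longrightarrow> \<theta> \<le> 1 \<Longrightarrow>
    -1 < \<eta> \<Longrightarrow> \<eta> < 1 \<Longrightarrow>
    b * (\<theta> powr (- B) * (1 - (1 + \<eta>) powr (- B))) \<le>
    d / p * (\<theta> powr (- A) * ((1 - \<eta>) powr (- A) - (1 + \<eta> + \<theta> powr (B + 1)) powr (- A))) +
      K - (1 + 1 / p) * (B + 2) * ln \<theta>"
proof -
  interpret w: exponential_weight \<omega> b B c by fact
  interpret v: exponential_weight \<nu> d A c' by fact
  obtain C where C: "0 < C" "\<And>n u \<delta>. 0 < n \<Longrightarrow>
    (LINT z|disc_area. cmod z powr (2 * real n) * annulus u \<delta> (cmod z) * \<omega> (cmod z)) / w.moment n *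
      (LINT z|disc_area. cmod z powr (real n * p) * \<nu> (cmod z)) powr (1 / p) \<le>
    C * (LINT z|disc_area. cmod z powr (real n * p) * annulus u \<delta> (cmod z) * \<nu> (cmod z)) powr (1 / p)"
    using necessary_norm_inequality[OF assms] by blast
  \<comment> \<open>6 and 6 / p bound 2 (t1 + \<delta>) and 2 (t2 + \<delta>) / p, as t1 and t2 are
    at most 2 and \<delta> at most 1. The last term pays for the errors 2 n \<delta> and n \<delta>
    due to the thickness, through 2 n \<delta> \<le> b B.\<close>
  define K where "K = ln C - ln (2 * c) - ln (2 * c') / p + 6 + 6 / p + 3 / 2 * (b * B)"
  show ?thesis
  proof (rule that[of K])
    fix n :: nat and \<theta> \<eta> :: real
    assume n: "0 < n" and \<theta>_def: "\<theta> = w.saddle (2 * real n)" and \<theta>1: "\<theta> \<le> 1" and \<eta>: "-1 < \<eta>" "\<eta> < 1"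
    have \<theta>: "0 < \<theta>" using n w.saddle_pos[of "2 * real n"] by (simp add: \<theta>_def)
    define \<delta> t1 t2 where "\<delta> = \<theta> powr (B + 2)" and "t1 = \<theta> * (1 + \<eta>)" and "t2 = \<theta> * (1 - \<eta>)"
    have \<delta>: "0 < \<delta>" "\<delta> \<le> 1" using \<theta> \<theta>1 w.B_pos by (auto simp: \<delta>_def intro!: powr_le1)
    have t1: "0 < t1" "t1 \<le> 2" using \<theta> \<theta>1 \<eta> mult_mono[of \<theta> 1 "1 + \<eta>" 2] by (auto simp: t1_def)
    have t2: "0 < t2" "t2 \<le> 2" using \<theta> \<theta>1 \<eta> mult_mono[of \<theta> 1 "1 - \<eta>" 2] by (auto simp: t2_def)
    define \<phi> where "\<phi> = w.phase (2 * real n) \<theta>"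
    define LM where "LM = ln (2 * c * \<delta>) - 2 * (t1 + \<delta>) - 2 * real n * (t1 + \<delta>) - b * t1 powr (- B)"
    define LI where "LI = ln (2 * c' * \<delta>) - 2 * (t2 + \<delta>) - real n * p * (t2 + \<delta>) - d * t2 powr (- A)"
    define LJ where "LJ = - (real n * p) * t1 - d * (t1 + \<delta>) powr (- A)"
    define M I J where "M = (LINT z|disc_area. cmod z powr (2 * real n) * annulus t1 \<delta> (cmod z) * \<omega> (cmod z))"
      and "I = (LINT z|disc_area. cmod z powr (real n * p) * \<nu> (cmod z))"
      and "J = (LINT z|disc_area. cmod z powr (real n * p) * annulus t1 \<delta> (cmod z) * \<nu> (cmod z))"
    have LM: "exp LM \<le> M"
    proof -
      have "exp LM = c * (2 * \<delta>) * exp (- 2 * (t1 + \<delta>) - 2 * real n * (t1 + \<delta>) - b * t1 powr (- B))"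
      proof -
        have "LM = ln (2 * c * \<delta>) + (- 2 * (t1 + \<delta>) - 2 * real n * (t1 + \<delta>) - b * t1 powr (- B))"
          by (simp add: LM_def)
        then have "exp LM = exp (ln (2 * c * \<delta>)) * exp (- 2 * (t1 + \<delta>) - 2 * real n * (t1 + \<delta>) - b * t1 powr (- B))"
          by (simp only: exp_add)
        then show ?thesis
          using w.c_pos \<delta> by simp
      qed
      also have "\<dots> \<le> M"
        unfolding M_def using t1 \<delta> by (intro w.annulus_integral_ge) auto
      finally show ?thesis .
    qed
    have LI: "exp LI \<le> I"
    proof -
      have "exp LI = c' * (2 * \<delta>) * exp (- 2 * (t2 + \<delta>) - real n * p * (t2 + \<delta>) - d * t2 powr (- A))"
      proof -
        have "LI = ln (2 * c' * \<delta>) + (- 2 * (t2 + \<delta>) - real n * p * (t2 + \<delta>) - d * t2 powr (- A))"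
          by (simp add: LI_def)
        then have "exp LI = exp (ln (2 * c' * \<delta>)) * exp (- 2 * (t2 + \<delta>) - real n * p * (t2 + \<delta>) - d * t2 powr (- A))"
          by (simp only: exp_add)
        then show ?thesis
          using v.c_pos \<delta> by simp
      qed
      also have "\<dots> \<le> I"
        unfolding I_def using t2 \<delta> p by (intro v.integral_powr_ge) auto
      finally show ?thesis .
    qed
    have LJ: "J \<le> exp LJ" "0 \<le> J"
    proof -
      show "J \<le> exp LJ"
        unfolding J_def LJ_def using t1 \<delta> p by (intro v.annulus_integral_le) auto
      show "0 \<le> J"
        unfolding J_def using v.weight_nonneg annulus_bounds by (intro Bochner_Integration.integral_nonneg) auto
    qed
    have M: "0 \<le> M" by (rule order.trans[OF exp_ge_zero LM])
    have "exp (LM + \<phi> + LI / p) = exp LM / exp (- \<phi>) * exp LI powr (1 / p)"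
      by (simp add: powr_def exp_add exp_minus field_simps)
    also have "\<dots> \<le> M / w.moment n * I powr (1 / p)"
    proof (intro mult_mono frac_le powr_mono2)
      show "w.moment n \<le> exp (- \<phi>)"
        using w.moment_le[OF n] by (simp add: \<phi>_def \<theta>_def)
    qed (use M LM LI w.moment_pos[of n] p in \<open>auto intro: order.trans[OF exp_ge_zero]\<close>)
    also have "\<dots> \<le> C * J powr (1 / p)"
      unfolding M_def I_def J_def by (rule C(2)[OF n])
    also have "\<dots> \<le> C * exp LJ powr (1 / p)"
      using C(1) LJ p by (intro mult_left_mono powr_mono2) auto
    also have "\<dots> = exp (ln C + LJ / p)"
      using C(1) by (simp add: powr_def exp_add)
    finally have ineq: "LM + \<phi> + LI / p \<le> ln C + LJ / p"
      by simp
    have ln1: "ln (2 * c * \<delta>) = ln (2 * c) + (B + 2) * ln \<theta>" "ln (2 * c' * \<delta>) = ln (2 * c') + (B + 2) * ln \<theta>"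
      using w.c_pos v.c_pos \<theta> \<delta> by (simp_all add: ln_mult_pos \<delta>_def ln_powr)
    have n_eq: "2 * real n = b * B * \<theta> powr (- B - 1)"
      using w.saddle_powr[of "2 * real n"] n by (simp add: \<theta>_def)
    have n_\<delta>: "2 * real n * \<delta> \<le> b * B"
    proof -
      have "2 * real n * \<delta> = b * B * (\<theta> powr (- B - 1) * \<theta> powr (B + 2))"
        by (simp only: n_eq \<delta>_def mult.assoc)
      also have "\<theta> powr (- B - 1) * \<theta> powr (B + 2) = \<theta>"
        using \<theta> by (simp flip: powr_add)
      also have "b * B * \<theta> \<le> b * B * 1"
        using \<theta>1 w.b_pos w.B_pos by (intro mult_left_mono) auto
      finally show ?thesis by simp
    qed
    have LI_div: "LI / p = ln (2 * c' * \<delta>) / p - 2 * (t2 + \<delta>) / p - real n * (t2 + \<delta>) - d / p * t2 powr (- A)"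
      using p by (simp add: LI_def diff_divide_distrib)
    have LJ_div: "LJ / p = - real n * t1 - d / p * (t1 + \<delta>) powr (- A)"
      using p by (simp add: LJ_def diff_divide_distrib)
    have lin: "real n * (2 * \<theta> - t1 - t2) = 0" by (simp add: t1_def t2_def algebra_simps)
    have div2: "2 * (t2 + \<delta>) / p \<le> 6 / p" using t2 \<delta> p by (intro divide_right_mono) auto
    have "b * \<theta> powr (- B) - b * t1 powr (- B) \<le> d / p * t2 powr (- A) - d / p * (t1 + \<delta>) powr (- A) + ln C
        - ln (2 * c * \<delta>) - ln (2 * c' * \<delta>) / p + 2 * (t1 + \<delta>) + 2 * (t2 + \<delta>) / p + 3 / 2 * (2 * real n * \<delta>)
        - real n * (2 * \<theta> - t1 - t2)"
      using ineq unfolding LI_div LJ_div LM_def \<phi>_def w.phase_def by (simp add: algebra_simps)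
    also have "\<dots> \<le> d / p * t2 powr (- A) - d / p * (t1 + \<delta>) powr (- A) + K - (1 + 1 / p) * (B + 2) * ln \<theta>"
    proof -
      define q N where "q = (B + 2) * ln \<theta>" and "N = 2 * real n * \<delta>"
      have 1: "ln (2 * c' * \<delta>) / p = ln (2 * c') / p + q / p"
        by (simp add: ln1 add_divide_distrib q_def)
      have 2: "(1 + 1 / p) * (B + 2) * ln \<theta> = q + q / p"
        unfolding q_def mult.assoc[of "1 + 1 / p"] by (simp only: distrib_right) simp
      have 3: "ln (2 * c * \<delta>) = ln (2 * c) + q"
        by (simp add: ln1 q_def)
      have "X - (l + q) - (l' + r) + 2 * (t1 + \<delta>) + D + 3 / 2 * N - 0 \<le> X - l - l' + 6 + e + 3 / 2 * y - (q + r)"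
        if "D \<le> e" "N \<le> y" for X l l' r D e y :: real
        using that t1(2) \<delta>(2) by (simp add: algebra_simps)
      from this[OF div2 n_\<delta>[folded N_def], of "d / p * t2 powr (- A) - d / p * (t1 + \<delta>) powr (- A) + ln C" "ln (2 * c)" "ln (2 * c') / p" "q / p"]
      show ?thesis
        unfolding 1 2 3 lin K_def N_def by simp
    qed
    finally have main: "b * \<theta> powr (- B) - b * t1 powr (- B) \<le> d / p * t2 powr (- A) - d / p * (t1 + \<delta>) powr (- A) + K - (1 + 1 / p) * (B + 2) * ln \<theta>" .
    have "\<delta> = \<theta> * \<theta> powr (B + 1)"
    proof -
      have "\<theta> * \<theta> powr (B + 1) = \<theta> powr 1 * \<theta> powr (B + 1)" using \<theta> by simp
      also have "\<dots> = \<theta> powr (1 + (B + 1))" by (rule powr_add[symmetric])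
      finally show ?thesis by (simp add: \<delta>_def add.commute)
    qed
    then have "t1 + \<delta> = \<theta> * (1 + \<eta> + \<theta> powr (B + 1))"
      by (simp add: t1_def algebra_simps)
    then have "(t1 + \<delta>) powr (- A) = \<theta> powr (- A) * (1 + \<eta> + \<theta> powr (B + 1)) powr (- A)"
      using \<theta> \<eta> by (simp add: powr_mult)
    moreover have "t1 powr (- B) = \<theta> powr (- B) * (1 + \<eta>) powr (- B)" "t2 powr (- A) = \<theta> powr (- A) * (1 - \<eta>) powr (- A)"
      using \<theta> \<eta> by (simp_all add: t1_def t2_def powr_mult)
    ultimately show "b * (\<theta> powr (- B) * (1 - (1 + \<eta>) powr (- B))) \<le>
      d / p * (\<theta> powr (- A) * ((1 - \<eta>) powr (- A) - (1 + \<eta> + \<theta> powr (B + 1)) powr (- A))) + K - (1 + 1 / p) * (B + 2) * ln \<theta>"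
      using main by (simp only: right_diff_distrib mult_1_right)
  qed
qed

section \<open>The limit of large frequency\<close>

lemma tendsto_powr_at_right_0:
  fixes a :: real
  assumes "0 \<le> a"
  shows "((\<lambda>x. x powr a) \<longlongrightarrow> (if a = 0 then 1 else 0)) (at_right 0)"
proof (cases "a = 0")
  case True
  have "eventually (\<lambda>x::real. x powr a = 1) (at_right 0)"
    using eventually_at_right_less[of "0::real"] by (auto simp: True elim!: eventually_mono)
  then show ?thesis using True by (simp add: tendsto_eventually)
next
  case False
  then have "0 < a" using assms by simp
  then have "((\<lambda>x. x powr a) \<longlongrightarrow> 0) (at_right 0)" by real_asymp
  then show ?thesis using False by simp
qed

text \<open>After multiplication by \<theta>^L with L = max A B, a side survives as \<theta> tends
  to 0 exactly when its exponent is the larger one, or both are equal. The constant and logarithmic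
  errors vanish in every case.\<close>

lemma necessary_limit_inequality:
  assumes "exponential_weight \<omega> b B c" "exponential_weight \<nu> d A c'" and p: "1 < p"
    and bounded: "bergman_projection_bounded (radial \<omega>) p (radial \<nu>)" and \<eta>: "-1 < \<eta>" "\<eta> < 1"
  shows "(if A \<le> B then b * (1 - (1 + \<eta>) powr (- B)) else 0) \<le>
    (if B \<le> A then d / p * ((1 - \<eta>) powr (- A) - (1 + \<eta>) powr (- A)) else 0)"
proof -
  interpret w: exponential_weight \<omega> b B c by fact
  interpret v: exponential_weight \<nu> d A c' by fact
  define L where "L = max A B"
  have L: "0 < L" "0 \<le> L - A" "0 \<le> L - B" using w.B_pos by (auto simp: L_def)
  obtain K where K: "\<And>n \<theta> \<eta>. 0 < n \<Longrightarrow> \<theta> = w.saddle (2 * real n) \<Longrightarrow> \<theta> \<le> 1 \<Longrightarrow>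
    -1 < \<eta> \<Longrightarrow> \<eta> < 1 \<Longrightarrow>
    b * (\<theta> powr (- B) * (1 - (1 + \<eta>) powr (- B))) \<le>
    d / p * (\<theta> powr (- A) * ((1 - \<eta>) powr (- A) - (1 + \<eta> + \<theta> powr (B + 1)) powr (- A))) +
      K - (1 + 1 / p) * (B + 2) * ln \<theta>"
    using necessary_inequality[OF assms(1-4)] by blast
  define F where "F \<theta> = \<theta> powr (L - B) * (b * (1 - (1 + \<eta>) powr (- B)))" for \<theta>
  define G where "G \<theta> = \<theta> powr (L - A) * (d / p * ((1 - \<eta>) powr (- A) - (1 + \<eta> + \<theta> powr (B + 1)) powr (- A))) +
      K * \<theta> powr L - (1 + 1 / p) * (B + 2) * (\<theta> powr L * ln \<theta>)" for \<theta>
  have lim_theta: "filterlim (\<lambda>n. w.saddle (2 * real n)) (at_right 0) sequentially"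
  proof (rule tendsto_imp_filterlim_at_right)
    have "(\<lambda>n. b * B / (2 * real n)) \<longlonglongrightarrow> 0"
      by real_asymp
    then show "(\<lambda>n. w.saddle (2 * real n)) \<longlonglongrightarrow> 0"
      unfolding w.saddle_def using w.b_pos w.B_pos
      by (intro tendsto_zero_powrI[OF _ tendsto_const]) (auto intro!: always_eventually)
    show "eventually (\<lambda>n. 0 < w.saddle (2 * real n)) sequentially"
      using eventually_gt_at_top[of "0::nat"] by eventually_elim (simp add: w.saddle_pos)
  qed
  have limF: "(F \<longlongrightarrow> (if L - B = 0 then 1 else 0) * (b * (1 - (1 + \<eta>) powr (- B)))) (at_right 0)"
    unfolding F_def by (intro tendsto_mult tendsto_const tendsto_powr_at_right_0 L)
  have limG: "(G \<longlongrightarrow> (if L - A = 0 then 1 else 0) * (d / p * ((1 - \<eta>) powr (- A) - (1 + \<eta> + 0) powr (- A))) +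
      K * 0 - (1 + 1 / p) * (B + 2) * 0) (at_right 0)"
    unfolding G_def
  proof (intro tendsto_add tendsto_diff tendsto_mult tendsto_const tendsto_powr_at_right_0 L tendsto_powr)
    show "((\<lambda>x. x powr (B + 1)) \<longlongrightarrow> 0) (at_right 0)"
      using tendsto_powr_at_right_0[of "B + 1"] w.B_pos by simp
    show "((\<lambda>x. x powr L) \<longlongrightarrow> 0) (at_right 0)"
      using tendsto_powr_at_right_0[of L] L by simp
    show "((\<lambda>x. x powr L * ln x) \<longlongrightarrow> 0) (at_right 0)"
      using L(1) by real_asymp
    show "1 + \<eta> + 0 \<noteq> 0" using \<eta> by simp
  qed
  have ev: "eventually (\<lambda>n. F (w.saddle (2 * real n)) \<le> G (w.saddle (2 * real n))) sequentially"
  proof -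
    have "eventually (\<lambda>\<theta>::real. 0 < \<theta> \<and> \<theta> < 1) (at_right 0)"
      by (auto simp: eventually_at_right_field intro: exI[of _ 1])
    then have "eventually (\<lambda>n. 0 < w.saddle (2 * real n) \<and> w.saddle (2 * real n) < 1) sequentially"
      using lim_theta by (auto simp: filterlim_iff)
    then show ?thesis
      using eventually_gt_at_top[of 0]
    proof eventually_elim
      fix n :: nat assume n: "0 < n"
      define \<theta> where "\<theta> = w.saddle (2 * real n)"
      assume "0 < w.saddle (2 * real n) \<and> w.saddle (2 * real n) < 1"
      then have \<theta>: "0 < \<theta>" "\<theta> \<le> 1" by (auto simp: \<theta>_def)
      have "\<theta> powr L * (b * (\<theta> powr (- B) * (1 - (1 + \<eta>) powr (- B)))) \<le> \<theta> powr L * (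
        d / p * (\<theta> powr (- A) * ((1 - \<eta>) powr (- A) - (1 + \<eta> + \<theta> powr (B + 1)) powr (- A))) +
          K - (1 + 1 / p) * (B + 2) * ln \<theta>)"
        using K[OF n \<theta>_def \<theta>(2) \<eta>] by (intro mult_left_mono) auto
      moreover have "\<theta> powr (L - B) = \<theta> powr L * \<theta> powr (- B)" "\<theta> powr (L - A) = \<theta> powr L * \<theta> powr (- A)"
        by (simp_all flip: powr_add)
      ultimately have "F \<theta> \<le> G \<theta>"
        unfolding F_def G_def by (simp add: algebra_simps)
      then show "F (w.saddle (2 * real n)) \<le> G (w.saddle (2 * real n))" by (simp add: \<theta>_def)
    qed
  qed
  have "(if L - B = 0 then 1 else 0) * (b * (1 - (1 + \<eta>) powr (- B))) \<le>
      (if L - A = 0 then 1 else 0) * (d / p * ((1 - \<eta>) powr (- A) - (1 + \<eta> + 0) powr (- A))) + K * 0 - (1 + 1 / p) * (B + 2) * 0"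
    by (rule tendsto_le[OF _ filterlim_compose[OF limG lim_theta] filterlim_compose[OF limF lim_theta] ev]) simp
  then show ?thesis
    by (auto simp: L_def max_def split: if_splits)
qed

text \<open>If the exponents differ, only one side survives in the limit and a suitable sign of
  \<eta> refutes it: the left side is positive for \<eta> > 0, the right side negative for \<eta> <
  0. If they agree, right side minus left side is nonnegative and vanishes at \<eta> = 0, so its
  derivative 2 d B / p - b B is 0 there.\<close>

theorem bergman_projection_bounded_imp:
  assumes "exponential_weight \<omega> b B c" "exponential_weight \<nu> d A c'" and p: "1 < p"
    and bounded: "bergman_projection_bounded (radial \<omega>) p (radial \<nu>)"
  shows "A = B \<and> b = 2 * d / p"
proof -
  interpret w: exponential_weight \<omega> b B c by fact
  interpret v: exponential_weight \<nu> d A c' by fact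
  note lim = necessary_limit_inequality[OF assms]
  have "\<not> A < B"
  proof
    assume "A < B"
    then have "b * (1 - (1 + 1 / 2) powr (- B)) \<le> 0"
      using lim[of "1 / 2"] by simp
    moreover have "(1 + 1 / 2 :: real) powr (- B) < 1"
      using w.B_pos by (subst powr_less_one) auto
    ultimately show False using w.b_pos by (simp add: mult_le_0_iff)
  qed
  moreover have "\<not> B < A"
  proof
    assume "B < A"
    then have "0 \<le> d / p * ((1 + 1 / 2) powr (- A) - (1 - 1 / 2) powr (- A))"
      using lim[of "- (1 / 2)"] by simp
    moreover have "(1 + 1 / 2 :: real) powr (- A) < (1 - 1 / 2) powr (- A)"
      using v.B_pos by (intro powr_less_mono2_neg) auto
    then have "d / p * ((1 + 1 / 2) powr (- A) - (1 - 1 / 2) powr (- A)) < 0"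
      using v.b_pos p by (intro mult_pos_neg) auto
    ultimately show False by linarith
  qed
  ultimately have "A = B" by simp
  define G where "G \<eta> = d / p * ((1 - \<eta>) powr (- B) - (1 + \<eta>) powr (- B)) - b * (1 - (1 + \<eta>) powr (- B))" for \<eta>
  have D: "(G has_real_derivative (d / p * (2 * B) - b * B)) (at 0)"
    unfolding G_def using p by (auto intro!: derivative_eq_intros)
  have "\<forall>y. \<bar>0 - y\<bar> < 1 \<longrightarrow> G 0 \<le> G y"
    using lim \<open>A = B\<close> by (auto simp: G_def abs_less_iff)
  then have "d / p * (2 * B) - b * B = 0"
    by (rule DERIV_local_min[OF D zero_less_one])
  then have "b = 2 * d / p"
    using w.B_pos p by (simp add: field_simps)
  with \<open>A = B\<close> show ?thesis by simp
qed

theorem bergman_projection_bounded_iff: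
  assumes w: "exponential_weight \<omega> b B c" and v: "exponential_weight \<nu> d A c'" and p: "1 < p"
  shows "bergman_projection_bounded (radial \<omega>) p (radial \<nu>) \<longleftrightarrow> A = B \<and> b = 2 * d / p"
proof
  assume *: "A = B \<and> b = 2 * d / p"
  interpret w: exponential_weight \<omega> b B c by fact
  interpret v: exponential_weight \<nu> d A c' by fact
  have d: "d = b * (p / 2)" using * p by simp
  have bounds: "c' * \<omega> (exp (- t)) powr (p / 2) \<le> \<nu> (exp (- t)) \<and> \<nu> (exp (- t)) \<le> (1 / c) powr (p / 2) * \<omega> (exp (- t)) powr (p / 2)"
    if t: "0 < t" for t
  proof -
    define e where "e = exp (- (b * t powr (- B)))"
    have "exp (- (d * t powr (- A))) = e powr (p / 2)"
      using * by (simp add: e_def powr_def d mult_ac)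
    then have \<nu>: "c' * e powr (p / 2) \<le> \<nu> (exp (- t))" "\<nu> (exp (- t)) \<le> e powr (p / 2)"
      using v.weight_ge[OF t] v.weight_le[OF t] by simp_all
    have \<omega>: "0 < \<omega> (exp (- t))" using t by (intro w.weight_pos) auto
    have "\<omega> (exp (- t)) powr (p / 2) \<le> e powr (p / 2)"
      using w.weight_le[OF t] \<omega> p by (intro powr_mono2) (auto simp: e_def)
    then have 1: "c' * \<omega> (exp (- t)) powr (p / 2) \<le> c' * e powr (p / 2)"
      using v.c_pos by simp
    have "e \<le> 1 / c * \<omega> (exp (- t))"
      using w.weight_ge[OF t] w.c_pos by (simp add: e_def field_simps)
    then have "e powr (p / 2) \<le> (1 / c * \<omega> (exp (- t))) powr (p / 2)"
      using p by (intro powr_mono2) (auto simp: e_def)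
    also have "\<dots> = (1 / c) powr (p / 2) * \<omega> (exp (- t)) powr (p / 2)"
      by (rule powr_mult)
    finally show ?thesis using 1 \<nu> by linarith
  qed
  show "bergman_projection_bounded (radial \<omega>) p (radial \<nu>)"
  proof (rule w.bergman_projection_bounded_if_comparable[OF p v.borel_measurable_weight v.c_pos, of "(1 / c) powr (p / 2)"])
    show "0 < (1 / c) powr (p / 2)" using w.c_pos by simp
    fix r :: real assume "0 < r" "r < 1"
    then show "c' * \<omega> r powr (p / 2) \<le> \<nu> r" "\<nu> r \<le> (1 / c) powr (p / 2) * \<omega> r powr (p / 2)"
      using bounds[of "- ln r"] by auto
  qed
qed (rule bergman_projection_bounded_imp[OF assms])

section \<open>Exponential weights\<close>

text \<open>With x = 1 - exp (- w) one has 1 / x \<le> 1 + 1 / w, and for B \<le> 1 the power B is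
  subadditive. This keeps the error in the exponent bounded and is where the restriction on the
  exponents enters.\<close>

lemma inverse_one_minus_exp_powr:
  fixes w B :: real
  assumes "0 < w" "0 < B" "B \<le> 1"
  shows "w powr (- B) \<le> (1 - exp (- w)) powr (- B)" "(1 - exp (- w)) powr (- B) \<le> 1 + w powr (- B)"
proof -
  define x where "x = 1 - exp (- w)"
  have x: "0 < x" using assms by (simp add: x_def)
  have "1 + - w \<le> exp (- w)" by (rule exp_ge_add_one_self)
  then have "x \<le> w" by (simp add: x_def)
  then show "w powr (- B) \<le> (1 - exp (- w)) powr (- B)"
    unfolding x_def[symmetric] using x assms by (intro powr_mono2') auto
  have "1 + w \<le> exp w" by (rule exp_ge_add_one_self)
  then have "exp (- w) * (1 + w) \<le> 1" by (simp add: exp_minus field_simps)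
  then have "1 / x \<le> 1 + 1 / w"
    using x assms by (simp add: x_def field_simps)
  then have "(1 / x) powr B \<le> (1 + 1 / w) powr B"
    using x assms by (intro powr_mono2) auto
  also have "(1 + 1 / w) powr B = (1 + 1 / w) powr (B - 1) + 1 / w * (1 + 1 / w) powr (B - 1)"
  proof -
    have "(1 + 1 / w) powr B = (1 + 1 / w) powr 1 * (1 + 1 / w) powr (B - 1)"
      by (simp only: powr_add[symmetric]) simp
    also have "(1 + 1 / w) powr 1 = 1 + 1 / w" using assms by simp
    finally show ?thesis by (simp only: distrib_right mult_1)
  qed
  also have "\<dots> \<le> 1 + 1 / w * (1 / w) powr (B - 1)"
  proof (intro add_mono mult_left_mono)
    show "(1 + 1 / w) powr (B - 1) \<le> 1"
      using assms powr_mono[of "B - 1" 0 "1 + 1 / w"] add_pos_pos[of 1 "1 / w"] by simp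
    show "(1 + 1 / w) powr (B - 1) \<le> (1 / w) powr (B - 1)"
      using assms powr_mono2'[of "B - 1" "1 / w" "1 + 1 / w"] by simp
  qed (use assms in simp)
  also have "1 / w * (1 / w) powr (B - 1) = (1 / w) powr B"
  proof -
    have "(1 / w) powr 1 * (1 / w) powr (B - 1) = (1 / w) powr (1 + (B - 1))" by (rule powr_add[symmetric])
    then show ?thesis using assms by simp
  qed
  finally show "(1 - exp (- w)) powr (- B) \<le> 1 + w powr (- B)"
    using x assms by (simp add: powr_divide powr_minus_divide x_def)
qed

text \<open>Since r^l = exp (- l t), the leading exponent is \<alpha> (l t)^(-\<beta>); the additive
  error 1 becomes the factor exp (- \<alpha>).\<close>

lemma exponential_weightI:
  fixes \<omega> :: "real \<Rightarrow> real"
  assumes par: "0 < \<alpha>" "0 < l" "0 < \<beta>" "\<beta> \<le> 1"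
    and \<omega>: "\<And>r. 0 \<le> r \<Longrightarrow> r < 1 \<Longrightarrow> \<omega> r = exp (- (\<alpha> / (1 - r powr l) powr \<beta>))"
  shows "exponential_weight \<omega> (\<alpha> / l powr \<beta>) \<beta> (exp (- \<alpha>))"
proof
  have "(\<lambda>z. exp (- (\<alpha> / (1 - cmod z powr l) powr \<beta>))) \<in> borel_measurable disc_area"
    by measurable
  then show meas: "(\<lambda>z. \<omega> (cmod z)) \<in> borel_measurable disc_area"
    by (rule measurable_cong[THEN iffD2, rotated]) (simp add: \<omega>)
  show "integrable disc_area (\<lambda>z. \<omega> (cmod z))"
    using par meas by (intro disc_area.integrable_const_bound[where B = 1] AE_I2) (auto simp: \<omega>)
  show "0 < \<omega> r" if "0 \<le> r" "r < 1" for r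
    using that by (simp add: \<omega>)
  show "0 < \<alpha> / l powr \<beta>" using par by simp
  fix t :: real assume t: "0 < t"
  have eq: "\<omega> (exp (- t)) = exp (- (\<alpha> * (1 - exp (- (l * t))) powr (- \<beta>)))"
    using t by (simp add: \<omega> powr_def[of "exp (- t)"] powr_minus_divide)
  have eq': "\<alpha> / l powr \<beta> * t powr (- \<beta>) = \<alpha> * (l * t) powr (- \<beta>)"
    using par t by (simp add: powr_mult powr_minus_divide)
  have b: "(l * t) powr (- \<beta>) \<le> (1 - exp (- (l * t))) powr (- \<beta>)" "(1 - exp (- (l * t))) powr (- \<beta>) \<le> 1 + (l * t) powr (- \<beta>)"
    using inverse_one_minus_exp_powr[of "l * t" \<beta>] par t by auto
  show "\<omega> (exp (- t)) \<le> exp (- (\<alpha> / l powr \<beta> * t powr (- \<beta>)))"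
    unfolding eq eq' using b par by simp
  have "\<alpha> * (1 - exp (- (l * t))) powr (- \<beta>) \<le> \<alpha> * (1 + (l * t) powr (- \<beta>))"
    using b par by (intro mult_left_mono) auto
  then show "exp (- \<alpha>) * exp (- (\<alpha> / l powr \<beta> * t powr (- \<beta>))) \<le> \<omega> (exp (- t))"
    unfolding eq eq' by (simp add: distrib_left flip: exp_add)
qed (use par in simp_all)

theorem theorem6:
  fixes p \<alpha> \<alpha>' l l' \<beta> \<beta>' :: real
    and \<nu> \<omega> :: "real \<Rightarrow> real"
  assumes "1 < p"
    and "0 < \<alpha>" and "0 < \<alpha>'" and "0 < l" and "0 < l'"
    and "0 < \<beta>" and "\<beta> \<le> 1" and "0 < \<beta>'" and "\<beta>' \<le> 1"
    and "\<And>r. 0 \<le> r \<Longrightarrow> r < 1 \<Longrightarrow> \<nu> r = exp (- (\<alpha> / (1 - r powr l) powr \<beta>))"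
    and "\<And>r. 0 \<le> r \<Longrightarrow> r < 1 \<Longrightarrow> \<omega> r = exp (- (\<alpha>' / (1 - r powr l') powr \<beta>'))"
  shows "bergman_projection_bounded (radial \<omega>) p (radial \<nu>) \<longleftrightarrow>
         \<beta> = \<beta>' \<and> \<alpha>' = 2 * \<alpha> / p * (l' / l) powr \<beta>"
proof -
  have w: "exponential_weight \<omega> (\<alpha>' / l' powr \<beta>') \<beta>' (exp (- \<alpha>'))"
    by (rule exponential_weightI) (use assms in auto)
  have v: "exponential_weight \<nu> (\<alpha> / l powr \<beta>) \<beta> (exp (- \<alpha>))"
    by (rule exponential_weightI) (use assms in auto)
  \<comment> \<open>Rewrites \<open>b = 2 * d / p\<close> in the original parameters, once the
    exponents are known to agree.\<close>
  have "\<alpha>' / l' powr \<beta> = 2 * (\<alpha> / l powr \<beta>) / p \<longleftrightarrow> \<alpha>' = 2 * \<alpha> / p * (l' / l) powr \<beta>"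
    using assms(1-5) by (auto simp: powr_divide field_simps)
  then show ?thesis
    using bergman_projection_bounded_iff[OF w v assms(1)] by auto
qed

end
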